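(* Let $A$ be a regular weak multiplier Hopf algebra with a faithful left cointegral $h\in A$. With $E_t,E_s,S_1',S_2'$ as defined in the context, for any $a\in A$: (1) $\Delta(a)(1\otimes h)=E(a\otimes h)$; (2) $(1\otimes h)\Delta(a)=(a\otimes h)E_t$; (3) $\Delta(a)(h\otimes 1)=E(h\otimes a)$; (4) $(h\otimes 1)\Delta(a)=(h\otimes a)E_s$; (5) $(1\otimes a)\Delta(h)=(S(a)\otimes 1)\Delta(h)$; (6) $\Delta(h)(1\otimes a)=\Delta(h)(S_1'(a)\otimes 1)$; (7) $(a\otimes 1)\Delta(h)=(1\otimes S^{-1}(a))\Delta(h)$; (8) $\Delta(h)(a\otimes 1)=\Delta(h)(1\otimes S_2'(a))$.
   Context: All algebras are over $\mathbb{C}$, associative, possibly non-unital, with non-degenerate product. $A$ is idempotent if $A^2=A$; $M(A)$ is the multiplier algebra (identity $1$); $A'$ is the space of all linear functionals on $A$. A coproduct is a homomorphism $\Delta:A\to M(A\otimes A)$ with $\Delta(a)(1\otimes b),(a\otimes 1)\Delta(b)\in A\otimes A$, coassociative: $(a\otimes1\otimes1)(\Delta\otimes id)(\Delta(b)(1\otimes c))=(id\otimes\Delta)((a\otimes1)\Delta(b))(1\otimes1\otimes c)$. Put $T_1(a\otimes b)=\Delta(a)(1\otimes b)$, $T_2(a\otimes b)=(a\otimes1)\Delta(b)$. $\Delta$ is full if the smallest subspaces $V,W\subset A$ with $\Delta(A)(1\otimes A)\subset V\otimes A$ and $(A\otimes1)\Delta(A)\subset A\otimes W$ both equal $A$.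 A counit is a linear functional $\varepsilon$ with $(\varepsilon\otimes id)(\Delta(a)(1\otimes b))=ab$, $(id\otimes\varepsilon)((c\otimes1)\Delta(a))=ca$. A weak multiplier Hopf algebra is a non-degenerate idempotent algebra $A$ with a full coproduct $\Delta$ and a counit such that: (i) there is an idempotent $E\in M(A\otimes A)$ with $T_1(A\otimes A)=E(A\otimes A)$, $T_2(A\otimes A)=(A\otimes A)E$; (ii) $(id\otimes\Delta)E=(E\otimes1)(1\otimes E)=(1\otimes E)(E\otimes1)$; (iii) $\mathrm{Ker}(T_i)=(1-G_i)(A\otimes A)$, $i=1,2$, where $G_1,G_2$ are the linear maps on $A\otimes A$ given by $(G_1\otimes id)(\Delta_{13}(a)(1\otimes b\otimes c))=\Delta_{13}(a)(1\otimes E)(1\otimes b\otimes c)$ and $(id\otimes G_2)((a\otimes b\otimes1)\Delta_{13}(c))=(a\otimes b\otimes1)(E\otimes1)\Delta_{13}(c)$. Here $\Delta$ (and likewise $id\otimes\Delta$) is uniquely extended to multipliers, with $\Delta(1)=E$. With Sweedler notation $\Delta(a)=\sum a_{(1)}\otimes a_{(2)}$, the antipode $S$ is the non-degenerate anti-homomorphism $A\to M(A)$ with $E(a\otimes b)=\sum a_{(1)}\otimes a_{(2)}S(a_{(3)})b$, $(a\otimes b)E=\sum aS(b_{(1)})b_{(2)}\otimes b_{(3)}$, $G_1(a\otimes b)=\sum a_{(1)}\otimes S(a_{(2)})a_{(3)}b$, $G_2(a\otimes b)=\sum ab_{(1)}S(b_{(2)})\otimes b_{(3)}$, $\sum S(a_{(1)})a_{(2)}S(a_{(3)})=S(a)$;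 it extends to $M(A)$. $A$ is regular if $S$ is bijective from $A$ to $A$; then also $\Delta(a)(b\otimes1),(1\otimes a)\Delta(b)\in A\otimes A$. Put $\varepsilon_t(a)=\sum a_{(1)}S(a_{(2)})$, $A_s=\{y\in M(A):\Delta(y)=E(1\otimes y)\}$, $A_t=\{x\in M(A):\Delta(x)=(x\otimes1)E\}$. A left cointegral is a non-zero $h\in M(A)$ with $ah=\varepsilon_t(a)h$ for all $a\in A$. It is faithful if for $f\in A'$, $(id\otimes f)\Delta(h)=0$ or $(f\otimes id)\Delta(h)=0$ implies $f=0$. If $h\in A$ is a faithful left cointegral, then for each $a\in A$ one has $ha\in hA_t$ and $ha\in hA_s$, and maps $\gamma_t:A\to A_t$, $\gamma_s:A\to A_s$ are determined by $ha=h\gamma_t(a)$ and $ha=h\gamma_s(a)$. Notation: $(a\otimes1)E_t=(id\otimes\gamma_t)\Delta(a)$ and $(1\otimes a)E_s=(\gamma_s\otimes id)\Delta(a)$, so that $(a\otimes h)E_t$ means $(1\otimes h)(id\otimes\gamma_t)\Delta(a)$ and $(h\otimes a)E_s$ means $(h\otimes1)(\gamma_s\otimes id)\Delta(a)$, the expressions being understood after covering (e.g. multiplying by an element of $A$ in the other tensor factor). Finally $S_1'(a)=\sum\gamma_t(a_{(2)})S^{-1}(a_{(1)})$ and $S_2'(a)=\sum\gamma_s(a_{(1)})S(a_{(2)})$, elements of $M(A)$. *)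

theory Defs
  imports Complex_Main "HOL-Library.Poly_Mapping"
begin

section \<open>Complex vector spaces and algebras\<close>

class complex_vector = ab_group_add +
  fixes scaleC :: "complex \<Rightarrow> 'a \<Rightarrow> 'a" (infixr "*\<^sub>C" 75)
  assumes scaleC_add_right: "c *\<^sub>C (x + y) = c *\<^sub>C x + c *\<^sub>C y"
    and scaleC_add_left: "(c + d) *\<^sub>C x = c *\<^sub>C x + d *\<^sub>C x"
    and scaleC_scaleC: "c *\<^sub>C d *\<^sub>C x = (c * d) *\<^sub>C x"
    and scaleC_one: "1 *\<^sub>C x = x"

global_interpretation complex_vector: vector_space "scaleC :: complex \<Rightarrow> 'a \<Rightarrow> 'a::complex_vector"
  defines csubspace = complex_vector.subspace
    and cspan = complex_vector.span
  by unfold_locales (simp_all add: scaleC_add_right scaleC_add_left scaleC_scaleC scaleC_one)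

global_interpretation complex_vector_pair:
  vector_space_pair "scaleC :: complex \<Rightarrow> 'a \<Rightarrow> 'a::complex_vector"
    "scaleC :: complex \<Rightarrow> 'b \<Rightarrow> 'b::complex_vector"
  by unfold_locales

abbreviation clinear :: "('a::complex_vector \<Rightarrow> 'b::complex_vector) \<Rightarrow> bool"
  where "clinear f \<equiv> Vector_Spaces.linear scaleC scaleC f"

definition cbilinear :: "('a::complex_vector \<Rightarrow> 'b::complex_vector \<Rightarrow> 'c::complex_vector) \<Rightarrow> bool"
  where "cbilinear f \<longleftrightarrow> (\<forall>a. clinear (f a)) \<and> (\<forall>b. clinear (\<lambda>a. f a b))"

lemma clinear_iff:
  "clinear f \<longleftrightarrow> (\<forall>x y. f (x + y) = f x + f y) \<and> (\<forall>c x. f (c *\<^sub>C x) = c *\<^sub>C f x)"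
  by (simp add: Vector_Spaces.linear_iff complex_vector.vector_space_axioms)

lemma clinearI:
  assumes "\<And>x y. f (x + y) = f x + f y" "\<And>c x. f (c *\<^sub>C x) = c *\<^sub>C f x"
  shows "clinear f"
  using assms by (simp add: clinear_iff)

lemma clinear_add: "clinear f \<Longrightarrow> f (x + y) = f x + f y"
  and clinear_scale: "clinear f \<Longrightarrow> f (c *\<^sub>C x) = c *\<^sub>C f x"
  by (simp_all add: clinear_iff)

lemma clinear_zero: "clinear f \<Longrightarrow> f 0 = 0"
  by (rule complex_vector_pair.linear_0)

lemma clinear_diff: "clinear f \<Longrightarrow> f (x - y) = f x - f y"
  by (rule complex_vector_pair.linear_diff)

lemma clinear_minus: "clinear f \<Longrightarrow> f (- x) = - f x"
  by (rule complex_vector_pair.linear_neg)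

lemma clinear_sum: "clinear f \<Longrightarrow> f (\<Sum>i\<in>I. g i) = (\<Sum>i\<in>I. f (g i))"
  by (rule complex_vector_pair.linear_sum)

lemma clinear_compose: "clinear f \<Longrightarrow> clinear g \<Longrightarrow> clinear (\<lambda>x. g (f x))"
  by (simp add: clinear_iff)

lemma clinear_ident: "clinear (\<lambda>x. x)"
  by (simp add: clinear_iff)

lemma cbilinearI:
  assumes "\<And>a b b'. f a (b + b') = f a b + f a b'" "\<And>a c b. f a (c *\<^sub>C b) = c *\<^sub>C f a b"
    "\<And>a a' b. f (a + a') b = f a b + f a' b" "\<And>c a b. f (c *\<^sub>C a) b = c *\<^sub>C f a b"
  shows "cbilinear f"
  using assms by (simp add: cbilinear_def clinear_iff)

lemma cbilinear_add_right: "cbilinear f \<Longrightarrow> f a (b + b') = f a b + f a b'"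
  and cbilinear_scale_right: "cbilinear f \<Longrightarrow> f a (c *\<^sub>C b) = c *\<^sub>C f a b"
  and cbilinear_add_left: "cbilinear f \<Longrightarrow> f (a + a') b = f a b + f a' b"
  and cbilinear_scale_left: "cbilinear f \<Longrightarrow> f (c *\<^sub>C a) b = c *\<^sub>C f a b"
  by (simp_all add: cbilinear_def clinear_iff)

instantiation complex :: complex_vector
begin
definition "scaleC_complex (c::complex) (x::complex) = c * x"
instance
  by standard (simp_all add: scaleC_complex_def algebra_simps)
end

lemma exists_functional:
  fixes x :: "'a::complex_vector"
  assumes "x \<noteq> 0"
  shows "\<exists>f :: 'a \<Rightarrow> complex. clinear f \<and> f x = 1"
proof -
  have "\<not> complex_vector.dependent {x}"
    using assms by (simp add: complex_vector.dependent_single)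
  then obtain g :: "'a \<Rightarrow> complex" where "clinear g" "\<forall>y\<in>{x}. g y = (\<lambda>_. 1) y"
    using complex_vector_pair.linear_independent_extend[of "{x}" "\<lambda>_. 1 :: complex"] by blast
  then show ?thesis by auto
qed

text \<open>Algebras are associative but need not have an identity.\<close>

class complex_algebra = complex_vector + ring +
  assumes mult_scaleC_left: "(c *\<^sub>C x) * y = c *\<^sub>C (x * y)"
    and mult_scaleC_right: "x * (c *\<^sub>C y) = c *\<^sub>C (x * y)"

class nondegenerate_algebra = complex_algebra +
  assumes nondegenerate_left: "(\<And>b. a * b = 0) \<Longrightarrow> a = 0"
    and nondegenerate_right: "(\<And>b. b * a = 0) \<Longrightarrow> a = 0"

definition idempotent_algebra :: "'a::complex_algebra itself \<Rightarrow> bool"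
  where "idempotent_algebra _ \<longleftrightarrow> cspan {a * b | a b :: 'a. True} = UNIV"

definition algebra_hom :: "('a::complex_algebra \<Rightarrow> 'b::complex_algebra) \<Rightarrow> bool"
  where "algebra_hom f \<longleftrightarrow> clinear f \<and> (\<forall>a b. f (a * b) = f a * f b)"

definition algebra_antihom :: "('a::complex_algebra \<Rightarrow> 'b::complex_algebra) \<Rightarrow> bool"
  where "algebra_antihom f \<longleftrightarrow> clinear f \<and> (\<forall>a b. f (a * b) = f b * f a)"


section \<open>The algebraic tensor product\<close>

instantiation poly_mapping :: (type, complex_vector) complex_vector
begin
definition "scaleC_poly_mapping c (x :: 'a \<Rightarrow>\<^sub>0 'b) = Poly_Mapping.map ((*\<^sub>C) c) x"
lemma lookup_scaleC: "Poly_Mapping.lookup (c *\<^sub>C x) k = c *\<^sub>C Poly_Mapping.lookup (x :: 'a \<Rightarrow>\<^sub>0 'b) k"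
  by (cases "Poly_Mapping.lookup x k = 0")
    (simp_all add: scaleC_poly_mapping_def Poly_Mapping.map.rep_eq)
instance
  by standard
    (simp_all add: poly_mapping_eq_iff fun_eq_iff lookup_scaleC lookup_add
      scaleC_add_right scaleC_add_left scaleC_scaleC scaleC_one)
end

text \<open>The quotient of the vector space with basis \<^typ>\<open>'a \<times> 'b\<close> by the bilinearity relations.\<close>

definition tensor_relations :: "('a::complex_vector \<times> 'b::complex_vector \<Rightarrow>\<^sub>0 complex) set"
  where "tensor_relations =
    {Poly_Mapping.single (a + a', b) 1 - Poly_Mapping.single (a, b) 1
       - Poly_Mapping.single (a', b) 1 | a a' b. True} \<union>
    {Poly_Mapping.single (a, b + b') 1 - Poly_Mapping.single (a, b) 1
       - Poly_Mapping.single (a, b') 1 | a b b'. True} \<union>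
    {Poly_Mapping.single (c *\<^sub>C a, b) 1 - c *\<^sub>C Poly_Mapping.single (a, b) 1 | c a b. True} \<union>
    {Poly_Mapping.single (a, c *\<^sub>C b) 1 - c *\<^sub>C Poly_Mapping.single (a, b) 1 | c a b. True}"

definition tensor_rel ::
    "('a::complex_vector \<times> 'b::complex_vector \<Rightarrow>\<^sub>0 complex) \<Rightarrow> ('a \<times> 'b \<Rightarrow>\<^sub>0 complex) \<Rightarrow> bool"
  where "tensor_rel x y \<longleftrightarrow> x - y \<in> cspan tensor_relations"

quotient_type (overloaded) ('a, 'b) tensor (infixr "\<otimes>" 65) =
  "('a::complex_vector \<times> 'b::complex_vector) \<Rightarrow>\<^sub>0 complex" / tensor_rel
proof (rule equivpI)
  show "reflp tensor_rel"
    by (simp add: reflp_def tensor_rel_def complex_vector.span_zero)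
  show "symp tensor_rel"
    unfolding symp_def tensor_rel_def
    by (metis complex_vector.span_neg minus_diff_eq)
  show "transp tensor_rel"
    unfolding transp_def tensor_rel_def
    using complex_vector.span_add by fastforce
qed

instantiation tensor :: (complex_vector, complex_vector) complex_vector
begin
lift_definition zero_tensor :: "('a, 'b) tensor" is 0 .
lift_definition plus_tensor :: "('a, 'b) tensor \<Rightarrow> ('a, 'b) tensor \<Rightarrow> ('a, 'b) tensor" is "(+)"
  unfolding tensor_rel_def
  by (drule complex_vector.span_add, assumption) (simp add: algebra_simps)
lift_definition uminus_tensor :: "('a, 'b) tensor \<Rightarrow> ('a, 'b) tensor" is uminus
  unfolding tensor_rel_def by (metis complex_vector.span_neg minus_diff_minus)
lift_definition minus_tensor :: "('a, 'b) tensor \<Rightarrow> ('a, 'b) tensor \<Rightarrow> ('a, 'b) tensor" is "(-)"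
  unfolding tensor_rel_def
  by (drule complex_vector.span_diff, assumption) (simp add: algebra_simps)
lift_definition scaleC_tensor :: "complex \<Rightarrow> ('a, 'b) tensor \<Rightarrow> ('a, 'b) tensor" is "(*\<^sub>C)"
  unfolding tensor_rel_def
  by (metis complex_vector.scale_right_diff_distrib complex_vector.span_scale)
instance
proof
  fix x y z :: "('a, 'b) tensor" and c d :: complex
  have refl: "tensor_rel u u" for u :: "'a \<times> 'b \<Rightarrow>\<^sub>0 complex"
    by (simp add: tensor_rel_def complex_vector.span_zero)
  show "x + y + z = x + (y + z)" by transfer (simp add: add.assoc refl)
  show "x + y = y + x" by transfer (simp add: add.commute refl)
  show "0 + x = x" by transfer (simp add: refl)
  show "- x + x = 0" by transfer (simp add: refl)
  show "x - y = x + - y" by transfer (simp add: refl)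
  show "c *\<^sub>C (x + y) = c *\<^sub>C x + c *\<^sub>C y" by transfer (simp add: scaleC_add_right refl)
  show "(c + d) *\<^sub>C x = c *\<^sub>C x + d *\<^sub>C x" by transfer (simp add: scaleC_add_left refl)
  show "c *\<^sub>C d *\<^sub>C x = (c * d) *\<^sub>C x" by transfer (simp add: scaleC_scaleC refl)
  show "1 *\<^sub>C x = x" by transfer (simp add: scaleC_one refl)
qed
end

lift_definition pure_tensor :: "'a::complex_vector \<Rightarrow> 'b::complex_vector \<Rightarrow> ('a, 'b) tensor"
    (infixr "\<otimes>" 75)
  is "\<lambda>a b. Poly_Mapping.single (a, b) 1" .

lemma cbilinear_pure_tensor: "cbilinear pure_tensor"
proof (rule cbilinearI)
  fix a a' :: 'a and b b' :: 'b and c :: complex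
  show "a \<otimes> (b + b') = a \<otimes> b + a \<otimes> b'"
    by transfer (unfold tensor_rel_def diff_diff_add[symmetric],
      rule complex_vector.span_base, unfold tensor_relations_def, blast)
  show "(a + a') \<otimes> b = a \<otimes> b + a' \<otimes> b"
    by transfer (unfold tensor_rel_def diff_diff_add[symmetric],
      rule complex_vector.span_base, unfold tensor_relations_def, blast)
  show "a \<otimes> (c *\<^sub>C b) = c *\<^sub>C (a \<otimes> b)"
    by transfer (unfold tensor_rel_def,
      rule complex_vector.span_base, unfold tensor_relations_def, blast)
  show "(c *\<^sub>C a) \<otimes> b = c *\<^sub>C (a \<otimes> b)"
    by transfer (unfold tensor_rel_def,
      rule complex_vector.span_base, unfold tensor_relations_def, blast)
qed

lemmas pure_tensor_simps =
  cbilinear_add_right[OF cbilinear_pure_tensor] cbilinear_scale_right[OF cbilinear_pure_tensor]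
  cbilinear_add_left[OF cbilinear_pure_tensor] cbilinear_scale_left[OF cbilinear_pure_tensor]

lemma pure_tensor_zero_left: "0 \<otimes> b = 0"
  using pure_tensor_simps(4)[of 0 0 b] by simp

definition free_lift :: "('a \<times> 'b \<Rightarrow> 'c::complex_vector) \<Rightarrow> ('a \<times> 'b \<Rightarrow>\<^sub>0 complex) \<Rightarrow> 'c"
  where "free_lift f x = (\<Sum>p\<in>Poly_Mapping.keys x. Poly_Mapping.lookup x p *\<^sub>C f p)"

text \<open>For bilinear \<open>f\<close>, the linear map on the tensor product with \<open>a \<otimes> b \<mapsto> f a b\<close>.\<close>

definition tensor_lift ::
    "('a::complex_vector \<Rightarrow> 'b::complex_vector \<Rightarrow> 'c::complex_vector) \<Rightarrow> ('a, 'b) tensor \<Rightarrow> 'c"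
  where "tensor_lift f t = free_lift (\<lambda>(a, b). f a b) (rep_tensor t)"

lemma free_lift_superset:
  assumes "finite K" "Poly_Mapping.keys x \<subseteq> K"
  shows "free_lift f x = (\<Sum>p\<in>K. Poly_Mapping.lookup x p *\<^sub>C f p)"
  unfolding free_lift_def
  by (rule sum.mono_neutral_left) (use assms in \<open>auto simp: in_keys_iff\<close>)

lemma clinear_free_lift: "clinear (free_lift f)"
proof (rule clinearI)
  fix x y :: "'a \<times> 'b \<Rightarrow>\<^sub>0 complex" and c :: complex
  let ?K = "Poly_Mapping.keys x \<union> Poly_Mapping.keys y"
  have "free_lift f (x + y) = (\<Sum>p\<in>?K. Poly_Mapping.lookup (x + y) p *\<^sub>C f p)"
    by (rule free_lift_superset) (auto simp: keys_add)
  also have "\<dots> = (\<Sum>p\<in>?K. Poly_Mapping.lookup x p *\<^sub>C f p) + (\<Sum>p\<in>?K. Poly_Mapping.lookup y p *\<^sub>C f p)"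
    by (simp add: lookup_add scaleC_add_left sum.distrib)
  also have "\<dots> = free_lift f x + free_lift f y"
    by (simp add: free_lift_superset[of ?K])
  finally show "free_lift f (x + y) = free_lift f x + free_lift f y" .
  have "free_lift f (c *\<^sub>C x) = (\<Sum>p\<in>Poly_Mapping.keys x. Poly_Mapping.lookup (c *\<^sub>C x) p *\<^sub>C f p)"
    by (rule free_lift_superset) (auto simp: in_keys_iff lookup_scaleC scaleC_complex_def)
  then show "free_lift f (c *\<^sub>C x) = c *\<^sub>C free_lift f x"
    by (simp add: lookup_scaleC scaleC_complex_def free_lift_def scaleC_scaleC
        complex_vector.scale_sum_right)
qed

lemma free_lift_single: "free_lift f (Poly_Mapping.single p c) = c *\<^sub>C f p"
  by (simp add: free_lift_def)

lemma free_lift_cong_rel: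
  assumes f: "cbilinear f" and xy: "tensor_rel x y"
  shows "free_lift (\<lambda>(a, b). f a b) x = free_lift (\<lambda>(a, b). f a b) y"
proof -
  let ?F = "free_lift (\<lambda>(a, b). f a b)"
  have lin: "clinear ?F" by (rule clinear_free_lift)
  have "?F z = 0" if "z \<in> cspan tensor_relations" for z
    using that
  proof (rule complex_vector_pair.linear_eq_0_on_span[OF lin, rotated])
    fix z :: "'a \<times> 'b \<Rightarrow>\<^sub>0 complex"
    assume "z \<in> tensor_relations"
    then show "?F z = 0"
      unfolding tensor_relations_def
      by (auto simp: clinear_diff[OF lin] clinear_scale[OF lin] free_lift_single scaleC_one
          cbilinear_add_right[OF f] cbilinear_scale_right[OF f]
          cbilinear_add_left[OF f] cbilinear_scale_left[OF f])
  qed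
  from this[OF xy[unfolded tensor_rel_def]] show ?thesis
    by (simp add: clinear_diff[OF lin])
qed

lemma tensor_lift_abs:
  assumes "cbilinear f"
  shows "tensor_lift f (abs_tensor x) = free_lift (\<lambda>(a, b). f a b) x"
  unfolding tensor_lift_def
  by (rule free_lift_cong_rel[OF assms]) (rule Quotient3_rep_abs[OF Quotient3_tensor],
      simp add: tensor_rel_def complex_vector.span_zero)

lemma tensor_lift_pure: "cbilinear f \<Longrightarrow> tensor_lift f (a \<otimes> b) = f a b"
  by (simp add: pure_tensor.abs_eq tensor_lift_abs free_lift_single scaleC_one)

lemma clinear_tensor_lift:
  assumes "cbilinear f" shows "clinear (tensor_lift f)"
proof (rule clinearI)
  fix x y :: "('a, 'b) tensor" and c :: complex
  obtain u v where [simp]: "x = abs_tensor u" "y = abs_tensor v"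
    by (metis Quotient3_abs_rep[OF Quotient3_tensor])
  show "tensor_lift f (x + y) = tensor_lift f x + tensor_lift f y"
    by (simp add: plus_tensor.abs_eq tensor_lift_abs[OF assms] clinear_add[OF clinear_free_lift])
  show "tensor_lift f (c *\<^sub>C x) = c *\<^sub>C tensor_lift f x"
    by (simp add: scaleC_tensor.abs_eq tensor_lift_abs[OF assms]
        clinear_scale[OF clinear_free_lift])
qed

lemma tensor_induct [case_names pure add, induct type: tensor]:
  fixes t :: "('a::complex_vector, 'b::complex_vector) tensor"
  assumes pure: "\<And>a b. P (a \<otimes> b)" and add: "\<And>x y. P x \<Longrightarrow> P y \<Longrightarrow> P (x + y)"
  shows "P t"
proof -
  have zero: "P 0"
    using pure[of 0 0] by (simp add: pure_tensor_zero_left)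
  have "P (abs_tensor u)" for u :: "'a \<times> 'b \<Rightarrow>\<^sub>0 complex"
  proof (induct "card (Poly_Mapping.keys u)" arbitrary: u)
    case 0
    then have "u = 0" by simp
    then show ?case using zero by (simp add: zero_tensor.abs_eq)
  next
    case (Suc n)
    then obtain p where p: "p \<in> Poly_Mapping.keys u" by (metis card_eq_0_iff equals0I nat.distinct(1))
    obtain a b where ab: "p = (a, b)" by (cases p)
    let ?s = "Poly_Mapping.single p (Poly_Mapping.lookup u p)"
    have "Poly_Mapping.keys (u - ?s) = Poly_Mapping.keys u - {p}"
      by (auto simp: in_keys_iff lookup_minus lookup_single when_def split: if_splits)
    then have "P (abs_tensor (u - ?s))"
      using Suc p by (metis card_Diff_singleton diff_Suc_1)
    moreover have "?s = Poly_Mapping.lookup u p *\<^sub>C Poly_Mapping.single p 1"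
      by (rule poly_mapping_eqI) (simp add: lookup_scaleC lookup_single when_def scaleC_complex_def)
    then have "abs_tensor ?s = Poly_Mapping.lookup u p *\<^sub>C (a \<otimes> b)"
      by (simp add: ab pure_tensor.abs_eq scaleC_tensor.abs_eq)
    then have "abs_tensor ?s = (Poly_Mapping.lookup u p *\<^sub>C a) \<otimes> b"
      by (simp add: pure_tensor_simps)
    then have "P (abs_tensor ?s)" by (simp add: pure)
    ultimately have "P (abs_tensor (u - ?s) + abs_tensor ?s)" by (rule add)
    then show ?case by (simp add: plus_tensor.abs_eq)
  qed
  then show ?thesis by (metis Quotient3_abs_rep[OF Quotient3_tensor])
qed

lemma clinear_tensor_eqI:
  assumes "clinear f" "clinear g" "\<And>a b. f (a \<otimes> b) = g (a \<otimes> b)"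
  shows "f t = g t"
  by (induct t) (simp_all add: assms clinear_add[OF assms(1)] clinear_add[OF assms(2)])

definition tensor_map :: "('a::complex_vector \<Rightarrow> 'c::complex_vector) \<Rightarrow>
    ('b::complex_vector \<Rightarrow> 'd::complex_vector) \<Rightarrow> ('a, 'b) tensor \<Rightarrow> ('c, 'd) tensor"
  where "tensor_map f g = tensor_lift (\<lambda>a b. f a \<otimes> g b)"

lemma cbilinear_tensor_map:
  assumes "clinear f" "clinear g"
  shows "cbilinear (\<lambda>a b. f a \<otimes> g b)"
  by (rule cbilinearI) (simp_all add: clinear_add[OF assms(1)] clinear_scale[OF assms(1)]
      clinear_add[OF assms(2)] clinear_scale[OF assms(2)] pure_tensor_simps)

lemma clinear_tensor_map: "clinear f \<Longrightarrow> clinear g \<Longrightarrow> clinear (tensor_map f g)"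
  unfolding tensor_map_def by (intro clinear_tensor_lift cbilinear_tensor_map)

lemma tensor_map_pure:
  "clinear f \<Longrightarrow> clinear g \<Longrightarrow> tensor_map f g (a \<otimes> b) = f a \<otimes> g b"
  unfolding tensor_map_def by (simp add: tensor_lift_pure cbilinear_tensor_map)

definition slice_left :: "('a::complex_vector \<Rightarrow> complex) \<Rightarrow> ('a, 'b::complex_vector) tensor \<Rightarrow> 'b"
  where "slice_left f = tensor_lift (\<lambda>a b. f a *\<^sub>C b)"

definition slice_right :: "('b::complex_vector \<Rightarrow> complex) \<Rightarrow> ('a::complex_vector, 'b) tensor \<Rightarrow> 'a"
  where "slice_right f = tensor_lift (\<lambda>a b. f b *\<^sub>C a)"

lemma cbilinear_slice_left: "clinear f \<Longrightarrow> cbilinear (\<lambda>a b. f a *\<^sub>C b)"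
  by (simp add: cbilinear_def clinear_iff scaleC_add_right scaleC_add_left scaleC_scaleC
      scaleC_complex_def mult.commute)

lemma cbilinear_slice_right: "clinear f \<Longrightarrow> cbilinear (\<lambda>a b. f b *\<^sub>C a)"
  by (simp add: cbilinear_def clinear_iff scaleC_add_right scaleC_add_left scaleC_scaleC
      scaleC_complex_def mult.commute)

lemma clinear_slice_left: "clinear f \<Longrightarrow> clinear (slice_left f)"
  unfolding slice_left_def by (intro clinear_tensor_lift cbilinear_slice_left)

lemma clinear_slice_right: "clinear f \<Longrightarrow> clinear (slice_right f)"
  unfolding slice_right_def by (intro clinear_tensor_lift cbilinear_slice_right)

lemma slice_left_pure: "clinear f \<Longrightarrow> slice_left f (a \<otimes> b) = f a *\<^sub>C b"
  unfolding slice_left_def by (simp add: tensor_lift_pure cbilinear_slice_left)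

lemma slice_right_pure: "clinear f \<Longrightarrow> slice_right f (a \<otimes> b) = f b *\<^sub>C a"
  unfolding slice_right_def by (simp add: tensor_lift_pure cbilinear_slice_right)

definition tensor_flip :: "('a::complex_vector, 'b::complex_vector) tensor \<Rightarrow> ('b, 'a) tensor"
  where "tensor_flip = tensor_lift (\<lambda>a b. b \<otimes> a)"

definition tensor_assoc :: "(('a::complex_vector, 'b::complex_vector) tensor, 'c::complex_vector) tensor
    \<Rightarrow> ('a, ('b, 'c) tensor) tensor"
  where "tensor_assoc = tensor_lift (\<lambda>t c. tensor_lift (\<lambda>a b. a \<otimes> (b \<otimes> c)) t)"

lemma tensor_lift_add_fun:
  assumes "cbilinear f" "cbilinear g"
  shows "tensor_lift (\<lambda>a b. f a b + g a b) t = tensor_lift f t + tensor_lift g t"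
proof -
  have "cbilinear (\<lambda>a b. f a b + g a b)"
    using assms by (auto simp: cbilinear_def clinear_iff algebra_simps scaleC_add_right)
  then show ?thesis
    by (induct t) (simp_all add: assms tensor_lift_pure clinear_add[OF clinear_tensor_lift])
qed

lemma tensor_lift_scale_fun:
  assumes "cbilinear f"
  shows "tensor_lift (\<lambda>a b. c *\<^sub>C f a b) t = c *\<^sub>C tensor_lift f t"
proof -
  have "cbilinear (\<lambda>a b. c *\<^sub>C f a b)"
    using assms by (auto simp: cbilinear_def clinear_iff scaleC_add_right scaleC_scaleC mult.commute)
  then show ?thesis
    by (induct t) (simp_all add: assms tensor_lift_pure clinear_add[OF clinear_tensor_lift]
        scaleC_add_right)
qed

lemma cbilinear_tensor_assoc:
  "cbilinear (\<lambda>t c. tensor_lift (\<lambda>a b. a \<otimes> (b \<otimes> c)) t)"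
proof -
  have b: "cbilinear (\<lambda>a b. a \<otimes> (b \<otimes> c))" for c :: 'c
    by (rule cbilinearI) (simp_all add: pure_tensor_simps)
  show ?thesis
    by (rule cbilinearI) (simp_all add: pure_tensor_simps tensor_lift_add_fun tensor_lift_scale_fun b
        clinear_add[OF clinear_tensor_lift] clinear_scale[OF clinear_tensor_lift])
qed

lemma tensor_assoc_pure: "tensor_assoc ((a \<otimes> b) \<otimes> c) = a \<otimes> (b \<otimes> c)"
proof -
  have b: "cbilinear (\<lambda>a b. a \<otimes> (b \<otimes> c))"
    by (rule cbilinearI) (simp_all add: pure_tensor_simps)
  show ?thesis
    unfolding tensor_assoc_def by (simp add: tensor_lift_pure cbilinear_tensor_assoc b)
qed

lemma cbilinear_flip: "cbilinear (\<lambda>a b. b \<otimes> a)"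
  by (rule cbilinearI) (simp_all add: pure_tensor_simps)

lemma tensor_flip_pure: "tensor_flip (a \<otimes> b) = b \<otimes> a"
  unfolding tensor_flip_def by (rule tensor_lift_pure[OF cbilinear_flip])

lemma clinear_tensor_flip: "clinear tensor_flip"
  unfolding tensor_flip_def by (rule clinear_tensor_lift[OF cbilinear_flip])

lemma clinear_tensor_assoc: "clinear tensor_assoc"
  unfolding tensor_assoc_def by (rule clinear_tensor_lift[OF cbilinear_tensor_assoc])

lemma tensor_flip_flip: "tensor_flip (tensor_flip t) = t"
  by (induct t) (simp_all add: tensor_flip_pure clinear_add[OF clinear_tensor_flip])

lemma tensor_map_flip_flip:
  "tensor_map (\<lambda>a. a) tensor_flip (tensor_map (\<lambda>a. a) tensor_flip t) = t"
  by (induct t) (simp_all add: tensor_flip_flip tensor_map_pure[OF clinear_ident clinear_tensor_flip]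
      clinear_add[OF clinear_tensor_map[OF clinear_ident clinear_tensor_flip]])

lemma bij_tensor_map_flip: "bij (tensor_map (\<lambda>a. a) tensor_flip)"
  by (rule o_bij[of "tensor_map (\<lambda>a. a) tensor_flip"]) (simp_all add: fun_eq_iff tensor_map_flip_flip)

lemma bij_tensor_assoc:
  "bij (tensor_assoc :: (('a::complex_vector, 'b::complex_vector) tensor, 'c::complex_vector) tensor \<Rightarrow> _)"
proof -
  let ?f = "tensor_assoc :: (('a, 'b) tensor, 'c) tensor \<Rightarrow> _"
  let ?B = "\<lambda>(a::'a) (b::'b) (c::'c). (a \<otimes> b) \<otimes> c"
  let ?g = "tensor_lift (\<lambda>a t. tensor_lift (?B a) t)"
  have b: "cbilinear (?B a)" for a
    by (rule cbilinearI) (simp_all add: pure_tensor_simps)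
  have b2: "cbilinear (\<lambda>a t. tensor_lift (?B a) t)"
    by (rule cbilinearI) (simp_all add: pure_tensor_simps tensor_lift_add_fun tensor_lift_scale_fun b
        clinear_add[OF clinear_tensor_lift] clinear_scale[OF clinear_tensor_lift])
  have g: "?g (a \<otimes> (b \<otimes> c)) = (a \<otimes> b) \<otimes> c" for a b c
    by (rule trans[OF tensor_lift_pure[OF b2]]) (rule tensor_lift_pure[OF b])
  note add = clinear_add[OF clinear_tensor_assoc] clinear_add[OF clinear_tensor_lift[OF b2]]
    pure_tensor_simps
  have "?g (?f t) = t" for t
  proof (induct t)
    case (pure s c)
    show ?case by (induct s) (simp_all add: tensor_assoc_pure g add)
  qed (simp add: add)
  moreover have "?f (?g t) = t" for t
  proof (induct t)
    case (pure a s)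
    show ?case by (induct s) (simp_all add: tensor_assoc_pure g add)
  qed (simp add: add)
  ultimately show ?thesis by (intro o_bij[of ?g]) (simp_all add: fun_eq_iff)
qed

instantiation tensor :: (complex_algebra, complex_algebra) complex_algebra
begin
definition times_tensor :: "('a, 'b) tensor \<Rightarrow> ('a, 'b) tensor \<Rightarrow> ('a, 'b) tensor"
  where "s * t = tensor_lift (\<lambda>a b. tensor_lift (\<lambda>c d. (a * c) \<otimes> (b * d)) t) s"

lemma cbilinear_times_aux: "cbilinear (\<lambda>c d. (a * c) \<otimes> (b * d))"
  for a :: "'a::complex_algebra" and b :: "'b::complex_algebra"
  by (rule cbilinearI) (simp_all add: pure_tensor_simps distrib_left mult_scaleC_right)

lemma cbilinear_times_aux2: "cbilinear (\<lambda>a b. tensor_lift (\<lambda>c d. (a * c) \<otimes> (b * d)) t)"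
  for t :: "('a::complex_algebra, 'b::complex_algebra) tensor"
  by (rule cbilinearI) (simp_all add: pure_tensor_simps distrib_right mult_scaleC_left
      tensor_lift_add_fun tensor_lift_scale_fun cbilinear_times_aux)

lemma times_tensor_pure: "(a \<otimes> b) * (c \<otimes> d) = (a * c) \<otimes> (b * d)"
  for a c :: "'a::complex_algebra" and b d :: "'b::complex_algebra"
  unfolding times_tensor_def
  by (rule trans[OF tensor_lift_pure[OF cbilinear_times_aux2]])
    (rule tensor_lift_pure[OF cbilinear_times_aux])

lemma cbilinear_times_tensor: "cbilinear (times :: ('a, 'b) tensor \<Rightarrow> _ \<Rightarrow> _)"
proof (rule cbilinearI)
  fix x y z :: "('a, 'b) tensor" and c :: complex
  show "(x + y) * z = x * z + y * z" "(c *\<^sub>C x) * z = c *\<^sub>C (x * z)"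
    unfolding times_tensor_def
    by (simp_all add: clinear_add[OF clinear_tensor_lift[OF cbilinear_times_aux2]]
        clinear_scale[OF clinear_tensor_lift[OF cbilinear_times_aux2]])
  have *: "tensor_lift (\<lambda>c d. (a * c) \<otimes> (b * d)) (y + z)
      = tensor_lift (\<lambda>c d. (a * c) \<otimes> (b * d)) y + tensor_lift (\<lambda>c d. (a * c) \<otimes> (b * d)) z"
    for a :: 'a and b :: 'b
    by (rule clinear_add[OF clinear_tensor_lift[OF cbilinear_times_aux]])
  have **: "tensor_lift (\<lambda>p q. (a * p) \<otimes> (b * q)) (c *\<^sub>C z)
      = c *\<^sub>C tensor_lift (\<lambda>c d. (a * c) \<otimes> (b * d)) z" for a :: 'a and b :: 'b
    by (rule clinear_scale[OF clinear_tensor_lift[OF cbilinear_times_aux]])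
  show "x * (y + z) = x * y + x * z" "x * (c *\<^sub>C z) = c *\<^sub>C (x * z)"
    unfolding times_tensor_def * **
    by (simp_all add: tensor_lift_add_fun tensor_lift_scale_fun cbilinear_times_aux2)
qed

instance
proof
  fix x y z :: "('a, 'b) tensor" and c :: complex
  note B = cbilinear_times_tensor
  note lin = cbilinear_add_left[OF B] cbilinear_add_right[OF B]
  show "(x + y) * z = x * z + y * z" "x * (y + z) = x * y + x * z"
    by (rule lin)+
  show "(c *\<^sub>C x) * y = c *\<^sub>C (x * y)" "x * (c *\<^sub>C y) = c *\<^sub>C (x * y)"
    by (rule cbilinear_scale_left[OF B] cbilinear_scale_right[OF B])+
  show "x * y * z = x * (y * z)"
  proof (induct x)
    case (pure a b)
    show ?case
    proof (induct y)
      case (pure a' b')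
      show ?case by (induct z) (simp_all add: times_tensor_pure mult.assoc lin)
    qed (simp add: lin)
  qed (simp add: lin)
qed
end

lemma algebra_hom_tensor_flip: "algebra_hom tensor_flip"
proof -
  have "tensor_flip (s * t) = tensor_flip s * tensor_flip t" for s t :: "('a, 'b) tensor"
  proof (induct s)
    case (pure a b)
    show ?case by (induct t) (simp_all add: tensor_flip_pure times_tensor_pure distrib_left
          clinear_add[OF clinear_tensor_flip])
  qed (simp add: distrib_right clinear_add[OF clinear_tensor_flip])
  then show ?thesis by (simp add: algebra_hom_def clinear_tensor_flip)
qed

lemma algebra_hom_tensor_map:
  assumes "algebra_hom f" "algebra_hom g"
  shows "algebra_hom (tensor_map f g)"
proof -
  have lin: "clinear f" "clinear g" using assms by (simp_all add: algebra_hom_def)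
  note P = tensor_map_pure[OF lin] clinear_add[OF clinear_tensor_map[OF lin]] times_tensor_pure
    distrib_left distrib_right assms[unfolded algebra_hom_def]
  have "tensor_map f g (s * t) = tensor_map f g s * tensor_map f g t" for s t
  proof (induct s)
    case (pure a b) show ?case by (induct t) (simp_all add: P)
  qed (simp add: P)
  then show ?thesis by (simp add: algebra_hom_def clinear_tensor_map lin)
qed

lemma algebra_hom_tensor_assoc: "algebra_hom tensor_assoc"
proof -
  note P = tensor_assoc_pure clinear_add[OF clinear_tensor_assoc] times_tensor_pure
    distrib_left distrib_right pure_tensor_simps
  have "tensor_assoc (s * t) = tensor_assoc s * tensor_assoc t"
    for s t :: "(('a, 'b) tensor, 'c) tensor"
  proof (induct s)
    case (pure u c)
    show ?case
    proof (induct u)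
      case (pure a b)
      show ?case
      proof (induct t)
        case (pure v c')
        show ?case by (induct v) (simp_all add: P)
      qed (simp add: P)
    qed (simp add: P)
  qed (simp add: P)
  then show ?thesis by (simp add: algebra_hom_def clinear_tensor_assoc)
qed

lemma tensor_basis_representation:
  fixes t :: "('a::complex_vector, 'b::complex_vector) tensor"
  assumes "\<And>x. x \<in> complex_vector.span B"
  shows "\<exists>F g. finite F \<and> F \<subseteq> B \<and> t = (\<Sum>b\<in>F. g b \<otimes> b)"
proof (induct t)
  case (pure a b)
  obtain F r where F: "finite F" "F \<subseteq> B" "b = (\<Sum>x\<in>F. r x *\<^sub>C x)"
    using assms[of b] unfolding complex_vector.span_explicit by blast
  have lin: "clinear ((\<otimes>) a)"
    using cbilinear_pure_tensor by (auto simp: cbilinear_def)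
  have "a \<otimes> b = (\<Sum>x\<in>F. (r x *\<^sub>C a) \<otimes> x)"
    by (simp add: F(3) clinear_sum[OF lin] pure_tensor_simps)
  with F show ?case by (intro exI[of _ F] exI[of _ "\<lambda>x. r x *\<^sub>C a"]) simp
next
  case (add x y)
  then obtain F g G h where *: "finite F" "F \<subseteq> B" "x = (\<Sum>b\<in>F. g b \<otimes> b)"
    "finite G" "G \<subseteq> B" "y = (\<Sum>b\<in>G. h b \<otimes> b)" by blast
  have zero: "0 \<otimes> b = (0 :: ('a, 'b) tensor)" for b :: 'b
    by (rule pure_tensor_zero_left)
  have "x = (\<Sum>b\<in>F \<union> G. (if b \<in> F then g b else 0) \<otimes> b)"
    unfolding *(3) by (rule sum.mono_neutral_cong_left) (use * zero in auto)
  moreover have "y = (\<Sum>b\<in>F \<union> G. (if b \<in> G then h b else 0) \<otimes> b)"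
    unfolding *(6) by (rule sum.mono_neutral_cong_left) (use * zero in auto)
  ultimately have
    "x + y = (\<Sum>b\<in>F \<union> G. ((if b \<in> F then g b else 0) + (if b \<in> G then h b else 0)) \<otimes> b)"
    by (simp add: sum.distrib pure_tensor_simps)
  with * show ?case by (intro exI[of _ "F \<union> G"] exI) auto
qed

lemma tensor_eq_0I:
  fixes t :: "('a::complex_vector, 'b::complex_vector) tensor"
  assumes "\<And>f. clinear f \<Longrightarrow> slice_right f t = 0"
  shows "t = 0"
proof -
  obtain B :: "'b set" where B: "complex_vector.independent B" "\<And>x. x \<in> complex_vector.span B"
    using complex_vector.independent_extend_basis[OF complex_vector.independent_empty]
      complex_vector.span_extend_basis[OF complex_vector.independent_empty] by (metis UNIV_I)
  obtain F g where F: "finite F" "F \<subseteq> B" "t = (\<Sum>b\<in>F. g b \<otimes> b)"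
    using tensor_basis_representation[OF B(2)] by blast
  have "g b = 0" if b: "b \<in> F" for b
  proof -
    obtain f :: "'b \<Rightarrow> complex" where f: "clinear f" "\<forall>x\<in>B. f x = (if x = b then 1 else 0)"
      using complex_vector_pair.linear_independent_extend[OF B(1), of "\<lambda>x. if x = b then 1 else 0 :: complex"]
      by blast
    have "0 = slice_right f t" using assms[OF f(1)] by simp
    also have "\<dots> = (\<Sum>x\<in>F. f x *\<^sub>C g x)"
      by (simp add: F(3) clinear_sum[OF clinear_slice_right[OF f(1)]] slice_right_pure[OF f(1)])
    also have "\<dots> = (\<Sum>x\<in>F. if x = b then g x else 0)"
      using f(2) F(2) by (intro sum.cong) (auto simp: scaleC_one)
    also have "\<dots> = g b" using b F(1) by simp
    finally show ?thesis by simp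
  qed
  moreover have "0 \<otimes> b = (0 :: ('a, 'b) tensor)" for b :: 'b
    by (rule pure_tensor_zero_left)
  ultimately show ?thesis by (simp add: F(3))
qed

instance tensor :: (nondegenerate_algebra, nondegenerate_algebra) nondegenerate_algebra
proof
  fix t :: "('a, 'b) tensor"
  note B = cbilinear_times_tensor[where ?'a = 'a and ?'b = 'b]
  show "t = 0" if z: "\<And>u. t * u = 0"
  proof (rule tensor_eq_0I)
    fix f :: "'b \<Rightarrow> complex" assume f: "clinear f"
    show "slice_right f t = 0"
    proof (rule ccontr)
      assume "slice_right f t \<noteq> 0"
      then obtain a where "slice_right f t * a \<noteq> 0" using nondegenerate_left[of "slice_right f t"] by blast
      then obtain g :: "'a \<Rightarrow> complex" where g: "clinear g" "g (slice_right f t * a) = 1"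
        using exists_functional[of "slice_right f t * a"] by blast
      have ga: "clinear (\<lambda>x. g (x * a))"
        using g(1) by (simp add: clinear_iff distrib_right mult_scaleC_left)
      have 1: "slice_left g (t * (a \<otimes> b)) = slice_left (\<lambda>x. g (x * a)) t * b" for b
        by (induct t) (simp_all add: times_tensor_pure slice_left_pure[OF g(1)] slice_left_pure[OF ga]
            mult_scaleC_left cbilinear_add_left[OF B] distrib_right
            clinear_add[OF clinear_slice_left[OF g(1)]] clinear_add[OF clinear_slice_left[OF ga]])
      have "slice_left (\<lambda>x. g (x * a)) t = 0"
        by (rule nondegenerate_left) (simp flip: 1 add: z clinear_zero[OF clinear_slice_left[OF g(1)]])
      moreover have "f (slice_left (\<lambda>x. g (x * a)) t) = g (slice_right f t * a)"
        by (induct t) (simp_all add: slice_left_pure[OF ga] slice_right_pure[OF f]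
            clinear_scale[OF f] clinear_scale[OF g(1)] mult_scaleC_left scaleC_complex_def mult.commute
            clinear_add[OF f] clinear_add[OF g(1)] distrib_right
            clinear_add[OF clinear_slice_right[OF f]] clinear_add[OF clinear_slice_left[OF ga]])
      ultimately show False using g(2) clinear_zero[OF f] by simp
    qed
  qed
  show "t = 0" if z: "\<And>u. u * t = 0"
  proof (rule tensor_eq_0I)
    fix f :: "'b \<Rightarrow> complex" assume f: "clinear f"
    show "slice_right f t = 0"
    proof (rule ccontr)
      assume "slice_right f t \<noteq> 0"
      then obtain a where "a * slice_right f t \<noteq> 0" using nondegenerate_right[of "slice_right f t"] by blast
      then obtain g :: "'a \<Rightarrow> complex" where g: "clinear g" "g (a * slice_right f t) = 1"
        using exists_functional[of "a * slice_right f t"] by blast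
      have ga: "clinear (\<lambda>x. g (a * x))"
        using g(1) by (simp add: clinear_iff distrib_left mult_scaleC_right)
      have 1: "slice_left g ((a \<otimes> b) * t) = b * slice_left (\<lambda>x. g (a * x)) t" for b
        by (induct t) (simp_all add: times_tensor_pure slice_left_pure[OF g(1)] slice_left_pure[OF ga]
            mult_scaleC_right cbilinear_add_right[OF B] distrib_left
            clinear_add[OF clinear_slice_left[OF g(1)]] clinear_add[OF clinear_slice_left[OF ga]])
      have "slice_left (\<lambda>x. g (a * x)) t = 0"
        by (rule nondegenerate_right) (simp flip: 1 add: z clinear_zero[OF clinear_slice_left[OF g(1)]])
      moreover have "f (slice_left (\<lambda>x. g (a * x)) t) = g (a * slice_right f t)"
        by (induct t) (simp_all add: slice_left_pure[OF ga] slice_right_pure[OF f]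
            clinear_scale[OF f] clinear_scale[OF g(1)] mult_scaleC_right scaleC_complex_def mult.commute
            clinear_add[OF f] clinear_add[OF g(1)] distrib_left
            clinear_add[OF clinear_slice_right[OF f]] clinear_add[OF clinear_slice_left[OF ga]])
      ultimately show False using g(2) clinear_zero[OF f] by simp
    qed
  qed
qed


section \<open>The multiplier algebra\<close>

text \<open>A multiplier is a pair of a left and a right action, \<open>a \<mapsto> x a\<close> and \<open>a \<mapsto> a x\<close>.\<close>

typedef (overloaded) 'a multiplier =
  "{(l, r). clinear l \<and> clinear r \<and> (\<forall>a b. l (a * b) = l a * b) \<and>
     (\<forall>a b. r (a * b) = a * r b) \<and> (\<forall>a b. r a * b = a * l b)}
     :: (('a::complex_algebra \<Rightarrow> 'a) \<times> ('a \<Rightarrow> 'a)) set"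
  by (rule exI[of _ "(\<lambda>a. a, \<lambda>a. a)"]) (simp add: clinear_ident)

setup_lifting type_definition_multiplier

lift_definition left_act :: "'a::complex_algebra multiplier \<Rightarrow> 'a \<Rightarrow> 'a" (infixr "\<rhd>" 70) is fst .
lift_definition right_act :: "'a::complex_algebra \<Rightarrow> 'a multiplier \<Rightarrow> 'a" (infixl "\<lhd>" 70)
  is "\<lambda>a x. snd x a" .

lemma clinear_left_act: "clinear ((\<rhd>) x)"
  and clinear_right_act: "clinear (\<lambda>a. a \<lhd> x)"
  and left_act_mult: "x \<rhd> (a * b) = (x \<rhd> a) * b"
  and right_act_mult: "(a * b) \<lhd> x = a * (b \<lhd> x)"
  and act_middle: "(a \<lhd> x) * b = a * (x \<rhd> b)"
  by (transfer; auto)+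

lemma multiplier_eqI:
  assumes "\<And>a. x \<rhd> a = y \<rhd> a" "\<And>a. a \<lhd> x = a \<lhd> y"
  shows "x = y"
  using assms by transfer (auto simp: prod_eq_iff fun_eq_iff)

instantiation multiplier :: (complex_algebra) "{complex_algebra, monoid_mult}"
begin
lift_definition zero_multiplier :: "'a multiplier" is "(\<lambda>_. 0, \<lambda>_. 0)"
  by (simp add: clinear_iff)
lift_definition one_multiplier :: "'a multiplier" is "(\<lambda>a. a, \<lambda>a. a)"
  by (simp add: clinear_ident)
lift_definition plus_multiplier :: "'a multiplier \<Rightarrow> 'a multiplier \<Rightarrow> 'a multiplier"
  is "\<lambda>x y. (\<lambda>a. fst x a + fst y a, \<lambda>a. snd x a + snd y a)"
  by (auto simp: clinear_iff algebra_simps scaleC_add_right)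
lift_definition uminus_multiplier :: "'a multiplier \<Rightarrow> 'a multiplier"
  is "\<lambda>x. (\<lambda>a. - fst x a, \<lambda>a. - snd x a)"
  by (auto simp: clinear_iff)
lift_definition minus_multiplier :: "'a multiplier \<Rightarrow> 'a multiplier \<Rightarrow> 'a multiplier"
  is "\<lambda>x y. (\<lambda>a. fst x a - fst y a, \<lambda>a. snd x a - snd y a)"
  by (auto simp: clinear_iff algebra_simps complex_vector.scale_right_diff_distrib)
lift_definition scaleC_multiplier :: "complex \<Rightarrow> 'a multiplier \<Rightarrow> 'a multiplier"
  is "\<lambda>c x. (\<lambda>a. c *\<^sub>C fst x a, \<lambda>a. c *\<^sub>C snd x a)"
  by (auto simp: clinear_iff scaleC_add_right scaleC_scaleC mult_scaleC_left mult_scaleC_right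
      mult.commute)
lift_definition times_multiplier :: "'a multiplier \<Rightarrow> 'a multiplier \<Rightarrow> 'a multiplier"
  is "\<lambda>x y. (\<lambda>a. fst x (fst y a), \<lambda>a. snd y (snd x a))"
  by (auto simp: clinear_iff)

lemma left_act_simps:
  fixes x y :: "'a multiplier"
  shows "0 \<rhd> a = 0" "1 \<rhd> a = a" "(x + y) \<rhd> a = (x \<rhd> a) + (y \<rhd> a)" "(- x) \<rhd> a = - (x \<rhd> a)"
    "(x - y) \<rhd> a = (x \<rhd> a) - (y \<rhd> a)" "(c *\<^sub>C x) \<rhd> a = c *\<^sub>C (x \<rhd> a)" "(x * y) \<rhd> a = x \<rhd> y \<rhd> a"
  by (transfer; simp)+

lemma right_act_simps:
  fixes x y :: "'a multiplier"
  shows "a \<lhd> 0 = 0" "a \<lhd> 1 = a" "a \<lhd> (x + y) = (a \<lhd> x) + (a \<lhd> y)" "a \<lhd> (- x) = - (a \<lhd> x)"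
    "a \<lhd> (x - y) = (a \<lhd> x) - (a \<lhd> y)" "a \<lhd> (c *\<^sub>C x) = c *\<^sub>C (a \<lhd> x)" "a \<lhd> (x * y) = a \<lhd> x \<lhd> y"
  by (transfer; simp)+

instance
  by standard (rule multiplier_eqI;
    simp add: left_act_simps right_act_simps scaleC_add_right scaleC_add_left scaleC_scaleC
      scaleC_one clinear_add[OF clinear_left_act] clinear_add[OF clinear_right_act]
      clinear_scale[OF clinear_left_act] clinear_scale[OF clinear_right_act] add.assoc add.commute)+
end

instance multiplier :: (complex_algebra) nondegenerate_algebra
proof
  fix x :: "'a multiplier"
  show "x = 0" if "\<And>y. x * y = 0" using that[of 1] by simp
  show "x = 0" if "\<And>y. y * x = 0" using that[of 1] by simp
qed

lift_definition emb :: "'a::complex_algebra \<Rightarrow> 'a multiplier" is "\<lambda>a. (\<lambda>b. a * b, \<lambda>b. b * a)"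
  by (simp add: clinear_iff distrib_left distrib_right mult_scaleC_left mult_scaleC_right mult.assoc)

lemma emb_act: "emb a \<rhd> b = a * b" "b \<lhd> emb a = b * a"
  by (transfer; simp)+

lemma algebra_hom_emb: "algebra_hom emb"
  unfolding algebra_hom_def clinear_iff
  by (auto intro!: multiplier_eqI simp: emb_act left_act_simps right_act_simps
      distrib_left distrib_right mult_scaleC_left mult_scaleC_right mult.assoc)

lemma mult_emb: "x * emb a = emb (x \<rhd> a)" "emb a * x = emb (a \<lhd> x)"
  by (rule multiplier_eqI; simp add: emb_act left_act_simps right_act_simps
      left_act_mult right_act_mult act_middle)+

lemma inj_emb: "inj (emb :: 'a::nondegenerate_algebra \<Rightarrow> _)"
proof (rule injI)
  fix a b :: 'a
  assume "emb a = emb b"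
  then have "a * c = b * c" for c by (metis emb_act(1))
  then have "(a - b) * c = 0" for c by (simp add: left_diff_distrib)
  then have "a - b = 0" by (rule nondegenerate_left)
  then show "a = b" by simp
qed

text \<open>The element of the algebra given by a multiplier in the range of \<^const>\<open>emb\<close>.\<close>

definition elt :: "'a::nondegenerate_algebra multiplier \<Rightarrow> 'a"
  where "elt x = (THE a. emb a = x)"

lemma elt_emb: "elt (emb a) = a"
  unfolding elt_def by (rule the_equality) (use inj_emb in \<open>auto simp: inj_def\<close>)

lift_definition multiplier_tensor :: "'a::complex_algebra multiplier \<Rightarrow> 'b::complex_algebra multiplier
    \<Rightarrow> ('a \<otimes> 'b) multiplier" (infixr "\<otimes>\<^sub>M" 75)
  is "\<lambda>x y. (tensor_map (fst x) (fst y), tensor_map (snd x) (snd y))"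
proof (clarsimp, intro conjI allI)
  fix l r :: "'a \<Rightarrow> 'a" and l' r' :: "'b \<Rightarrow> 'b" and s t :: "'a \<otimes> 'b"
  assume lin: "clinear l" "clinear r" "clinear l'" "clinear r'"
    and l: "\<forall>a b. l (a * b) = l a * b" "\<forall>a b. l' (a * b) = l' a * b"
    and r: "\<forall>a b. r (a * b) = a * r b" "\<forall>a b. r' (a * b) = a * r' b"
    and lr: "\<forall>a b. r a * b = a * l b" "\<forall>a b. r' a * b = a * l' b"
  show L: "clinear (tensor_map l l')" and R: "clinear (tensor_map r r')"
    by (intro clinear_tensor_map lin)+
  note add = clinear_add[OF L] clinear_add[OF R] distrib_left distrib_right
  note P = tensor_map_pure[OF lin(1,3)] tensor_map_pure[OF lin(2,4)] times_tensor_pure l r lr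
  show "tensor_map l l' (s * t) = tensor_map l l' s * t"
  proof (induct s)
    case (pure a b) show ?case by (induct t) (simp_all add: P add)
  qed (simp add: add)
  show "tensor_map r r' (s * t) = s * tensor_map r r' t"
  proof (induct s)
    case (pure a b) show ?case by (induct t) (simp_all add: P add)
  qed (simp add: add)
  show "tensor_map r r' s * t = s * tensor_map l l' t"
  proof (induct s)
    case (pure a b) show ?case by (induct t) (simp_all add: P add)
  qed (simp add: add)
qed

lemma multiplier_tensor_act:
  "(x \<otimes>\<^sub>M y) \<rhd> (a \<otimes> b) = (x \<rhd> a) \<otimes> (y \<rhd> b)"
  "(a \<otimes> b) \<lhd> (x \<otimes>\<^sub>M y) = (a \<lhd> x) \<otimes> (b \<lhd> y)"
  using clinear_left_act[of x] clinear_left_act[of y] clinear_right_act[of x] clinear_right_act[of y]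
  by (simp_all add: left_act.rep_eq right_act.rep_eq multiplier_tensor.rep_eq tensor_map_pure)

text \<open>Transport of multipliers along an algebra isomorphism.\<close>

definition multiplier_transport ::
    "('a::complex_algebra \<Rightarrow> 'b::complex_algebra) \<Rightarrow> 'a multiplier \<Rightarrow> 'b multiplier"
  where "multiplier_transport f x = Abs_multiplier (\<lambda>b. f (x \<rhd> inv f b), \<lambda>b. f (inv f b \<lhd> x))"

lemma multiplier_transport_act:
  assumes "algebra_hom f" "bij f"
  shows "multiplier_transport f x \<rhd> f a = f (x \<rhd> a)" "f a \<lhd> multiplier_transport f x = f (a \<lhd> x)"
proof -
  let ?g = "inv f"
  have g: "f (?g b) = b" "?g (f a) = a" for a b
    using assms(2) by (simp_all add: bij_is_surj surj_f_inv_f bij_is_inj)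
  have f: "f (a * b) = f a * f b" "f (a + b) = f a + f b" "f (c *\<^sub>C a) = c *\<^sub>C f a" for a b c
    using assms(1) by (simp_all add: algebra_hom_def clinear_iff)
  have gh: "?g (a * b) = ?g a * ?g b" "?g (a + b) = ?g a + ?g b" "?g (c *\<^sub>C a) = c *\<^sub>C ?g a" for a b c
    by (metis f g)+
  have mem: "(\<lambda>b. f (x \<rhd> ?g b), \<lambda>b. f (?g b \<lhd> x)) \<in>
    {(l, r). clinear l \<and> clinear r \<and>
     (\<forall>a b. l (a * b) = l a * b) \<and> (\<forall>a b. r (a * b) = a * r b) \<and> (\<forall>a b. r a * b = a * l b)}"
  proof -
    have "f (?g a \<lhd> x) * b = a * f (x \<rhd> ?g b)" for a b
      by (metis act_middle f(1) g(1))
    then show ?thesis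
      by (simp add: clinear_iff f g gh left_act_mult right_act_mult
        clinear_add[OF clinear_left_act] clinear_add[OF clinear_right_act]
        clinear_scale[OF clinear_left_act] clinear_scale[OF clinear_right_act])
  qed
  have rep: "Rep_multiplier (multiplier_transport f x) = (\<lambda>b. f (x \<rhd> ?g b), \<lambda>b. f (?g b \<lhd> x))"
    unfolding multiplier_transport_def by (rule Abs_multiplier_inverse[OF mem])
  show "multiplier_transport f x \<rhd> f a = f (x \<rhd> a)"
    by (simp add: left_act.rep_eq[of "multiplier_transport f x"] rep g)
  show "f a \<lhd> multiplier_transport f x = f (a \<lhd> x)"
    by (simp add: right_act.rep_eq[of _ "multiplier_transport f x"] rep g)
qed

text \<open>
  The threefold tensor product is \<open>A \<otimes> (A \<otimes> A)\<close>; an index as in \<open>leg12\<close> names the tensor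
  factors in which a multiplier of \<open>A \<otimes> A\<close> is placed.
\<close>

definition leg12 :: "('a::complex_algebra \<otimes> 'a) multiplier \<Rightarrow> ('a \<otimes> 'a \<otimes> 'a) multiplier"
  where "leg12 x = multiplier_transport tensor_assoc (x \<otimes>\<^sub>M 1)"

definition leg23 :: "('a::complex_algebra \<otimes> 'a) multiplier \<Rightarrow> ('a \<otimes> 'a \<otimes> 'a) multiplier"
  where "leg23 x = 1 \<otimes>\<^sub>M x"

definition leg13 :: "('a::complex_algebra \<otimes> 'a) multiplier \<Rightarrow> ('a \<otimes> 'a \<otimes> 'a) multiplier"
  where "leg13 x = multiplier_transport (tensor_map (\<lambda>a. a) tensor_flip) (leg12 x)"

lemma leg12_act:
  "leg12 x \<rhd> tensor_assoc (t \<otimes> c) = tensor_assoc ((x \<rhd> t) \<otimes> c)"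
  "tensor_assoc (t \<otimes> c) \<lhd> leg12 x = tensor_assoc ((t \<lhd> x) \<otimes> c)"
  unfolding leg12_def
  by (simp_all add: multiplier_transport_act[OF algebra_hom_tensor_assoc bij_tensor_assoc]
      multiplier_tensor_act left_act_simps right_act_simps)

lemma leg13_act:
  "leg13 x \<rhd> (a \<otimes> b \<otimes> c) = tensor_map (\<lambda>a. a) tensor_flip (leg12 x \<rhd> (a \<otimes> c \<otimes> b))"
  "(a \<otimes> b \<otimes> c) \<lhd> leg13 x = tensor_map (\<lambda>a. a) tensor_flip ((a \<otimes> c \<otimes> b) \<lhd> leg12 x)"
proof -
  have hom: "algebra_hom (tensor_map (\<lambda>a. a) tensor_flip)"
    by (intro algebra_hom_tensor_map algebra_hom_tensor_flip)
      (simp add: algebra_hom_def clinear_ident)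
  have eq: "a \<otimes> b \<otimes> c = tensor_map (\<lambda>a. a) tensor_flip (a \<otimes> c \<otimes> b)"
    by (simp add: tensor_map_pure[OF clinear_ident clinear_tensor_flip] tensor_flip_pure)
  show "leg13 x \<rhd> (a \<otimes> b \<otimes> c) = tensor_map (\<lambda>a. a) tensor_flip (leg12 x \<rhd> (a \<otimes> c \<otimes> b))"
    "(a \<otimes> b \<otimes> c) \<lhd> leg13 x = tensor_map (\<lambda>a. a) tensor_flip ((a \<otimes> c \<otimes> b) \<lhd> leg12 x)"
    unfolding eq leg13_def
    by (simp_all only: multiplier_transport_act[OF hom bij_tensor_map_flip])
qed

text \<open>
  The homomorphism \<open>\<psi>\<close> on the multiplier algebra that extends \<open>\<phi>\<close> and has \<open>\<psi> 1 = e\<close>. It is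
  unique if \<open>\<phi>(B) C\<close> spans \<open>e C\<close>, where \<open>\<phi>: B \<rightarrow> M(C)\<close>.
\<close>

definition multiplier_extension ::
    "('b::complex_algebra \<Rightarrow> 'c::complex_algebra multiplier) \<Rightarrow> 'c multiplier \<Rightarrow> 'b multiplier \<Rightarrow> 'c multiplier"
  where "multiplier_extension \<phi> e =
    (THE \<psi>. algebra_hom \<psi> \<and> (\<forall>b. \<psi> (emb b) = \<phi> b) \<and> \<psi> 1 = e)"


section \<open>Coproducts\<close>

text \<open>\<open>(\<Delta> \<otimes> id)\<close> and \<open>(id \<otimes> \<Delta>)\<close> on \<open>A \<otimes> A\<close>, with values in \<open>M(A \<otimes> (A \<otimes> A))\<close>.\<close>

definition coprod_id :: "('a::complex_algebra \<Rightarrow> ('a \<otimes> 'a) multiplier) \<Rightarrow> 'a \<otimes> 'a \<Rightarrow>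
    ('a \<otimes> 'a \<otimes> 'a) multiplier"
  where "coprod_id \<Delta> t =
    multiplier_transport tensor_assoc (tensor_lift (\<lambda>p q. \<Delta> p \<otimes>\<^sub>M emb q) t)"

definition id_coprod :: "('a::complex_algebra \<Rightarrow> ('a \<otimes> 'a) multiplier) \<Rightarrow> 'a \<otimes> 'a \<Rightarrow>
    ('a \<otimes> 'a \<otimes> 'a) multiplier"
  where "id_coprod \<Delta> = tensor_lift (\<lambda>p q. emb p \<otimes>\<^sub>M \<Delta> q)"

definition T1 :: "('a::nondegenerate_algebra \<Rightarrow> ('a \<otimes> 'a) multiplier) \<Rightarrow> 'a \<otimes> 'a \<Rightarrow> 'a \<otimes> 'a"
  where "T1 \<Delta> = tensor_lift (\<lambda>a b. elt (\<Delta> a * (1 \<otimes>\<^sub>M emb b)))"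

definition T2 :: "('a::nondegenerate_algebra \<Rightarrow> ('a \<otimes> 'a) multiplier) \<Rightarrow> 'a \<otimes> 'a \<Rightarrow> 'a \<otimes> 'a"
  where "T2 \<Delta> = tensor_lift (\<lambda>a b. elt ((emb a \<otimes>\<^sub>M 1) * \<Delta> b))"

definition coproduct :: "('a::nondegenerate_algebra \<Rightarrow> ('a \<otimes> 'a) multiplier) \<Rightarrow> bool"
  where "coproduct \<Delta> \<longleftrightarrow> algebra_hom \<Delta> \<and>
    (\<forall>a b. \<Delta> a * (1 \<otimes>\<^sub>M emb b) \<in> range emb) \<and>
    (\<forall>a b. (emb a \<otimes>\<^sub>M 1) * \<Delta> b \<in> range emb) \<and>
    (\<forall>a b c. (emb a \<otimes>\<^sub>M 1 \<otimes>\<^sub>M 1) * coprod_id \<Delta> (T1 \<Delta> (b \<otimes> c)) =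
       id_coprod \<Delta> (T2 \<Delta> (a \<otimes> b)) * (1 \<otimes>\<^sub>M 1 \<otimes>\<^sub>M emb c))"

definition left_leg :: "('a::nondegenerate_algebra \<Rightarrow> ('a \<otimes> 'a) multiplier) \<Rightarrow> 'a set"
  where "left_leg \<Delta> =
    \<Inter>{V. csubspace V \<and> (\<forall>a b. T1 \<Delta> (a \<otimes> b) \<in> cspan {v \<otimes> c | v c. v \<in> V})}"

definition right_leg :: "('a::nondegenerate_algebra \<Rightarrow> ('a \<otimes> 'a) multiplier) \<Rightarrow> 'a set"
  where "right_leg \<Delta> =
    \<Inter>{W. csubspace W \<and> (\<forall>a b. T2 \<Delta> (a \<otimes> b) \<in> cspan {c \<otimes> w | c w. w \<in> W})}"

definition full_coproduct :: "('a::nondegenerate_algebra \<Rightarrow> ('a \<otimes> 'a) multiplier) \<Rightarrow> bool"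
  where "full_coproduct \<Delta> \<longleftrightarrow> coproduct \<Delta> \<and> left_leg \<Delta> = UNIV \<and> right_leg \<Delta> = UNIV"

definition counit ::
    "('a::nondegenerate_algebra \<Rightarrow> ('a \<otimes> 'a) multiplier) \<Rightarrow> ('a \<Rightarrow> complex) \<Rightarrow> bool"
  where "counit \<Delta> \<epsilon> \<longleftrightarrow> clinear \<epsilon> \<and>
    (\<forall>a b. slice_left \<epsilon> (T1 \<Delta> (a \<otimes> b)) = a * b) \<and>
    (\<forall>a c. slice_right \<epsilon> (T2 \<Delta> (c \<otimes> a)) = c * a)"


section \<open>Weak multiplier Hopf algebras\<close>

abbreviation coprod_ext :: "('a::complex_algebra \<Rightarrow> ('a \<otimes> 'a) multiplier) \<Rightarrow> ('a \<otimes> 'a) multiplier \<Rightarrow>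
    'a multiplier \<Rightarrow> ('a \<otimes> 'a) multiplier"
  where "coprod_ext \<Delta> E \<equiv> multiplier_extension \<Delta> E"

abbreviation id_coprod_ext :: "('a::complex_algebra \<Rightarrow> ('a \<otimes> 'a) multiplier) \<Rightarrow>
    ('a \<otimes> 'a) multiplier \<Rightarrow> ('a \<otimes> 'a) multiplier \<Rightarrow> ('a \<otimes> 'a \<otimes> 'a) multiplier"
  where "id_coprod_ext \<Delta> E \<equiv> multiplier_extension (id_coprod \<Delta>) (1 \<otimes>\<^sub>M E)"

definition G1_map :: "('a::nondegenerate_algebra \<Rightarrow> ('a \<otimes> 'a) multiplier) \<Rightarrow>
    ('a \<otimes> 'a) multiplier \<Rightarrow> ('a \<otimes> 'a \<Rightarrow> 'a \<otimes> 'a) \<Rightarrow> bool"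
  where "G1_map \<Delta> E G \<longleftrightarrow> clinear G \<and> (\<forall>a b c.
    tensor_assoc (tensor_map G (\<lambda>a. a)
      (inv tensor_assoc (elt (leg13 (\<Delta> a) * (1 \<otimes>\<^sub>M emb b \<otimes>\<^sub>M emb c))))) =
    elt (leg13 (\<Delta> a) * leg23 E * (1 \<otimes>\<^sub>M emb b \<otimes>\<^sub>M emb c)))"

definition G2_map :: "('a::nondegenerate_algebra \<Rightarrow> ('a \<otimes> 'a) multiplier) \<Rightarrow>
    ('a \<otimes> 'a) multiplier \<Rightarrow> ('a \<otimes> 'a \<Rightarrow> 'a \<otimes> 'a) \<Rightarrow> bool"
  where "G2_map \<Delta> E G \<longleftrightarrow> clinear G \<and> (\<forall>a b c.
    tensor_map (\<lambda>a. a) G (elt ((emb a \<otimes>\<^sub>M emb b \<otimes>\<^sub>M 1) * leg13 (\<Delta> c))) =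
    elt ((emb a \<otimes>\<^sub>M emb b \<otimes>\<^sub>M 1) * leg12 E * leg13 (\<Delta> c)))"

text \<open>
  The counit, the idempotent \<open>E\<close> and the maps \<open>G1\<close>, \<open>G2\<close> are determined by the coproduct; they
  are parameters so that no choice is needed to refer to them.
\<close>

locale weak_multiplier_Hopf_algebra =
  fixes \<Delta> :: "'a::nondegenerate_algebra \<Rightarrow> ('a \<otimes> 'a) multiplier"
    and \<epsilon> :: "'a \<Rightarrow> complex"
    and E :: "('a \<otimes> 'a) multiplier"
    and G1 G2 :: "'a \<otimes> 'a \<Rightarrow> 'a \<otimes> 'a"
  assumes idempotent: "idempotent_algebra TYPE('a)"
    and full_coproduct: "full_coproduct \<Delta>"
    and counit: "counit \<Delta> \<epsilon>"
    and E_idem: "E * E = E"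
    and range_T1: "range (T1 \<Delta>) = range (\<lambda>t. E \<rhd> t)"
    and range_T2: "range (T2 \<Delta>) = range (\<lambda>t. t \<lhd> E)"
    and id_coprod_E: "id_coprod_ext \<Delta> E E = leg12 E * leg23 E"
    and E_commute: "leg12 E * leg23 E = leg23 E * leg12 E"
    and G1: "G1_map \<Delta> E G1"
    and G2: "G2_map \<Delta> E G2"
    and ker_T1: "{t. T1 \<Delta> t = 0} = range (\<lambda>t. t - G1 t)"
    and ker_T2: "{t. T2 \<Delta> t = 0} = range (\<lambda>t. t - G2 t)"

text \<open>
  The Sweedler formulas are stated after covering. In \<open>A\<close> we have
  \<open>times_eps_t \<Delta> S d a = \<Sum> d a\<^sub>1 S(a\<^sub>2)\<close> and \<open>eps_s_times \<Delta> S a d = \<Sum> S(a\<^sub>1) a\<^sub>2 d\<close>.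
\<close>

definition times_eps_t :: "('a::nondegenerate_algebra \<Rightarrow> ('a \<otimes> 'a) multiplier) \<Rightarrow>
    ('a \<Rightarrow> 'a multiplier) \<Rightarrow> 'a \<Rightarrow> 'a \<Rightarrow> 'a"
  where "times_eps_t \<Delta> S d a = tensor_lift (\<lambda>p q. p \<lhd> S q) (T2 \<Delta> (d \<otimes> a))"

definition eps_s_times :: "('a::nondegenerate_algebra \<Rightarrow> ('a \<otimes> 'a) multiplier) \<Rightarrow>
    ('a \<Rightarrow> 'a multiplier) \<Rightarrow> 'a \<Rightarrow> 'a \<Rightarrow> 'a"
  where "eps_s_times \<Delta> S a d = tensor_lift (\<lambda>p q. S p \<rhd> q) (T1 \<Delta> (a \<otimes> d))"

definition eps_t :: "('a::nondegenerate_algebra \<Rightarrow> ('a \<otimes> 'a) multiplier) \<Rightarrow>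
    ('a \<Rightarrow> 'a multiplier) \<Rightarrow> 'a \<Rightarrow> 'a multiplier"
  where "eps_t \<Delta> S a = (THE x. \<forall>d. d \<lhd> x = times_eps_t \<Delta> S d a)"

text \<open>
  The formulas for \<open>E(a \<otimes> b)\<close> and \<open>G1(a \<otimes> b)\<close> are multiplied from the left by an element of \<open>A\<close>
  in the first factor (for \<open>E\<close> in both factors), those for \<open>(a \<otimes> b)E\<close> and \<open>G2(a \<otimes> b)\<close> from the right
  by an element in the second factor (for \<open>E\<close> in both). In \<open>\<Sum> S(a\<^sub>1) a\<^sub>2 S(a\<^sub>3) = S(a)\<close>, an
  identity in \<open>M(A)\<close>, the left side is \<open>\<Sum> S(p) q\<close> over \<open>E(a \<otimes> b) = \<Sum> p \<otimes> q\<close> after right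
  multiplication by \<open>b\<close>, and \<open>\<Sum> p S(q)\<close> over \<open>(b \<otimes> a)E = \<Sum> p \<otimes> q\<close> after left multiplication by \<open>b\<close>.
\<close>

locale weak_multiplier_Hopf_algebra_antipode = weak_multiplier_Hopf_algebra \<Delta> \<epsilon> E G1 G2
  for \<Delta> :: "'a::nondegenerate_algebra \<Rightarrow> ('a \<otimes> 'a) multiplier" and \<epsilon> E G1 G2 +
  fixes S :: "'a \<Rightarrow> 'a multiplier"
  assumes antihom: "algebra_antihom S"
    and nondegenerate_antipode: "cspan {S a \<rhd> b | a b. True} = UNIV" "cspan {b \<lhd> S a | a b. True} = UNIV"
    and E_left: "(c \<otimes> d) * (E \<rhd> (a \<otimes> b)) =
      tensor_lift (\<lambda>p q. p \<otimes> (times_eps_t \<Delta> S d q * b)) (T2 \<Delta> (c \<otimes> a))"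
    and E_right: "((a \<otimes> b) \<lhd> E) * (d \<otimes> c) =
      tensor_lift (\<lambda>p q. (a * eps_s_times \<Delta> S p d) \<otimes> q) (T1 \<Delta> (b \<otimes> c))"
    and G1_antipode: "(emb c \<otimes>\<^sub>M 1) \<rhd> G1 (a \<otimes> b) =
      tensor_lift (\<lambda>p q. p \<otimes> eps_s_times \<Delta> S q b) (T2 \<Delta> (c \<otimes> a))"
    and G2_antipode: "G2 (a \<otimes> b) \<lhd> (1 \<otimes>\<^sub>M emb c) =
      tensor_lift (\<lambda>p q. times_eps_t \<Delta> S a p \<otimes> q) (T1 \<Delta> (b \<otimes> c))"
    and antipode_left: "S a \<rhd> b = tensor_lift (\<lambda>p q. S p \<rhd> q) (E \<rhd> (a \<otimes> b))"
    and antipode_right: "b \<lhd> S a = tensor_lift (\<lambda>p q. p \<lhd> S q) ((b \<otimes> a) \<lhd> E)"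

locale regular_weak_multiplier_Hopf_algebra =
  weak_multiplier_Hopf_algebra_antipode \<Delta> \<epsilon> E G1 G2 S
  for \<Delta> :: "'a::nondegenerate_algebra \<Rightarrow> ('a \<otimes> 'a) multiplier" and \<epsilon> E G1 G2 S +
  assumes bij_antipode: "bij_betw S UNIV (range emb)"

definition antipode_inv :: "('a::nondegenerate_algebra \<Rightarrow> 'a multiplier) \<Rightarrow> 'a \<Rightarrow> 'a"
  where "antipode_inv S a = inv S (emb a)"

definition source_algebra :: "('a::nondegenerate_algebra \<Rightarrow> ('a \<otimes> 'a) multiplier) \<Rightarrow>
    ('a \<otimes> 'a) multiplier \<Rightarrow> 'a multiplier set"
  where "source_algebra \<Delta> E = {y. coprod_ext \<Delta> E y = E * (1 \<otimes>\<^sub>M y)}"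

definition target_algebra :: "('a::nondegenerate_algebra \<Rightarrow> ('a \<otimes> 'a) multiplier) \<Rightarrow>
    ('a \<otimes> 'a) multiplier \<Rightarrow> 'a multiplier set"
  where "target_algebra \<Delta> E = {x. coprod_ext \<Delta> E x = (x \<otimes>\<^sub>M 1) * E}"


section \<open>Cointegrals\<close>

definition left_cointegral :: "('a::nondegenerate_algebra \<Rightarrow> ('a \<otimes> 'a) multiplier) \<Rightarrow>
    ('a \<Rightarrow> 'a multiplier) \<Rightarrow> 'a multiplier \<Rightarrow> bool"
  where "left_cointegral \<Delta> S h \<longleftrightarrow> h \<noteq> 0 \<and> (\<forall>a. emb a * h = eps_t \<Delta> S a * h)"

text \<open>
  For \<open>h \<in> A\<close>, the condition \<open>(id \<otimes> f)\<Delta>(h) = 0\<close> means \<open>(id \<otimes> f)((c \<otimes> 1)\<Delta>(h)) = 0\<close> for all \<open>c\<close>,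
  and \<open>(f \<otimes> id)\<Delta>(h) = 0\<close> means \<open>(f \<otimes> id)(\<Delta>(h)(1 \<otimes> c)) = 0\<close> for all \<open>c\<close>.
\<close>

definition faithful_cointegral ::
    "('a::nondegenerate_algebra \<Rightarrow> ('a \<otimes> 'a) multiplier) \<Rightarrow> 'a \<Rightarrow> bool"
  where "faithful_cointegral \<Delta> h \<longleftrightarrow> (\<forall>f. clinear f \<longrightarrow>
    (\<forall>c. slice_right f (T2 \<Delta> (c \<otimes> h)) = 0) \<or> (\<forall>c. slice_left f (T1 \<Delta> (h \<otimes> c)) = 0) \<longrightarrow>
    f = (\<lambda>_. 0))"

definition gamma_t :: "('a::nondegenerate_algebra \<Rightarrow> ('a \<otimes> 'a) multiplier) \<Rightarrow>
    ('a \<otimes> 'a) multiplier \<Rightarrow> 'a \<Rightarrow> 'a \<Rightarrow> 'a multiplier"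
  where "gamma_t \<Delta> E h a = (THE x. x \<in> target_algebra \<Delta> E \<and> emb (h * a) = emb h * x)"

definition gamma_s :: "('a::nondegenerate_algebra \<Rightarrow> ('a \<otimes> 'a) multiplier) \<Rightarrow>
    ('a \<otimes> 'a) multiplier \<Rightarrow> 'a \<Rightarrow> 'a \<Rightarrow> 'a multiplier"
  where "gamma_s \<Delta> E h a = (THE y. y \<in> source_algebra \<Delta> E \<and> emb (h * a) = emb h * y)"

text \<open>
  \<open>times_E_t \<Delta> E h a = (a \<otimes> 1)E\<^sub>t = (id \<otimes> \<gamma>\<^sub>t)\<Delta>(a)\<close>, covered from the left in the first factor, and
  \<open>times_E_s \<Delta> E h a = (1 \<otimes> a)E\<^sub>s = (\<gamma>\<^sub>s \<otimes> id)\<Delta>(a)\<close>, covered from the right in the second factor.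
\<close>

definition times_E_t :: "('a::nondegenerate_algebra \<Rightarrow> ('a \<otimes> 'a) multiplier) \<Rightarrow>
    ('a \<otimes> 'a) multiplier \<Rightarrow> 'a \<Rightarrow> 'a \<Rightarrow> ('a \<otimes> 'a) multiplier"
  where "times_E_t \<Delta> E h a = (THE x. \<forall>c. (emb c \<otimes>\<^sub>M 1) * x =
    tensor_lift (\<lambda>p q. emb p \<otimes>\<^sub>M gamma_t \<Delta> E h q) (T2 \<Delta> (c \<otimes> a)))"

definition times_E_s :: "('a::nondegenerate_algebra \<Rightarrow> ('a \<otimes> 'a) multiplier) \<Rightarrow>
    ('a \<otimes> 'a) multiplier \<Rightarrow> 'a \<Rightarrow> 'a \<Rightarrow> ('a \<otimes> 'a) multiplier"
  where "times_E_s \<Delta> E h a = (THE x. \<forall>c. x * (1 \<otimes>\<^sub>M emb c) =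
    tensor_lift (\<lambda>p q. gamma_s \<Delta> E h p \<otimes>\<^sub>M emb q) (T1 \<Delta> (a \<otimes> c)))"

text \<open>
  \<open>S1' a = \<Sum> \<gamma>\<^sub>t(a\<^sub>2) S\<^sup>-\<^sup>1(a\<^sub>1)\<close> is covered by right multiplication with \<open>S\<^sup>-\<^sup>1(d)\<close>, which gives
  \<open>\<Sum> \<gamma>\<^sub>t(a\<^sub>2) S\<^sup>-\<^sup>1(d a\<^sub>1)\<close>; \<open>S2' a = \<Sum> \<gamma>\<^sub>s(a\<^sub>1) S(a\<^sub>2)\<close> is covered by right multiplication with
  \<open>S(d)\<close>, which gives \<open>\<Sum> \<gamma>\<^sub>s(a\<^sub>1) S(d a\<^sub>2)\<close>. In the regular case \<open>S\<^sup>-\<^sup>1(d)\<close> and \<open>S(d)\<close> run through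
  all of \<open>A\<close>, and \<open>(1 \<otimes> d)\<Delta>(a)\<close> is in \<open>A \<otimes> A\<close>.
\<close>

definition S1' :: "('a::nondegenerate_algebra \<Rightarrow> ('a \<otimes> 'a) multiplier) \<Rightarrow>
    ('a \<otimes> 'a) multiplier \<Rightarrow> ('a \<Rightarrow> 'a multiplier) \<Rightarrow> 'a \<Rightarrow> 'a \<Rightarrow> 'a multiplier"
  where "S1' \<Delta> E S h a = (THE x. \<forall>d. x * emb (antipode_inv S d) =
    tensor_lift (\<lambda>p q. gamma_t \<Delta> E h q * emb (antipode_inv S p)) (T2 \<Delta> (d \<otimes> a)))"

definition S2' :: "('a::nondegenerate_algebra \<Rightarrow> ('a \<otimes> 'a) multiplier) \<Rightarrow>
    ('a \<otimes> 'a) multiplier \<Rightarrow> ('a \<Rightarrow> 'a multiplier) \<Rightarrow> 'a \<Rightarrow> 'a \<Rightarrow> 'a multiplier"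
  where "S2' \<Delta> E S h a = (THE x. \<forall>d. x * S d =
    tensor_lift (\<lambda>p q. gamma_s \<Delta> E h p * S q) (elt ((1 \<otimes>\<^sub>M emb d) * \<Delta> a)))"

end

theory Submission
  imports Defs
begin

text \<open>
  From \<open>a h = \<epsilon>\<^sub>t(a) h\<close> one gets \<open>\<Delta>(a)(1 \<otimes> h) = E(a \<otimes> h)\<close> by \<open>E(a \<otimes> b) = \<Sum> a\<^sub>1 \<otimes> \<epsilon>\<^sub>t(a\<^sub>2) b\<close>, and
  \<open>(1 \<otimes> a)\<Delta>(h) = \<Sum> S(a\<^sub>1) a\<^sub>2 h\<^sub>1 \<otimes> a\<^sub>3 h\<^sub>2 = (S(a) \<otimes> 1)\<Delta>(h)\<close>. The remaining identities need that the
  formulas for \<open>E\<close> hold also for the opposite coproduct with antipode \<open>S\<^sup>-\<^sup>1\<close>, for instance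
  \<open>E(b \<otimes> a) = \<Sum> a\<^sub>2 S\<^sup>-\<^sup>1(a\<^sub>1) b \<otimes> a\<^sub>3\<close>. This rests on \<open>\<Delta> \<circ> S = \<sigma>(S \<otimes> S)\<Delta>\<close> and \<open>\<sigma>(S \<otimes> S)E = E\<close>, so that \<open>S\<close>
  exchanges the source and target maps.

  For the existence of \<open>\<gamma>\<^sub>t\<close> one has \<open>(1 \<otimes> h)\<Delta>(h) = (S(h) \<otimes> 1)\<Delta>(h) = (S(h) \<otimes> h)E\<close>, whose second leg is in
  \<open>h A\<^sub>t\<close>: a functional that vanishes on \<open>h A\<^sub>t\<close> vanishes on \<open>h A\<close> by faithfulness. The argument for \<open>\<gamma>\<^sub>s\<close> is
  dual.
\<close>

section \<open>Linear maps and tensors\<close>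

text \<open>Sweedler sums make sense only after covering. Each identity is therefore proved for
  elements of an algebraic tensor product, and the covering factors are cancelled afterwards by
  non-degeneracy. Several standard facts are not among the hypotheses and have to be derived: the
  value of \<open>(\<Delta> \<otimes> id)E\<close>, the membership of
  \<open>\<Delta>(a)(b \<otimes> 1)\<close> and \<open>(1 \<otimes> a)\<Delta>(b)\<close> in
  \<open>A \<otimes> A\<close>, and the behaviour of the antipode on coproducts. The common lever is
  that the two legs of \<open>E\<close> consist of values of the source and target maps. Hence
  \<open>E\<close> can be moved past a coproduct until it stands inside \<open>\<Sum> S(p) q\<close>
  or \<open>\<Sum> p S(q)\<close>, where it is absorbed. The extensions to multipliers, the maps
  \<open>gamma_t\<close> and \<open>gamma_s\<close>, \<open>E_t\<close>, \<open>E_s\<close>,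
  \<open>S1'\<close> and \<open>S2'\<close> are given by definite descriptions, so existence and
  uniqueness must be shown before they can be used. For \<open>gamma_t\<close> and
  \<open>gamma_s\<close> both come from faithfulness, which says that each leg of
  \<open>\<Delta>(h)\<close> is all of \<open>A\<close>; for \<open>S1'\<close> and
  \<open>S2'\<close> existence does.\<close>

named_theorems clin
text \<open>\<open>clin\<close> closes goals of linearity and bilinearity through
  \<open>intro\<close>; \<open>push\<close> moves a linear map inside a Sweedler sum, with
  bilinearity of the summand as side condition. Most calculations below rewrite with
  \<open>push\<close> and discharge the side conditions with \<open>clin\<close>.\<close>

named_theorems push

lemma clin_o: "clinear g \<Longrightarrow> clinear f \<Longrightarrow> clinear (\<lambda>x. g (f x))"
  by (rule clinear_compose)

lemma cbilinearD: "cbilinear f \<Longrightarrow> clinear (f a)" "cbilinear f \<Longrightarrow> clinear (\<lambda>a. f a b)"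
  by (simp_all add: cbilinear_def)

lemma cbilinear_lin [clin]:
  "\<lbrakk>\<And>a. clinear (\<lambda>b. f a b); \<And>b. clinear (\<lambda>a. f a b)\<rbrakk> \<Longrightarrow> cbilinear f"
  by (simp add: cbilinear_def)

lemmas pure_lin = cbilinearD[OF cbilinear_pure_tensor]

lemma clinear_emb: "clinear emb"
  by (rule algebra_hom_emb[unfolded algebra_hom_def, THEN conjunct1])

lemma clin_basic [clin]:
  "clinear (\<lambda>x. x)"
  "clinear (\<lambda>x. 0)"
  "clinear f \<Longrightarrow> clinear g \<Longrightarrow> clinear (\<lambda>x. f x + g x)"
  "clinear f \<Longrightarrow> clinear g \<Longrightarrow> clinear (\<lambda>x. f x - g x)"
  "clinear f \<Longrightarrow> clinear (\<lambda>x. c *\<^sub>C f x)"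
  "clinear f \<Longrightarrow> clinear (\<lambda>x. f x \<otimes> b)"
  "clinear f \<Longrightarrow> clinear (\<lambda>x. a \<otimes> f x)"
  by (simp_all add: clinear_iff algebra_simps scaleC_add_right scaleC_scaleC pure_tensor_simps
      complex_vector.scale_right_diff_distrib)

lemma clin_scale_left [clin]: "clinear f \<Longrightarrow> clinear (\<lambda>x. f x *\<^sub>C v)" for f :: "_ \<Rightarrow> complex"
  by (simp add: clinear_iff scaleC_add_left scaleC_scaleC scaleC_complex_def)

lemma clin_mult [clin]:
  "clinear f \<Longrightarrow> clinear (\<lambda>x. f x * b)"
  "clinear f \<Longrightarrow> clinear (\<lambda>x. a * f x)" for a b :: "_ :: complex_algebra"
  by (simp_all add: clinear_iff distrib_left distrib_right mult_scaleC_left mult_scaleC_right)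

lemma clin_act [clin]:
  "clinear f \<Longrightarrow> clinear (\<lambda>x. m \<rhd> f x)"
  "clinear f \<Longrightarrow> clinear (\<lambda>x. f x \<lhd> m)"
  "clinear g \<Longrightarrow> clinear (\<lambda>x. g x \<rhd> a)"
  "clinear g \<Longrightarrow> clinear (\<lambda>x. a \<lhd> g x)"
  "clinear f \<Longrightarrow> clinear (\<lambda>x. emb (f x))"
  using clin_o[OF clinear_left_act[of m], of f] clin_o[OF clinear_right_act[of m], of f]
    clin_o[OF clinear_emb, of f]
  by (simp_all add: clinear_iff left_act_simps right_act_simps)

lemma csubspaceI:
  assumes "0 \<in> W" "\<And>x y. x \<in> W \<Longrightarrow> y \<in> W \<Longrightarrow> x + y \<in> W" "\<And>c x. x \<in> W \<Longrightarrow> c *\<^sub>C x \<in> W"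
  shows "csubspace W"
  using assms by (simp add: complex_vector.subspace_def)

lemma csubspace_eq: "clinear f \<Longrightarrow> clinear g \<Longrightarrow> csubspace {x. f x = g x}"
  by (rule csubspaceI) (simp_all add: clinear_zero clinear_add clinear_scale)

lemma tensor_eq_induct:
  assumes "csubspace {t. P t}" "\<And>a b. P (a \<otimes> b)"
  shows "P t"
proof (induct t)
  case (pure a b)
  show ?case by (rule assms)
next
  case (add x y)
  then show ?case using complex_vector.subspace_add[OF assms(1)] by simp
qed

lemma tensor_all_eqI:
  assumes "clinear f" "clinear g" "\<And>a b. f (a \<otimes> b) = g (a \<otimes> b)"
  shows "\<forall>t. f t = g t"
  using clinear_tensor_eqI[OF assms] by simp

text \<open>Without non-degeneracy one action need not determine a multiplier, so both are compared.
  This generality is what the linearity of \<open>\<otimes>\<^sub>M\<close> for arbitrary algebras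
  requires.\<close>

lemma multiplier_tensor_ext:
  fixes x y :: "('a::complex_algebra \<otimes> 'b::complex_algebra) multiplier"
  assumes "\<And>a b. x \<rhd> (a \<otimes> b) = y \<rhd> (a \<otimes> b)" "\<And>a b. (a \<otimes> b) \<lhd> x = (a \<otimes> b) \<lhd> y"
  shows "x = y"
proof (rule multiplier_eqI)
  have "\<forall>t. x \<rhd> t = y \<rhd> t"
    by (rule tensor_all_eqI) (intro clin assms)+
  then show "x \<rhd> t = y \<rhd> t" for t by simp
  have "\<forall>t. t \<lhd> x = t \<lhd> y"
    by (rule tensor_all_eqI) (intro clin assms)+
  then show "t \<lhd> x = t \<lhd> y" for t by simp
qed

lemma clin_multiplier_tensor [clin]:
  "clinear f \<Longrightarrow> clinear (\<lambda>x. f x \<otimes>\<^sub>M n)"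
  "clinear g \<Longrightarrow> clinear (\<lambda>x. m \<otimes>\<^sub>M g x)"
  unfolding clinear_iff
  by (auto intro!: multiplier_tensor_ext simp: multiplier_tensor_act left_act_simps right_act_simps
      pure_tensor_simps)

lemma emb_tensor: "emb (a \<otimes> b) = emb a \<otimes>\<^sub>M emb b"
  by (rule multiplier_tensor_ext) (simp_all add: emb_act multiplier_tensor_act times_tensor_pure)

lemma multiplier_tensor_mult: "(x \<otimes>\<^sub>M y) * (z \<otimes>\<^sub>M w) = (x * z) \<otimes>\<^sub>M (y * w)"
  by (rule multiplier_tensor_ext) (simp_all add: multiplier_tensor_act left_act_simps right_act_simps)

lemma multiplier_tensor_mult_assoc:
  "(x \<otimes>\<^sub>M y) * ((z \<otimes>\<^sub>M w) * m) = ((x * z) \<otimes>\<^sub>M (y * w)) * m"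
  by (simp add: multiplier_tensor_mult flip: mult.assoc)

lemma multiplier_tensor_one: "1 \<otimes>\<^sub>M 1 = 1"
  by (rule multiplier_tensor_ext) (simp_all add: multiplier_tensor_act left_act_simps right_act_simps)

lemma emb_mult: "emb (a * b) = emb a * emb b"
  by (rule algebra_hom_emb[unfolded algebra_hom_def, THEN conjunct2, rule_format])

lemma emb_eq_iff: "emb a = emb b \<longleftrightarrow> a = b" for a b :: "_ :: nondegenerate_algebra"
  using inj_emb by (auto simp: inj_def)

text \<open>\<open>tsum t f\<close> is the Sweedler sum \<open>\<Sum> f p q\<close> over \<open>t = \<Sum> p \<otimes> q\<close>.\<close>

abbreviation tsum :: "('a::complex_vector \<otimes> 'b::complex_vector) \<Rightarrow> ('a \<Rightarrow> 'b \<Rightarrow> 'c::complex_vector) \<Rightarrow> 'c"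
  where "tsum t f \<equiv> tensor_lift f t"

lemma clin_tsum [clin]: "cbilinear f \<Longrightarrow> clinear g \<Longrightarrow> clinear (\<lambda>x. tsum (g x) f)"
  by (rule clin_o[OF clinear_tensor_lift])

lemma lin_tsum:
  assumes "clinear g" "cbilinear f"
  shows "g (tsum t f) = tsum t (\<lambda>p q. g (f p q))"
proof -
  have b: "cbilinear (\<lambda>p q. g (f p q))"
    by (intro cbilinear_lin clin_o[OF assms(1)] cbilinearD[OF assms(2)])
  have "\<forall>t. g (tsum t f) = tsum t (\<lambda>p q. g (f p q))"
    by (rule tensor_all_eqI, rule clin_o[OF assms(1) clinear_tensor_lift[OF assms(2)]],
        rule clinear_tensor_lift[OF b], simp add: tensor_lift_pure b assms)
  then show ?thesis by simp
qed

lemma clin_tsum_fun [clin]: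
  assumes "\<And>x. cbilinear (\<beta> x)" "\<And>p q. clinear (\<lambda>x. \<beta> x p q)"
  shows "clinear (\<lambda>x. tsum t (\<beta> x))"
proof (induct t)
  case (pure a b)
  then show ?case by (simp add: tensor_lift_pure assms)
next
  case (add x y)
  then show ?case
    using clin_basic(3)[OF add] by (simp add: clinear_add[OF clinear_tensor_lift[OF assms(1)]])
qed

lemma tsum_pure: "\<lbrakk>\<And>a. clinear (\<lambda>b. f a b); \<And>b. clinear (\<lambda>a. f a b)\<rbrakk> \<Longrightarrow> tsum (a \<otimes> b) f = f a b"
  by (intro tensor_lift_pure clin)

lemma tsum_id: "tsum t (\<otimes>) = t" for t :: "'a::complex_vector \<otimes> 'b::complex_vector"
  by (induct t rule: tensor_eq_induct) (intro csubspace_eq clin, subst tsum_pure, (intro clin)+, rule refl)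

lemma push_basic [push]:
  assumes "cbilinear f"
  shows "tsum t f \<otimes> b = tsum t (\<lambda>p q. f p q \<otimes> b)"
    "a \<otimes> tsum t f = tsum t (\<lambda>p q. a \<otimes> f p q)"
    "c *\<^sub>C tsum t f = tsum t (\<lambda>p q. c *\<^sub>C f p q)"
  by (rule lin_tsum, intro clin, rule assms)+

lemma push_mult [push]:
  fixes a b :: "_ :: complex_algebra"
  assumes "cbilinear f"
  shows "tsum t f * b = tsum t (\<lambda>p q. f p q * b)"
    "a * tsum t f = tsum t (\<lambda>p q. a * f p q)"
  by (rule lin_tsum, intro clin, rule assms)+

lemma push_act [push]:
  assumes "cbilinear f"
  shows "m \<rhd> tsum t f = tsum t (\<lambda>p q. m \<rhd> f p q)"
    "tsum t f \<lhd> m = tsum t (\<lambda>p q. f p q \<lhd> m)"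
    "emb (tsum t f) = tsum t (\<lambda>p q. emb (f p q))"
  by (rule lin_tsum, intro clin, rule assms)+

lemma push_act_multiplier [push]:
  assumes "cbilinear g"
  shows "tsum t g \<rhd> a = tsum t (\<lambda>p q. g p q \<rhd> a)"
    "a \<lhd> tsum t g = tsum t (\<lambda>p q. a \<lhd> g p q)"
  by (rule lin_tsum[where g = "\<lambda>g. g \<rhd> a"], intro clin, rule assms)
    (rule lin_tsum[where g = "\<lambda>g. a \<lhd> g"], intro clin, rule assms)

lemma push_multiplier_tensor [push]:
  assumes "cbilinear f"
  shows "tsum t f \<otimes>\<^sub>M n = tsum t (\<lambda>p q. f p q \<otimes>\<^sub>M n)"
    "m \<otimes>\<^sub>M tsum t f = tsum t (\<lambda>p q. m \<otimes>\<^sub>M f p q)"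
  by (rule lin_tsum, intro clin, rule assms)+

lemma push_tsum [push]:
  assumes "cbilinear f" "cbilinear g"
  shows "tsum (tsum t f) g = tsum t (\<lambda>p q. tsum (f p q) g)"
  by (rule lin_tsum[OF clinear_tensor_lift[OF assms(2)] assms(1)])

lemma act_tsum:
  "(m \<otimes>\<^sub>M n) \<rhd> t = tsum t (\<lambda>p q. (m \<rhd> p) \<otimes> (n \<rhd> q))"
  "t \<lhd> (m \<otimes>\<^sub>M n) = tsum t (\<lambda>p q. (p \<lhd> m) \<otimes> (q \<lhd> n))"
proof -
  show "(m \<otimes>\<^sub>M n) \<rhd> t = tsum t (\<lambda>p q. (m \<rhd> p) \<otimes> (n \<rhd> q))"
    by (induct t rule: tensor_eq_induct)
      (intro csubspace_eq clin, subst tsum_pure, (intro clin)+, simp add: multiplier_tensor_act)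
  show "t \<lhd> (m \<otimes>\<^sub>M n) = tsum t (\<lambda>p q. (p \<lhd> m) \<otimes> (q \<lhd> n))"
    by (induct t rule: tensor_eq_induct)
      (intro csubspace_eq clin, subst tsum_pure, (intro clin)+, simp add: multiplier_tensor_act)
qed

lemma mult_tsum:
  fixes a :: "'a::complex_algebra" and b :: "'b::complex_algebra"
  shows "(a \<otimes> b) * t = tsum t (\<lambda>p q. (a * p) \<otimes> (b * q))"
  "t * (a \<otimes> b) = tsum t (\<lambda>p q. (p * a) \<otimes> (q * b))"
  using act_tsum(1)[of "emb a" "emb b" t] act_tsum(2)[of t "emb a" "emb b"]
  by (simp_all add: emb_act flip: emb_tensor)

lemma tensor_flip_eq_0: "tensor_flip t = 0 \<Longrightarrow> t = 0"
  by (metis tensor_flip_flip clinear_zero[OF clinear_tensor_flip])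

lemma slice_flip:
  fixes t :: "'a::complex_vector \<otimes> 'b::complex_vector"
  assumes f: "clinear f"
  shows "slice_right f (tensor_flip t) = slice_left f t"
proof -
  have "\<forall>t :: 'a \<otimes> 'b. slice_right f (tensor_flip t) = slice_left f t"
    by (rule tensor_all_eqI, rule clin_o[OF clinear_slice_right[OF f] clinear_tensor_flip],
        rule clinear_slice_left[OF f], simp add: slice_left_pure slice_right_pure tensor_flip_pure f)
  then show ?thesis by simp
qed

lemma tensor_eq_0I_left:
  assumes "\<And>f. clinear f \<Longrightarrow> slice_left f t = 0"
  shows "t = 0"
  by (rule tensor_flip_eq_0, rule tensor_eq_0I) (simp add: slice_flip assms)

lemma tensor_eqI:
  assumes "\<And>f. clinear f \<Longrightarrow> slice_right f s = slice_right f t"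
  shows "s = t"
proof -
  have "s - t = 0"
    by (rule tensor_eq_0I) (simp add: assms clinear_diff[OF clinear_slice_right])
  then show ?thesis by simp
qed

lemma tensor_eqI_left:
  assumes "\<And>f. clinear f \<Longrightarrow> slice_left f s = slice_left f t"
  shows "s = t"
proof -
  have "s - t = 0"
    by (rule tensor_eq_0I_left) (simp add: assms clinear_diff[OF clinear_slice_left])
  then show ?thesis by simp
qed

lemma slice_tsum:
  "slice_left f t = tsum t (\<lambda>p q. f p *\<^sub>C q)"
  "slice_right f' t = tsum t (\<lambda>p q. f' q *\<^sub>C p)"
  by (simp_all add: slice_left_def slice_right_def)

lemma clin_slice [clin]:
  "clinear f \<Longrightarrow> clinear g \<Longrightarrow> clinear (\<lambda>x. slice_left f (g x))"
  "clinear f' \<Longrightarrow> clinear g \<Longrightarrow> clinear (\<lambda>x. slice_right f' (g x))"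
  by (rule clin_o[OF clinear_slice_left] clin_o[OF clinear_slice_right]; assumption)+

lemma push_slice:
  assumes "clinear f" "cbilinear g"
  shows "slice_left f (tsum t g) = tsum t (\<lambda>p q. slice_left f (g p q))"
  by (rule lin_tsum, intro clin assms, intro assms)

lemma push_slice_right:
  assumes "clinear f" "cbilinear g"
  shows "slice_right f (tsum t g) = tsum t (\<lambda>p q. slice_right f (g p q))"
  by (rule lin_tsum, intro clin assms, intro assms)

section \<open>Cancellation of covering factors\<close>

lemma mult_cancel_all:
  fixes x y :: "'a::nondegenerate_algebra"
  shows "(\<And>c. x * c = y * c) \<Longrightarrow> x = y" "(\<And>c. c * x = c * y) \<Longrightarrow> x = y"
proof -
  show "x = y" if "\<And>c. x * c = y * c"
    using nondegenerate_left[of "x - y"] that by (simp add: left_diff_distrib)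
  show "x = y" if "\<And>c. c * x = c * y"
    using nondegenerate_right[of "x - y"] that by (simp add: right_diff_distrib)
qed

text \<open>Slicing the uncovered leg with a functional leaves an equation
  \<open>c * x = c * y\<close> in the algebra, and such slices separate tensors. The uncovered leg
  may therefore lie in any vector space.\<close>

lemma cover1_left:
  fixes X Y :: "('a::nondegenerate_algebra \<otimes> 'v::complex_vector)"
  assumes "\<And>c. tsum X (\<lambda>p v. (c * p) \<otimes> v) = tsum Y (\<lambda>p v. (c * p) \<otimes> v)"
  shows "X = Y"
proof (rule tensor_eqI)
  fix f :: "'v \<Rightarrow> complex" assume f [clin]: "clinear f"
  have *: "\<forall>Z :: 'a \<otimes> 'v. slice_right f (tsum Z (\<lambda>p v. (c * p) \<otimes> v)) = c * slice_right f Z" for c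
    by (rule tensor_all_eqI) (intro clin, intro clin, subst tsum_pure, (intro clin)+, simp add: slice_right_pure f mult_scaleC_right)
  have "c * slice_right f X = c * slice_right f Y" for c
    using arg_cong[OF assms[of c], of "slice_right f"] by (simp add: *)
  then show "slice_right f X = slice_right f Y"
    by (rule mult_cancel_all(2))
qed

lemma cover1_right:
  fixes X Y :: "('a::nondegenerate_algebra \<otimes> 'v::complex_vector)"
  assumes "\<And>c. tsum X (\<lambda>p v. (p * c) \<otimes> v) = tsum Y (\<lambda>p v. (p * c) \<otimes> v)"
  shows "X = Y"
proof (rule tensor_eqI)
  fix f :: "'v \<Rightarrow> complex" assume f [clin]: "clinear f"
  have *: "\<forall>Z :: 'a \<otimes> 'v. slice_right f (tsum Z (\<lambda>p v. (p * c) \<otimes> v)) = slice_right f Z * c" for c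
    by (rule tensor_all_eqI) (intro clin, intro clin, subst tsum_pure, (intro clin)+, simp add: slice_right_pure f mult_scaleC_left)
  have "slice_right f X * c = slice_right f Y * c" for c
    using arg_cong[OF assms[of c], of "slice_right f"] by (simp add: *)
  then show "slice_right f X = slice_right f Y"
    by (rule mult_cancel_all(1))
qed

lemma cover2_left:
  fixes X Y :: "('v::complex_vector \<otimes> 'a::nondegenerate_algebra)"
  assumes "\<And>c. tsum X (\<lambda>v p. v \<otimes> (c * p)) = tsum Y (\<lambda>v p. v \<otimes> (c * p))"
  shows "X = Y"
proof (rule tensor_eqI_left)
  fix f :: "'v \<Rightarrow> complex" assume f [clin]: "clinear f"
  have *: "\<forall>Z :: 'v \<otimes> 'a. slice_left f (tsum Z (\<lambda>v p. v \<otimes> (c * p))) = c * slice_left f Z" for c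
    by (rule tensor_all_eqI) (intro clin, intro clin, subst tsum_pure, (intro clin)+, simp add: slice_left_pure f mult_scaleC_right)
  have "c * slice_left f X = c * slice_left f Y" for c
    using arg_cong[OF assms[of c], of "slice_left f"] by (simp add: *)
  then show "slice_left f X = slice_left f Y"
    by (rule mult_cancel_all(2))
qed

lemma cover2_right:
  fixes X Y :: "('v::complex_vector \<otimes> 'a::nondegenerate_algebra)"
  assumes "\<And>c. tsum X (\<lambda>v p. v \<otimes> (p * c)) = tsum Y (\<lambda>v p. v \<otimes> (p * c))"
  shows "X = Y"
proof (rule tensor_eqI_left)
  fix f :: "'v \<Rightarrow> complex" assume f [clin]: "clinear f"
  have *: "\<forall>Z :: 'v \<otimes> 'a. slice_left f (tsum Z (\<lambda>v p. v \<otimes> (p * c))) = slice_left f Z * c" for c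
    by (rule tensor_all_eqI) (intro clin, intro clin, subst tsum_pure, (intro clin)+, simp add: slice_left_pure f mult_scaleC_left)
  have "slice_left f X * c = slice_left f Y * c" for c
    using arg_cong[OF assms[of c], of "slice_left f"] by (simp add: *)
  then show "slice_left f X = slice_left f Y"
    by (rule mult_cancel_all(1))
qed

text \<open>In an expansion along a basis of the first factor, the dual functionals return the
  coefficients as slices. This turns the membership in the definition of \<open>right_leg\<close>
  into a condition on slices.\<close>

lemma mem_span_slice_left:
  fixes t :: "('a::complex_vector \<otimes> 'b::complex_vector)"
  assumes W: "csubspace W" and sl: "\<And>f. clinear f \<Longrightarrow> slice_left f t \<in> W"
  shows "t \<in> cspan {c \<otimes> w | c w. w \<in> W}"
proof -
  obtain B :: "'a set" where B: "complex_vector.independent B" "\<And>x. x \<in> complex_vector.span B"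
    using complex_vector.independent_extend_basis[OF complex_vector.independent_empty]
      complex_vector.span_extend_basis[OF complex_vector.independent_empty] by (metis UNIV_I)
  obtain F g where F: "finite F" "F \<subseteq> B" "tensor_flip t = (\<Sum>b\<in>F. g b \<otimes> b)"
    using tensor_basis_representation[OF B(2)] by blast
  have t: "t = (\<Sum>b\<in>F. b \<otimes> g b)"
    by (subst tensor_flip_flip[symmetric])
      (simp add: F(3) clinear_sum[OF clinear_tensor_flip] tensor_flip_pure)
  have "g b \<in> W" if b: "b \<in> F" for b
  proof -
    obtain f :: "'a \<Rightarrow> complex" where f: "clinear f" "\<forall>x\<in>B. f x = (if x = b then 1 else 0)"
      using complex_vector_pair.linear_independent_extend[OF B(1), of "\<lambda>x. if x = b then 1 else 0 :: complex"]
      by blast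
    have "slice_left f t = (\<Sum>x\<in>F. f x *\<^sub>C g x)"
      by (simp add: t clinear_sum[OF clinear_slice_left[OF f(1)]] slice_left_pure[OF f(1)])
    also have "\<dots> = (\<Sum>x\<in>F. if x = b then g x else 0)"
      using f(2) F(2) by (intro sum.cong) (auto simp: scaleC_one)
    also have "\<dots> = g b" using b F(1) by simp
    finally show ?thesis using sl[OF f(1)] by simp
  qed
  then show ?thesis
    unfolding t by (intro complex_vector.span_sum complex_vector.span_base) auto
qed

lemma mem_span_slice_right:
  fixes t :: "('a::complex_vector \<otimes> 'b::complex_vector)"
  assumes W: "csubspace W" and sl: "\<And>f. clinear f \<Longrightarrow> slice_right f t \<in> W"
  shows "t \<in> cspan {w \<otimes> c | w c. w \<in> W}"
proof -
  have sub: "csubspace {t. tensor_flip t \<in> cspan {w \<otimes> c | w c. w \<in> W}}"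
    by (rule complex_vector_pair.linear_subspace_vimage[OF clinear_tensor_flip, unfolded vimage_def])
      (rule complex_vector.subspace_span)
  have "tensor_flip t \<in> cspan {c \<otimes> w | c w. w \<in> W}"
    by (rule mem_span_slice_left[OF W]) (metis sl slice_flip tensor_flip_flip)
  also have "\<dots> \<subseteq> {t. tensor_flip t \<in> cspan {w \<otimes> c | w c. w \<in> W}}"
    by (rule complex_vector.span_minimal[OF _ sub])
      (auto simp: tensor_flip_pure intro!: complex_vector.span_base, blast)
  finally show ?thesis by (simp add: tensor_flip_flip)
qed

lemma exists_separating_functional:
  fixes v :: "'a::complex_vector"
  assumes U: "csubspace U" and v: "v \<notin> U"
  shows "\<exists>f :: 'a \<Rightarrow> complex. clinear f \<and> (\<forall>u\<in>U. f u = 0) \<and> f v = 1"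
proof -
  obtain B where B: "B \<subseteq> U" "complex_vector.independent B" "U \<subseteq> complex_vector.span B"
    by (rule complex_vector.maximal_independent_subset)
  have sU: "complex_vector.span B = U"
    using B complex_vector.span_minimal[OF B(1) U] by blast
  then have ind: "complex_vector.independent (insert v B)"
    using B v by (simp add: complex_vector.independent_insertI)
  obtain f :: "'a \<Rightarrow> complex" where f: "clinear f" "\<forall>x\<in>insert v B. f x = (if x = v then 1 else 0)"
    using complex_vector_pair.linear_independent_extend[OF ind, of "\<lambda>x. if x = v then 1 else 0 :: complex"]
    by blast
  have "f u = 0" if "u \<in> U" for u
  proof (rule complex_vector_pair.linear_eq_0_on_span[OF f(1)])
    show "u \<in> complex_vector.span B" using that sU by simp
    show "f x = 0" if "x \<in> B" for x using f(2) that B(1) v by auto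
  qed
  with f show ?thesis by auto
qed


section \<open>Multipliers\<close>

text \<open>Non-degeneracy makes compatibility alone sufficient: linearity and the module properties
  of \<open>l\<close> and \<open>r\<close> follow after multiplication by an arbitrary element from
  the other side. The constructions of multipliers below go through this lemma.\<close>

lemma ex_multiplier:
  fixes l r :: "'a::nondegenerate_algebra \<Rightarrow> 'a"
  assumes lr: "\<And>a b. r a * b = a * l b"
  shows "\<exists>x. (\<forall>a. x \<rhd> a = l a) \<and> (\<forall>a. a \<lhd> x = r a)"
proof -
  have eqL: "x = y" if "\<And>a::'a. a * x = a * y" for x y
  proof -
    have "x - y = 0" by (rule nondegenerate_right) (simp add: right_diff_distrib that)
    then show ?thesis by simp
  qed
  have eqR: "x = y" if "\<And>a::'a. x * a = y * a" for x y
  proof -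
    have "x - y = 0" by (rule nondegenerate_left) (simp add: left_diff_distrib that)
    then show ?thesis by simp
  qed
  have "clinear l"
    by (rule clinearI; rule eqL) (simp_all add: distrib_left mult_scaleC_right flip: lr)
  moreover have "clinear r"
    by (rule clinearI; rule eqR) (simp_all add: distrib_right mult_scaleC_left lr)
  moreover have "l (a * b) = l a * b" for a b
    by (rule eqL) (metis lr mult.assoc)
  moreover have "r (a * b) = a * r b" for a b
    by (rule eqR) (metis lr mult.assoc)
  ultimately have mem: "(l, r) \<in> {(l, r). clinear l \<and> clinear r \<and>
     (\<forall>a b. l (a * b) = l a * b) \<and> (\<forall>a b. r (a * b) = a * r b) \<and> (\<forall>a b. r a * b = a * l b)}"
    by (simp add: lr)
  show ?thesis
    by (rule exI[of _ "Abs_multiplier (l, r)"])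
      (simp add: left_act.rep_eq right_act.rep_eq Abs_multiplier_inverse[OF mem])
qed

lemma multiplier_eqI_left:
  fixes x y :: "'a::nondegenerate_algebra multiplier"
  assumes "\<And>a. x \<rhd> a = y \<rhd> a"
  shows "x = y"
  by (rule multiplier_eqI[OF assms], rule mult_cancel_all(1)) (simp add: act_middle assms)

lemma multiplier_eqI_right:
  fixes x y :: "'a::nondegenerate_algebra multiplier"
  assumes "\<And>a. a \<lhd> x = a \<lhd> y"
  shows "x = y"
  by (rule multiplier_eqI[OF _ assms], rule mult_cancel_all(2)) (simp add: assms flip: act_middle)

lemma multiplier_tensor_eqI:
  fixes x y :: "('a::nondegenerate_algebra \<otimes> 'b::nondegenerate_algebra) multiplier"
  shows "(\<And>a b. x \<rhd> (a \<otimes> b) = y \<rhd> (a \<otimes> b)) \<Longrightarrow> x = y"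
    and "(\<And>a b. (a \<otimes> b) \<lhd> x = (a \<otimes> b) \<lhd> y) \<Longrightarrow> x = y"
proof -
  show "x = y" if "\<And>a b. x \<rhd> (a \<otimes> b) = y \<rhd> (a \<otimes> b)"
  proof (rule multiplier_eqI_left)
    have "\<forall>t. x \<rhd> t = y \<rhd> t"
      by (rule tensor_all_eqI) (intro clin that)+
    then show "x \<rhd> t = y \<rhd> t" for t by simp
  qed
  show "x = y" if *: "\<And>a b. (a \<otimes> b) \<lhd> x = (a \<otimes> b) \<lhd> y"
  proof (rule multiplier_eqI_right)
    have "\<forall>t. t \<lhd> x = t \<lhd> y"
      by (rule tensor_all_eqI) (intro clin *)+
    then show "t \<lhd> x = t \<lhd> y" for t by simp
  qed
qed

lemma emb_act_mult: "emb (m \<rhd> a) = m * emb a" "emb (a \<lhd> m) = emb a * m"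
  by (simp_all add: mult_emb)

abbreviation (input) "emb1 a \<equiv> emb a \<otimes>\<^sub>M 1"
abbreviation (input) "emb2 a \<equiv> 1 \<otimes>\<^sub>M emb a"

lemma multiplier_cancel:
  fixes x y :: "('a::nondegenerate_algebra \<otimes> 'b::nondegenerate_algebra) multiplier"
  shows "(\<And>c. x * emb1 c = y * emb1 c) \<Longrightarrow> x = y"
    and "(\<And>d. x * emb2 d = y * emb2 d) \<Longrightarrow> x = y"
    and "(\<And>c. (emb1 c) * x = emb1 c * y) \<Longrightarrow> x = y"
    and "(\<And>d. (emb2 d) * x = emb2 d * y) \<Longrightarrow> x = y"
proof -
  note acts = act_tsum left_act_simps right_act_simps emb_act
  show "x = y" if *: "\<And>c. x * emb1 c = y * emb1 c"
  proof (rule multiplier_eqI_right, rule cover1_right)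
    fix a c show "tsum (a \<lhd> x) (\<lambda>p v. (p * c) \<otimes> v) = tsum (a \<lhd> y) (\<lambda>p v. (p * c) \<otimes> v)"
      using arg_cong[OF *[of c], of "\<lambda>m. a \<lhd> m"] by (simp add: acts)
  qed
  show "x = y" if *: "\<And>d. x * emb2 d = y * emb2 d"
  proof (rule multiplier_eqI_right, rule cover2_right)
    fix a c show "tsum (a \<lhd> x) (\<lambda>p v. p \<otimes> (v * c)) = tsum (a \<lhd> y) (\<lambda>p v. p \<otimes> (v * c))"
      using arg_cong[OF *[of c], of "\<lambda>m. a \<lhd> m"] by (simp add: acts)
  qed
  show "x = y" if *: "\<And>c. (emb1 c) * x = emb1 c * y"
  proof (rule multiplier_eqI_left, rule cover1_left)
    fix a c show "tsum (x \<rhd> a) (\<lambda>p v. (c * p) \<otimes> v) = tsum (y \<rhd> a) (\<lambda>p v. (c * p) \<otimes> v)"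
      using arg_cong[OF *[of c], of "\<lambda>m. m \<rhd> a"] by (simp add: acts)
  qed
  show "x = y" if *: "\<And>d. (emb2 d) * x = emb2 d * y"
  proof (rule multiplier_eqI_left, rule cover2_left)
    fix a c show "tsum (x \<rhd> a) (\<lambda>p v. p \<otimes> (c * v)) = tsum (y \<rhd> a) (\<lambda>p v. p \<otimes> (c * v))"
      using arg_cong[OF *[of c], of "\<lambda>m. m \<rhd> a"] by (simp add: acts)
  qed
qed

text \<open>The span conditions make the definite description in \<open>multiplier_extension\<close>
  satisfiable and unique: on \<open>e C\<close> an extension is forced to send
  \<open>\<phi>(b)c\<close> to \<open>\<phi>(mb)c\<close>. Idempotency of \<open>e\<close> is a
  consequence.\<close>

definition extendable ::
    "('b::complex_algebra \<Rightarrow> 'c::nondegenerate_algebra multiplier) \<Rightarrow> 'c multiplier \<Rightarrow> bool"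
  where "extendable \<phi> e \<longleftrightarrow> algebra_hom \<phi> \<and> (\<forall>b. e * \<phi> b = \<phi> b) \<and> (\<forall>b. \<phi> b * e = \<phi> b) \<and>
    (\<forall>c. e \<rhd> c \<in> cspan {\<phi> b \<rhd> c' | b c'. True}) \<and>
    (\<forall>c. c \<lhd> e \<in> cspan {c' \<lhd> \<phi> b | b c'. True})"

lemma extendable_idem:
  assumes "extendable \<phi> e"
  shows "e * e = e"
proof (rule multiplier_eqI_left)
  fix c
  have "\<forall>w\<in>cspan {\<phi> b \<rhd> c' | b c'. True}. e \<rhd> w = w"
  proof
    fix w assume "w \<in> cspan {\<phi> b \<rhd> c' | b c'. True}"
    then show "e \<rhd> w = w"
      by (rule complex_vector_pair.linear_eq_on[OF clinear_left_act clinear_ident])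
        (use assms in \<open>auto simp: extendable_def simp flip: left_act_simps(7)\<close>)
  qed
  then show "(e * e) \<rhd> c = e \<rhd> c"
    using assms by (simp add: extendable_def left_act_simps)
qed

text \<open>An \<open>x\<close> with \<open>x e = x\<close> is determined by its action on
  \<open>e C\<close>, and this lies in the span of the images \<open>\<phi>(b)c\<close>.\<close>

lemma extendable_eqI:
  assumes "extendable \<phi> e" "x * e = x" "y * e = y" "\<And>b. x * \<phi> b = y * \<phi> b"
  shows "x = y"
proof (rule multiplier_eqI_left)
  fix c
  have "e \<rhd> c \<in> cspan {\<phi> b \<rhd> c' | b c'. True}"
    using assms(1) by (simp add: extendable_def)
  then have "x \<rhd> e \<rhd> c = y \<rhd> e \<rhd> c"
    by (rule complex_vector_pair.linear_eq_on[OF clinear_left_act clinear_left_act])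
      (use assms(4) in \<open>auto simp flip: left_act_simps(7)\<close>)
  then show "x \<rhd> c = y \<rhd> c"
    using assms(2,3) by (simp flip: left_act_simps(7))
qed

text \<open>The rule \<open>\<phi>(b)c \<mapsto> \<phi>(mb)c\<close> is not visibly well defined,
  since an element of the span has many representations. Instead, values are chosen on both sides
  and only their compatibility is checked; \<open>ex_multiplier\<close> does the rest.\<close>

lemma extendable_exists:
  fixes \<phi> :: "'b::complex_algebra \<Rightarrow> 'c::nondegenerate_algebra multiplier"
  assumes ext: "extendable \<phi> e"
  shows "\<exists>x. (\<forall>b. x * \<phi> b = \<phi> (m \<rhd> b)) \<and> (\<forall>b. \<phi> b * x = \<phi> (b \<lhd> m)) \<and> x * e = x \<and> e * x = x"
proof -
  have hom: "\<phi> (a * b) = \<phi> a * \<phi> b" "clinear \<phi>" for a b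
    using ext by (auto simp: extendable_def algebra_hom_def)
  have e: "e * \<phi> b = \<phi> b" "\<phi> b * e = \<phi> b" for b
    using ext by (auto simp: extendable_def)
  have eL: "e \<rhd> \<phi> b \<rhd> c = \<phi> b \<rhd> c" "\<phi> b \<rhd> e \<rhd> c = \<phi> b \<rhd> c" for b c
    by (simp_all add: e flip: left_act_simps(7))
  have eR: "c \<lhd> e \<lhd> \<phi> b = c \<lhd> \<phi> b" "c \<lhd> \<phi> b \<lhd> e = c \<lhd> \<phi> b" for b c
    by (simp_all add: e flip: right_act_simps(7))
  have homL: "\<phi> b \<rhd> \<phi> b' \<rhd> c = \<phi> (b * b') \<rhd> c" for b b' c
    by (simp add: hom left_act_simps)
  have homR: "c \<lhd> \<phi> b \<lhd> \<phi> b' = c \<lhd> \<phi> (b * b')" for b b' c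
    by (simp add: hom right_act_simps)
  \<comment> \<open>\<open>PL w u\<close> says that \<open>u\<close> behaves like
    \<open>\<psi>(m) w\<close>, and \<open>PR w v\<close> that \<open>v\<close> behaves like
    \<open>w \<psi>(m)\<close>, where \<psi> is the extension sought.\<close>
  define PL where "PL w u \<longleftrightarrow> e \<rhd> u = u \<and> (\<forall>b. \<phi> b \<rhd> u = \<phi> (b \<lhd> m) \<rhd> w)" for w u
  define PR where "PR w v \<longleftrightarrow> v \<lhd> e = v \<and> (\<forall>b. v \<lhd> \<phi> b = w \<lhd> \<phi> (m \<rhd> b))" for w v
  note addL = clinear_add[OF clinear_left_act] clinear_scale[OF clinear_left_act]
  note addR = clinear_add[OF clinear_right_act] clinear_scale[OF clinear_right_act]
  have exL: "\<exists>u. PL w u \<and> (\<forall>a v. PR a v \<longrightarrow> v * w = a * u)"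
    if "w \<in> cspan {\<phi> b \<rhd> c' | b c'. True}" for w
    using that
  proof (induct rule: complex_vector.span_induct_alt)
    case base
    show ?case
      by (rule exI[of _ 0]) (simp add: PL_def clinear_zero[OF clinear_left_act])
  next
    case (step c x y)
    then obtain b c' u where x: "x = \<phi> b \<rhd> c'"
      and u: "PL y u" "\<forall>a v. PR a v \<longrightarrow> v * y = a * u" by blast
    have "v * (c *\<^sub>C x + y) = a * (c *\<^sub>C (\<phi> (m \<rhd> b) \<rhd> c') + u)" if v: "PR a v" for a v
    proof -
      have "v * x = a * (\<phi> (m \<rhd> b) \<rhd> c')"
        using v by (simp add: x PR_def flip: act_middle)
      then show ?thesis
        using u(2) v by (simp add: distrib_left mult_scaleC_right)
    qed
    moreover have "PL (c *\<^sub>C x + y) (c *\<^sub>C (\<phi> (m \<rhd> b) \<rhd> c') + u)"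
      using u(1) by (simp add: PL_def x addL eL homL act_middle)
    ultimately show ?case by blast
  qed
  have exR: "\<exists>v. PR w v" if "w \<in> cspan {c' \<lhd> \<phi> b | b c'. True}" for w
    using that
  proof (induct rule: complex_vector.span_induct_alt)
    case base
    show ?case
      by (rule exI[of _ 0]) (simp add: PR_def clinear_zero[OF clinear_right_act])
  next
    case (step c x y)
    then obtain b c' v where x: "x = c' \<lhd> \<phi> b" and v: "PR y v" by blast
    have "PR (c *\<^sub>C x + y) (c *\<^sub>C (c' \<lhd> \<phi> (b \<lhd> m)) + v)"
      using v by (simp add: PR_def x addR eR homR act_middle)
    then show ?case by blast
  qed
  have "\<forall>c. \<exists>u. PL (e \<rhd> c) u \<and> (\<forall>a v. PR a v \<longrightarrow> v * (e \<rhd> c) = a * u)"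
    using exL ext by (simp add: extendable_def)
  then obtain l where l: "\<And>c. PL (e \<rhd> c) (l c)" "\<And>c a v. PR a v \<Longrightarrow> v * (e \<rhd> c) = a * l c"
    by metis
  have "\<forall>c. \<exists>v. PR (c \<lhd> e) v"
    using exR ext by (simp add: extendable_def)
  then obtain r where r: "\<And>c. PR (c \<lhd> e) (r c)" by metis
  have "r a * b = a * l b" for a b
  proof -
    have "r a * b = r a * (e \<rhd> b)"
      using r[of a] by (simp add: PR_def flip: act_middle)
    also have "\<dots> = (a \<lhd> e) * l b" by (rule l(2)[OF r])
    also have "\<dots> = a * l b" using l(1)[of b] by (simp add: PL_def act_middle)
    finally show ?thesis .
  qed
  from ex_multiplier[of r l, OF this] obtain x where
    x: "\<And>a. x \<rhd> a = l a" "\<And>a. a \<lhd> x = r a" by blast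
  show ?thesis
  proof (intro exI[of _ x] conjI allI)
    show "x * \<phi> b = \<phi> (m \<rhd> b)" for b
      by (rule multiplier_eqI_right) (use r in \<open>simp add: right_act_simps x PR_def eR\<close>)
    show "\<phi> b * x = \<phi> (b \<lhd> m)" for b
      by (rule multiplier_eqI_left) (use l(1) in \<open>simp add: left_act_simps x PL_def eL\<close>)
    show "x * e = x"
      by (rule multiplier_eqI_right) (use r in \<open>simp add: right_act_simps x PR_def\<close>)
    show "e * x = x"
      by (rule multiplier_eqI_left) (use l(1) in \<open>simp add: left_act_simps x PL_def\<close>)
  qed
qed

text \<open>The equations \<open>\<psi>(m)\<phi>(b) = \<phi>(mb)\<close> and
  \<open>\<psi>(m)e = \<psi>(m)\<close> leave no freedom for \<open>\<psi>(m)\<close>. This gives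
  multiplicativity of a chosen solution as well as uniqueness.\<close>

lemma multiplier_extension:
  fixes \<phi> :: "'b::complex_algebra \<Rightarrow> 'c::nondegenerate_algebra multiplier"
  assumes ext: "extendable \<phi> e"
  shows "algebra_hom (multiplier_extension \<phi> e)"
    and "multiplier_extension \<phi> e (emb b) = \<phi> b"
    and "multiplier_extension \<phi> e 1 = e"
proof -
  define \<psi> where "\<psi> m = (SOME x. (\<forall>b. x * \<phi> b = \<phi> (m \<rhd> b)) \<and> x * e = x)" for m
  have \<psi>: "\<psi> m * \<phi> b = \<phi> (m \<rhd> b)" "\<psi> m * e = \<psi> m" for m b
    using someI_ex[of "\<lambda>x. (\<forall>b. x * \<phi> b = \<phi> (m \<rhd> b)) \<and> x * e = x"] extendable_exists[OF ext, of m]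
    unfolding \<psi>_def by blast+
  have hom: "\<phi> (a * b) = \<phi> a * \<phi> b" "clinear \<phi>" for a b
    using ext by (auto simp: extendable_def algebra_hom_def)
  have e: "e * \<phi> b = \<phi> b" "\<phi> b * e = \<phi> b" for b
    using ext by (auto simp: extendable_def)
  note eqI = extendable_eqI[OF ext]
  have 1: "algebra_hom \<psi> \<and> (\<forall>b. \<psi> (emb b) = \<phi> b) \<and> \<psi> 1 = e"
    unfolding algebra_hom_def
  proof (intro conjI allI clinearI)
    show "\<psi> (x + y) = \<psi> x + \<psi> y" for x y
      by (rule eqI) (simp_all add: \<psi> distrib_right left_act_simps clinear_add[OF hom(2)])
    show "\<psi> (c *\<^sub>C x) = c *\<^sub>C \<psi> x" for c x
      by (rule eqI) (simp_all add: \<psi> mult_scaleC_left left_act_simps clinear_scale[OF hom(2)])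
    show "\<psi> (x * y) = \<psi> x * \<psi> y" for x y
      by (rule eqI) (simp_all add: \<psi> mult.assoc left_act_simps)
    show "\<psi> (emb b) = \<phi> b" for b
      by (rule eqI) (simp_all add: \<psi> e emb_act hom)
    show "\<psi> 1 = e"
      by (rule eqI) (simp_all add: \<psi> e left_act_simps extendable_idem[OF ext])
  qed
  moreover have "\<psi>' = \<psi>" if "algebra_hom \<psi>' \<and> (\<forall>b. \<psi>' (emb b) = \<phi> b) \<and> \<psi>' 1 = e" for \<psi>'
  proof
    fix m
    have m: "\<psi>' (x * y) = \<psi>' x * \<psi>' y" for x y
      using that by (simp add: algebra_hom_def)
    show "\<psi>' m = \<psi> m"
    proof (rule eqI)
      show "\<psi>' m * e = \<psi>' m" using m[of m 1] that by simp
      show "\<psi>' m * \<phi> b = \<psi> m * \<phi> b" for b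
        using m[of m "emb b"] that by (simp add: \<psi> mult_emb)
    qed (rule \<psi>)
  qed
  ultimately have "multiplier_extension \<phi> e = \<psi>"
    unfolding multiplier_extension_def by (rule the_equality)
  with 1 show "algebra_hom (multiplier_extension \<phi> e)" "multiplier_extension \<phi> e (emb b) = \<phi> b"
    "multiplier_extension \<phi> e 1 = e" by simp_all
qed

lemma multiplier_extension_mult:
  assumes "extendable \<phi> e"
  shows "multiplier_extension \<phi> e (x * y) = multiplier_extension \<phi> e x * multiplier_extension \<phi> e y"
    and "multiplier_extension \<phi> e m * \<phi> b = \<phi> (m \<rhd> b)"
    and "\<phi> b * multiplier_extension \<phi> e m = \<phi> (b \<lhd> m)"
    and "multiplier_extension \<phi> e m * e = multiplier_extension \<phi> e m"
    and "e * multiplier_extension \<phi> e m = multiplier_extension \<phi> e m"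
proof -
  note ext = multiplier_extension[OF assms]
  show 1: "multiplier_extension \<phi> e (x * y) = multiplier_extension \<phi> e x * multiplier_extension \<phi> e y" for x y
    using ext(1) by (simp add: algebra_hom_def)
  show "multiplier_extension \<phi> e m * \<phi> b = \<phi> (m \<rhd> b)"
    "\<phi> b * multiplier_extension \<phi> e m = \<phi> (b \<lhd> m)"
    using 1[of m "emb b"] 1[of "emb b" m] by (simp_all add: mult_emb ext(2))
  show "multiplier_extension \<phi> e m * e = multiplier_extension \<phi> e m"
    "e * multiplier_extension \<phi> e m = multiplier_extension \<phi> e m"
    using 1[of m 1] 1[of 1 m] by (simp_all add: ext(3))
qed

lemma multiplier_extension_eqI:
  assumes "extendable \<phi> e" "z * e = z" "\<And>b. z * \<phi> b = \<phi> (m \<rhd> b)"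
  shows "multiplier_extension \<phi> e m = z"
  by (rule extendable_eqI[OF assms(1)]) (simp_all add: assms multiplier_extension_mult)


subsection \<open>Transport along isomorphisms and anti-isomorphisms\<close>

lemma transport_hom:
  fixes f :: "'a::nondegenerate_algebra \<Rightarrow> 'b::nondegenerate_algebra"
  assumes f: "algebra_hom f" "bij f"
  shows "multiplier_transport f (x * y) = multiplier_transport f x * multiplier_transport f y"
    and "clinear (multiplier_transport f)"
    and "multiplier_transport f 1 = 1"
    and "multiplier_transport f (emb a) = emb (f a)"
    and "multiplier_transport f x = multiplier_transport f y \<Longrightarrow> x = y"
proof -
  note act = multiplier_transport_act[OF f]
  have hom: "f (a * b) = f a * f b" "f (a + b) = f a + f b" "f (c *\<^sub>C a) = c *\<^sub>C f a" for a b c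
    using f(1) by (simp_all add: algebra_hom_def clinear_iff)
  have eqI: "u = v" if "\<And>a. u \<rhd> f a = v \<rhd> f a" for u v
    by (rule multiplier_eqI_left) (metis that f(2) bij_pointE)
  show "multiplier_transport f (x * y) = multiplier_transport f x * multiplier_transport f y"
    by (rule eqI) (simp add: act left_act_simps)
  show "clinear (multiplier_transport f)"
    by (rule clinearI; rule eqI) (simp_all add: act left_act_simps hom)
  show "multiplier_transport f 1 = 1"
    by (rule eqI) (simp add: act left_act_simps)
  show "multiplier_transport f (emb a) = emb (f a)"
    by (rule eqI) (simp add: act emb_act hom)
  show "x = y" if "multiplier_transport f x = multiplier_transport f y"
  proof (rule multiplier_eqI_left)
    fix a have "f (x \<rhd> a) = f (y \<rhd> a)" by (simp add: that flip: act(1))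
    then show "x \<rhd> a = y \<rhd> a" using f(2) by (simp add: bij_def inj_def)
  qed
qed

text \<open>\<open>multiplier_transport\<close> is for isomorphisms; an anti-isomorphism exchanges
  the left and right actions. It is applied to the antipode and to
  \<open>\<sigma>(S \<otimes> S)\<close>.\<close>

definition anti_ext :: "('a::nondegenerate_algebra \<Rightarrow> 'b::nondegenerate_algebra) \<Rightarrow> 'a multiplier \<Rightarrow> 'b multiplier"
  where "anti_ext f x = (SOME y. \<forall>a. y \<rhd> f a = f (a \<lhd> x) \<and> f a \<lhd> y = f (x \<rhd> a))"

lemma anti_ext_act:
  fixes f :: "'a::nondegenerate_algebra \<Rightarrow> 'b::nondegenerate_algebra"
  assumes "algebra_antihom f" "bij f"
  shows "anti_ext f x \<rhd> f a = f (a \<lhd> x)" "f a \<lhd> anti_ext f x = f (x \<rhd> a)"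
proof -
  have hom: "f (a * b) = f b * f a" for a b
    using assms(1) by (simp add: algebra_antihom_def)
  have inv: "inv f (f a) = a" "f (inv f b) = b" for a b
    using assms(2) by (simp_all add: bij_is_inj bij_is_surj surj_f_inv_f)
  have "f (x \<rhd> inv f a) * b = a * f (inv f b \<lhd> x)" for a b
    by (metis hom inv(2) act_middle)
  from ex_multiplier[of "\<lambda>a. f (x \<rhd> inv f a)" "\<lambda>b. f (inv f b \<lhd> x)", OF this]
  have "\<exists>y. \<forall>a. y \<rhd> f a = f (a \<lhd> x) \<and> f a \<lhd> y = f (x \<rhd> a)"
    using inv by metis
  from someI_ex[OF this]
  show "anti_ext f x \<rhd> f a = f (a \<lhd> x)" "f a \<lhd> anti_ext f x = f (x \<rhd> a)"
    unfolding anti_ext_def by simp_all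
qed

lemma anti_ext_hom:
  fixes f :: "'a::nondegenerate_algebra \<Rightarrow> 'b::nondegenerate_algebra"
  assumes f: "algebra_antihom f" "bij f"
  shows "anti_ext f (x * y) = anti_ext f y * anti_ext f x"
    and "clinear (anti_ext f)"
    and "anti_ext f 1 = 1"
    and "anti_ext f (emb a) = emb (f a)"
proof -
  note act = anti_ext_act[OF f]
  have hom: "f (a * b) = f b * f a" "f (a + b) = f a + f b" "f (c *\<^sub>C a) = c *\<^sub>C f a" for a b c
    using f(1) by (simp_all add: algebra_antihom_def clinear_iff)
  have eqI: "u = v" if "\<And>a. u \<rhd> f a = v \<rhd> f a" for u v
    by (rule multiplier_eqI_left) (metis that f(2) bij_pointE)
  show "anti_ext f (x * y) = anti_ext f y * anti_ext f x"
    by (rule eqI) (simp add: act left_act_simps right_act_simps)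
  show "clinear (anti_ext f)"
    by (rule clinearI; rule eqI) (simp_all add: act left_act_simps right_act_simps hom)
  show "anti_ext f 1 = 1"
    by (rule eqI) (simp add: act left_act_simps right_act_simps)
  show "anti_ext f (emb a) = emb (f a)"
    by (rule eqI) (simp add: act emb_act hom)
qed


subsection \<open>Threefold tensor products\<close>

lemma multiplier3_eqI:
  fixes x y :: "('a::nondegenerate_algebra \<otimes> 'b::nondegenerate_algebra \<otimes> 'c::nondegenerate_algebra) multiplier"
  assumes "\<And>a b c. x \<rhd> (a \<otimes> b \<otimes> c) = y \<rhd> (a \<otimes> b \<otimes> c)"
  shows "x = y"
proof (rule multiplier_tensor_eqI(1))
  fix a w
  have "\<forall>w. x \<rhd> (a \<otimes> w) = y \<rhd> (a \<otimes> w)"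
    by (rule tensor_all_eqI) (intro clin assms)+
  then show "x \<rhd> (a \<otimes> w) = y \<rhd> (a \<otimes> w)" by simp
qed

abbreviation assoc_transport ::
  "(('a::complex_algebra \<otimes> 'b::complex_algebra) \<otimes> 'c::complex_algebra) multiplier \<Rightarrow> ('a \<otimes> 'b \<otimes> 'c) multiplier"
  where "assoc_transport \<equiv> multiplier_transport tensor_assoc"

lemmas assoc_transport_act = multiplier_transport_act[OF algebra_hom_tensor_assoc bij_tensor_assoc]

lemmas assoc_transport_hom = transport_hom[OF algebra_hom_tensor_assoc bij_tensor_assoc]

lemma assoc_transport_pure:
  "assoc_transport ((x \<otimes>\<^sub>M y) \<otimes>\<^sub>M z) = x \<otimes>\<^sub>M y \<otimes>\<^sub>M z"
  for x :: "'a::nondegenerate_algebra multiplier" and y :: "'b::nondegenerate_algebra multiplier"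
    and z :: "'c::nondegenerate_algebra multiplier"
proof (rule multiplier3_eqI)
  show "assoc_transport ((x \<otimes>\<^sub>M y) \<otimes>\<^sub>M z) \<rhd> (a \<otimes> b \<otimes> c) = (x \<otimes>\<^sub>M y \<otimes>\<^sub>M z) \<rhd> (a \<otimes> b \<otimes> c)" for a b c
    using assoc_transport_act(1)[of "(x \<otimes>\<^sub>M y) \<otimes>\<^sub>M z" "(a \<otimes> b) \<otimes> c"]
    by (simp add: multiplier_tensor_act tensor_assoc_pure)
qed

lemma clin_assoc_transport [clin]:
  fixes f :: "'v::complex_vector \<Rightarrow> (('a::nondegenerate_algebra \<otimes> 'b::nondegenerate_algebra) \<otimes> 'c::nondegenerate_algebra) multiplier"
  shows "clinear f \<Longrightarrow> clinear (\<lambda>x. assoc_transport (f x))"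
  by (rule clin_o[OF assoc_transport_hom(2)])

lemma clin_tensor_assoc [clin]: "clinear f \<Longrightarrow> clinear (\<lambda>x. tensor_assoc (f x))"
  by (rule clin_o[OF clinear_tensor_assoc])

lemma tensor_assoc_tsum: "tensor_assoc (t \<otimes> c) = tsum t (\<lambda>a b. a \<otimes> b \<otimes> c)"
  for t :: "'a::complex_vector \<otimes> 'b::complex_vector" and c :: "'c::complex_vector"
  by (induct t rule: tensor_eq_induct)
    (intro csubspace_eq clin, subst tsum_pure, (intro clin)+, simp add: tensor_assoc_pure)

subsection \<open>Extensions on tensor products\<close>

lemma extendable_eqI_right:
  assumes "extendable \<phi> e" "e * x = x" "e * y = y" "\<And>b. \<phi> b * x = \<phi> b * y"
  shows "x = y"
proof (rule multiplier_eqI_right)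
  fix c
  have "c \<lhd> e \<in> cspan {c' \<lhd> \<phi> b | b c'. True}"
    using assms(1) by (simp add: extendable_def)
  then have "c \<lhd> e \<lhd> x = c \<lhd> e \<lhd> y"
    by (rule complex_vector_pair.linear_eq_on[OF clinear_right_act clinear_right_act])
      (use assms(4) in \<open>auto simp flip: right_act_simps(7)\<close>)
  then show "c \<lhd> x = c \<lhd> y"
    using assms(2,3) by (simp flip: right_act_simps(7))
qed

lemma extendable_transport:
  fixes f :: "'b::nondegenerate_algebra \<Rightarrow> 'c::nondegenerate_algebra"
  assumes ext: "extendable \<phi> e" and f: "algebra_hom f" "bij f"
  shows "extendable (\<lambda>t. multiplier_transport f (\<phi> t)) (multiplier_transport f e)"
proof -
  note act = multiplier_transport_act[OF f] and hom = transport_hom[OF f]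
  have lin: "clinear f" using f(1) by (simp add: algebra_hom_def)
  have L: "f c \<in> cspan {multiplier_transport f (\<phi> b) \<rhd> c' | b c'. True}"
    if "c \<in> cspan {\<phi> b \<rhd> c' | b c'. True}" for c
  proof -
    have "f c \<in> cspan (f ` {\<phi> b \<rhd> c' | b c'. True})"
      using that complex_vector_pair.linear_span_image[OF lin] by blast
    moreover have "f ` {\<phi> b \<rhd> c' | b c'. True} \<subseteq> {multiplier_transport f (\<phi> b) \<rhd> c' | b c'. True}"
      by (auto simp flip: act(1), blast)
    ultimately show ?thesis using complex_vector.span_mono by blast
  qed
  have R: "f c \<in> cspan {c' \<lhd> multiplier_transport f (\<phi> b) | b c'. True}"
    if "c \<in> cspan {c' \<lhd> \<phi> b | b c'. True}" for c
  proof -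
    have "f c \<in> cspan (f ` {c' \<lhd> \<phi> b | b c'. True})"
      using that complex_vector_pair.linear_span_image[OF lin] by blast
    moreover have "f ` {c' \<lhd> \<phi> b | b c'. True} \<subseteq> {c' \<lhd> multiplier_transport f (\<phi> b) | b c'. True}"
      by (auto simp flip: act(2), blast)
    ultimately show ?thesis using complex_vector.span_mono by blast
  qed
  have surj: "\<exists>c'. c = f c'" for c using f(2) by (metis bij_pointE)
  show ?thesis
    unfolding extendable_def algebra_hom_def
  proof (intro conjI allI)
    show "clinear (\<lambda>t. multiplier_transport f (\<phi> t))"
      using ext by (intro clin_o[OF hom(2)]) (simp add: extendable_def algebra_hom_def)
    show "multiplier_transport f e \<rhd> c \<in> cspan {multiplier_transport f (\<phi> b) \<rhd> c' |b c'. True}" for c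
    proof -
      obtain c' where "c = f c'" using surj by blast
      then show ?thesis using L[of "e \<rhd> c'"] ext by (simp add: act extendable_def)
    qed
    show "c \<lhd> multiplier_transport f e \<in> cspan {c' \<lhd> multiplier_transport f (\<phi> b) |b c'. True}" for c
    proof -
      obtain c' where "c = f c'" using surj by blast
      then show ?thesis using R[of "c' \<lhd> e"] ext by (simp add: act extendable_def)
    qed
  qed (use ext in \<open>simp_all add: extendable_def algebra_hom_def flip: hom(1)\<close>)
qed

lemma span_tensor:
  assumes a: "a \<in> cspan S" and b: "b \<in> cspan T"
    and st: "\<And>s t. s \<in> S \<Longrightarrow> t \<in> T \<Longrightarrow> s \<otimes> t \<in> cspan U"
  shows "a \<otimes> b \<in> cspan U"
  using a
proof (induct rule: complex_vector.span_induct_alt)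
  case base then show ?case by (simp add: pure_tensor_zero_left complex_vector.span_zero)
next
  case (step c x y)
  have "x \<otimes> b \<in> cspan U"
    using b
  proof (induct rule: complex_vector.span_induct_alt)
    case base then show ?case by (simp add: clinear_zero[OF pure_lin(1)] complex_vector.span_zero)
  next
    case (step d z w)
    with st[OF \<open>x \<in> S\<close>] show ?case
      by (auto simp: pure_tensor_simps intro!: complex_vector.span_add complex_vector.span_scale)
  qed
  with step show ?case
    by (auto simp: pure_tensor_simps intro!: complex_vector.span_add complex_vector.span_scale)
qed

text \<open>Applied to \<open>\<Delta>\<close> with \<open>E\<close> and to \<open>emb\<close> with
  \<open>1\<close>, this makes \<open>id \<otimes> \<Delta>\<close> and
  \<open>\<Delta> \<otimes> id\<close> extend to multipliers.\<close>

lemma extendable_tensor: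
  fixes \<phi> :: "'a::complex_algebra \<Rightarrow> 'c::nondegenerate_algebra multiplier"
    and \<psi> :: "'b::complex_algebra \<Rightarrow> 'd::nondegenerate_algebra multiplier"
  assumes \<phi>: "extendable \<phi> e" and \<psi>: "extendable \<psi> e'"
  shows "extendable (tensor_lift (\<lambda>p q. \<phi> p \<otimes>\<^sub>M \<psi> q)) (e \<otimes>\<^sub>M e')" (is "extendable ?F _")
proof -
  have hom: "\<phi> (a * b) = \<phi> a * \<phi> b" "\<psi> (p * q) = \<psi> p * \<psi> q" for a b p q
    using assms by (auto simp: extendable_def algebra_hom_def)
  have lin: "clinear \<phi>" "clinear \<psi>"
    using assms by (auto simp: extendable_def algebra_hom_def)
  note [clin] = clin_o[OF lin(1)] clin_o[OF lin(2)]
  have F: "?F (p \<otimes> q) = \<phi> p \<otimes>\<^sub>M \<psi> q" for p q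
    by (rule tsum_pure) (intro clin)+
  have linF: "clinear ?F" by (intro clin)
  note [clin] = clin_o[OF linF]
  have e: "e * \<phi> b = \<phi> b" "\<phi> b * e = \<phi> b" "e' * \<psi> p = \<psi> p" "\<psi> p * e' = \<psi> p" for b p
    using assms by (auto simp: extendable_def)
  show ?thesis
    unfolding extendable_def algebra_hom_def
  proof (intro conjI allI)
    show "clinear ?F" by (rule linF)
    show "?F (s * t) = ?F s * ?F t" for s t
    proof -
      have "\<forall>s. ?F (s * (a \<otimes> b)) = ?F s * ?F (a \<otimes> b)" for a b
        by (rule tensor_all_eqI) (intro clin, intro clin,
            simp add: F times_tensor_pure hom multiplier_tensor_mult)
      then have "\<forall>t. ?F (s * t) = ?F s * ?F t"
        by (intro tensor_all_eqI) (intro clin, intro clin, simp)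
      then show ?thesis by simp
    qed
    show "(e \<otimes>\<^sub>M e') * ?F t = ?F t" for t
      by (induct t rule: tensor_eq_induct) (intro csubspace_eq clin, simp add: F multiplier_tensor_mult e)
    show "?F t * (e \<otimes>\<^sub>M e') = ?F t" for t
      by (induct t rule: tensor_eq_induct) (intro csubspace_eq clin, simp add: F multiplier_tensor_mult e)
    show "(e \<otimes>\<^sub>M e') \<rhd> t \<in> cspan {?F b \<rhd> c' | b c'. True}" for t
    proof (induct t)
      case (pure a b)
      have "(e \<rhd> a) \<otimes> (e' \<rhd> b) \<in> cspan {?F b \<rhd> c' | b c'. True}"
      proof (rule span_tensor)
        show "e \<rhd> a \<in> cspan {\<phi> b \<rhd> c' | b c'. True}" "e' \<rhd> b \<in> cspan {\<psi> b \<rhd> c' | b c'. True}"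
          using assms by (auto simp: extendable_def)
        fix s t assume "s \<in> {\<phi> b \<rhd> c' | b c'. True}" "t \<in> {\<psi> b \<rhd> c' | b c'. True}"
        then obtain b c b' c' where "s = \<phi> b \<rhd> c" "t = \<psi> b' \<rhd> c'" by blast
        then have "s \<otimes> t = ?F (b \<otimes> b') \<rhd> (c \<otimes> c')" by (simp add: F multiplier_tensor_act)
        then show "s \<otimes> t \<in> cspan {?F b \<rhd> c' | b c'. True}"
          by (auto intro: complex_vector.span_base)
      qed
      then show ?case by (simp add: multiplier_tensor_act)
    next
      case (add x y) then show ?case
        by (simp add: clinear_add[OF clinear_left_act] complex_vector.span_add)
    qed
    show "t \<lhd> (e \<otimes>\<^sub>M e') \<in> cspan {c' \<lhd> ?F b | b c'. True}" for t
    proof (induct t)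
      case (pure a b)
      have "(a \<lhd> e) \<otimes> (b \<lhd> e') \<in> cspan {c' \<lhd> ?F b | b c'. True}"
      proof (rule span_tensor)
        show "a \<lhd> e \<in> cspan {c' \<lhd> \<phi> b | b c'. True}" "b \<lhd> e' \<in> cspan {c' \<lhd> \<psi> b | b c'. True}"
          using assms by (auto simp: extendable_def)
        fix s t assume "s \<in> {c' \<lhd> \<phi> b | b c'. True}" "t \<in> {c' \<lhd> \<psi> b | b c'. True}"
        then obtain b c b' c' where "s = c \<lhd> \<phi> b" "t = c' \<lhd> \<psi> b'" by blast
        then have "s \<otimes> t = (c \<otimes> c') \<lhd> ?F (b \<otimes> b')" by (simp add: F multiplier_tensor_act)
        then show "s \<otimes> t \<in> cspan {c' \<lhd> ?F b | b c'. True}"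
          by (auto intro: complex_vector.span_base)
      qed
      then show ?case by (simp add: multiplier_tensor_act)
    next
      case (add x y) then show ?case
        by (simp add: clinear_add[OF clinear_right_act] complex_vector.span_add)
    qed
  qed
qed

lemma multiplier3_cancel:
  fixes x y :: "('a::nondegenerate_algebra \<otimes> 'b::nondegenerate_algebra \<otimes> 'c::nondegenerate_algebra) multiplier"
  assumes "\<And>c. x * (1 \<otimes>\<^sub>M 1 \<otimes>\<^sub>M emb c) = y * (1 \<otimes>\<^sub>M 1 \<otimes>\<^sub>M emb c)"
  shows "x = y"
proof (rule multiplier_cancel(2))
  fix w
  have *: "x * emb2 (b \<otimes> c) = y * emb2 (b \<otimes> c)" for b c
  proof -
    have "1 \<otimes>\<^sub>M emb (b \<otimes> c) = (1 \<otimes>\<^sub>M 1 \<otimes>\<^sub>M emb c) * (1 \<otimes>\<^sub>M emb b \<otimes>\<^sub>M 1 :: ('a \<otimes> 'b \<otimes> 'c) multiplier)"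
      by (simp add: multiplier_tensor_mult emb_tensor)
    then show ?thesis by (simp add: assms flip: mult.assoc)
  qed
  have "\<forall>w. x * emb2 w = y * emb2 w"
    by (rule tensor_all_eqI) (intro clin *)+
  then show "x * emb2 w = y * emb2 w" by simp
qed

lemma emb_eqI: "emb a = emb b \<Longrightarrow> a = b" for a b :: "_ :: nondegenerate_algebra"
  by (simp add: emb_eq_iff)

lemma tsum_act:
  assumes "\<And>a. clinear (f a)" "\<And>b. clinear (\<lambda>a. f a b)"
  shows "tsum ((m \<otimes>\<^sub>M n) \<rhd> t) f = tsum t (\<lambda>p q. f (m \<rhd> p) (n \<rhd> q))"
    and "tsum (t \<lhd> (m \<otimes>\<^sub>M n)) f = tsum t (\<lambda>p q. f (p \<lhd> m) (q \<lhd> n))"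
proof -
  have f: "cbilinear f" using assms by (simp add: cbilinear_def)
  show "tsum ((m \<otimes>\<^sub>M n) \<rhd> t) f = tsum t (\<lambda>p q. f (m \<rhd> p) (n \<rhd> q))"
    by (subst act_tsum, subst push_tsum[OF _ f], intro clin, simp add: tensor_lift_pure[OF f])
  show "tsum (t \<lhd> (m \<otimes>\<^sub>M n)) f = tsum t (\<lambda>p q. f (p \<lhd> m) (q \<lhd> n))"
    by (subst act_tsum, subst push_tsum[OF _ f], intro clin, simp add: tensor_lift_pure[OF f])
qed

lemma leg12_pure: "leg12 (x \<otimes>\<^sub>M y) = x \<otimes>\<^sub>M y \<otimes>\<^sub>M 1"
  for x y :: "'a::nondegenerate_algebra multiplier"
  by (simp add: leg12_def assoc_transport_pure)

lemma leg12_mult: "leg12 (x * y) = leg12 x * leg12 y"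
  for x y :: "('a::nondegenerate_algebra \<otimes> 'a) multiplier"
  by (simp add: leg12_def multiplier_tensor_mult flip: assoc_transport_hom(1))

lemma clin_leg12 [clin]: "clinear f \<Longrightarrow> clinear (\<lambda>x. leg12 (f x))"
  for f :: "_ \<Rightarrow> ('a::nondegenerate_algebra \<otimes> 'a) multiplier"
  unfolding leg12_def by (intro clin)

lemma tsum_swap:
  assumes "\<And>b c d. clinear (\<lambda>a. f a b c d)" "\<And>a c d. clinear (\<lambda>b. f a b c d)"
    "\<And>a b d. clinear (\<lambda>c. f a b c d)" "\<And>a b c. clinear (\<lambda>d. f a b c d)"
  shows "tsum s (\<lambda>a b. tsum t (f a b)) = tsum t (\<lambda>c d. tsum s (\<lambda>a b. f a b c d))"
proof -
  have b: "cbilinear (f a b)" "cbilinear (\<lambda>a b. f a b c d)" for a b c d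
    using assms by (simp_all add: cbilinear_def)
  have "\<forall>s. tsum s (\<lambda>a b. tsum t (f a b)) = tsum t (\<lambda>c d. tsum s (\<lambda>a b. f a b c d))"
  proof (rule tensor_all_eqI)
    show "clinear (\<lambda>s. tsum s (\<lambda>a b. tsum t (f a b)))"
      by (intro clin_tsum cbilinear_lin clin_tsum_fun b assms clin_basic)
    show "clinear (\<lambda>s. tsum t (\<lambda>c d. tsum s (\<lambda>a b. f a b c d)))"
      by (intro clin_tsum_fun cbilinear_lin clin_tsum b assms clin_basic)
    show "tsum (a \<otimes> b) (\<lambda>a b. tsum t (f a b)) = tsum t (\<lambda>c d. tsum (a \<otimes> b) (\<lambda>a b. f a b c d))" for a b
      by (subst tsum_pure, (intro clin_tsum_fun b assms)+, simp add: tensor_lift_pure b)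
  qed
  then show ?thesis by simp
qed

lemma act_assoc: "(m \<rhd> t) \<lhd> n = m \<rhd> (t \<lhd> n)" for t :: "_ :: nondegenerate_algebra"
  by (rule emb_eqI) (simp add: emb_act_mult mult.assoc)

lemma slice_act:
  "clinear f \<Longrightarrow> slice_right f (t \<lhd> (m \<otimes>\<^sub>M 1)) = slice_right f t \<lhd> m"
  "clinear f \<Longrightarrow> slice_left f (t \<lhd> (1 \<otimes>\<^sub>M m)) = slice_left f t \<lhd> m"
  "clinear f \<Longrightarrow> slice_right f ((1 \<otimes>\<^sub>M m) \<rhd> t) = slice_right (\<lambda>x. f (m \<rhd> x)) t"
  "clinear f \<Longrightarrow> slice_left f ((m \<otimes>\<^sub>M 1) \<rhd> t) = slice_left (\<lambda>x. f (m \<rhd> x)) t"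
proof -
  assume f: "clinear f"
  note [clin] = clin_o[OF f]
  show "slice_right f (t \<lhd> (m \<otimes>\<^sub>M 1)) = slice_right f t \<lhd> m"
    "slice_left f (t \<lhd> (1 \<otimes>\<^sub>M m)) = slice_left f t \<lhd> m"
    "slice_right f ((1 \<otimes>\<^sub>M m) \<rhd> t) = slice_right (\<lambda>x. f (m \<rhd> x)) t"
    "slice_left f ((m \<otimes>\<^sub>M 1) \<rhd> t) = slice_left (\<lambda>x. f (m \<rhd> x)) t"
    by (simp_all add: slice_tsum tsum_act push clin left_act_simps right_act_simps
        clinear_scale[OF clinear_right_act])
qed

text \<open>A multiplier with prescribed left action \<open>l\<close> needs a partner
  \<open>r\<close> for every \<open>q\<close>. As the \<open>q\<close> that have one form a
  subspace, it suffices to find partners for slices of \<open>\<Delta>(h)\<close>.\<close>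

lemma csubspace_right_factor: "csubspace {q. \<exists>r. \<forall>b. r * b = q * l b}"
  for l :: "'a::complex_algebra \<Rightarrow> 'a"
proof (rule csubspaceI; clarsimp)
  show "\<exists>r::'a. \<forall>b. r * b = 0" by (rule exI[of _ 0]) simp
  show "\<exists>r. \<forall>b. r * b = (x + y) * l b"
    if "\<forall>b. r * b = x * l b" "\<forall>b. r' * b = y * l b" for x y r r'
    by (rule exI[of _ "r + r'"]) (simp add: distrib_right that)
  show "\<exists>r. \<forall>b. r * b = (c *\<^sub>C x) * l b" if "\<forall>b. r * b = x * l b" for x r c
    by (rule exI[of _ "c *\<^sub>C r"]) (simp add: mult_scaleC_left that)
qed

lemma functional_slice:
  assumes f: "clinear f" and g: "clinear g"
  shows "g (slice_left f t) = f (slice_right g t)"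
proof -
  note [clin] = clin_o[OF f] clin_o[OF g]
  have "\<forall>t. g (slice_left f t) = f (slice_right g t)"
    by (rule tensor_all_eqI, intro clin, intro clin)
      (simp add: slice_left_pure slice_right_pure f g clinear_scale[OF f] clinear_scale[OF g]
        scaleC_complex_def mult.commute)
  then show ?thesis by simp
qed

section \<open>Coproducts and the canonical idempotent\<close>

context weak_multiplier_Hopf_algebra
begin

abbreviation "D1 a c \<equiv> T1 \<Delta> (a \<otimes> c)"
abbreviation "D2 c a \<equiv> T2 \<Delta> (c \<otimes> a)"

lemma is_coproduct: "coproduct \<Delta>"
  using full_coproduct by (simp add: full_coproduct_def)

lemma Delta_mult: "\<Delta> (a * b) = \<Delta> a * \<Delta> b"
  and clinear_Delta: "clinear \<Delta>"
  using is_coproduct by (simp_all add: coproduct_def algebra_hom_def)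

lemma clin_Delta [clin]: "clinear f \<Longrightarrow> clinear (\<lambda>x. \<Delta> (f x))"
  by (rule clin_o[OF clinear_Delta])

lemma emb_elt: "x \<in> range emb \<Longrightarrow> emb (elt x) = x"
  by (auto simp: elt_emb)

lemma clin_elt:
  fixes f :: "'v::complex_vector \<Rightarrow> 'b::nondegenerate_algebra multiplier"
  assumes "clinear f" "\<And>x. f x \<in> range emb"
  shows "clinear (\<lambda>x. elt (f x))"
proof -
  have e: "emb (elt (f x)) = f x" for x by (rule emb_elt[OF assms(2)])
  note lin = clinear_add[OF assms(1)] clinear_scale[OF assms(1)]
    clinear_add[OF clinear_emb] clinear_scale[OF clinear_emb]
  show ?thesis
  proof (rule clinearI)
    show "elt (f (x + y)) = elt (f x) + elt (f y)" for x y
      by (rule emb_eqI) (simp only: e lin(3,4), simp only: lin(1,2))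
    show "elt (f (c *\<^sub>C x)) = c *\<^sub>C elt (f x)" for c x
      by (rule emb_eqI) (simp only: e lin(3,4), simp only: lin(1,2))
  qed
qed

lemma cbilinear_T1: "cbilinear (\<lambda>a b. elt (\<Delta> a * emb2 b))"
  and cbilinear_T2: "cbilinear (\<lambda>a b. elt (emb1 a * \<Delta> b))"
  by (intro cbilinear_lin clin_elt clin; use is_coproduct in \<open>simp add: coproduct_def\<close>)+

lemma emb_T1: "emb (D1 a b) = \<Delta> a * emb2 b"
  and emb_T2: "emb (D2 a b) = emb1 a * \<Delta> b"
  using is_coproduct
  by (simp_all add: T1_def T2_def tensor_lift_pure cbilinear_T1 cbilinear_T2 emb_elt coproduct_def)

lemma clin_T [clin]:
  "clinear f \<Longrightarrow> clinear (\<lambda>x. T1 \<Delta> (f x))"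
  "clinear f \<Longrightarrow> clinear (\<lambda>x. T2 \<Delta> (f x))"
  unfolding T1_def T2_def by (rule clin_tsum[OF cbilinear_T1] clin_tsum[OF cbilinear_T2]; assumption)+

lemma E_T1: "E \<rhd> T1 \<Delta> t = T1 \<Delta> t"
  and T2_E: "T2 \<Delta> t \<lhd> E = T2 \<Delta> t"
proof -
  have "T1 \<Delta> t \<in> range (\<lambda>t. E \<rhd> t)" by (simp flip: range_T1)
  then obtain s where "T1 \<Delta> t = E \<rhd> s" by auto
  then show "E \<rhd> T1 \<Delta> t = T1 \<Delta> t" by (simp add: E_idem flip: left_act_simps(7))
  have "T2 \<Delta> t \<in> range (\<lambda>t. t \<lhd> E)" by (simp flip: range_T2)
  then obtain s where "T2 \<Delta> t = s \<lhd> E" by auto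
  then show "T2 \<Delta> t \<lhd> E = T2 \<Delta> t" by (simp add: E_idem flip: right_act_simps(7))
qed

lemma E_range: "\<exists>s. E \<rhd> t = T1 \<Delta> s" "\<exists>s. t \<lhd> E = T2 \<Delta> s"
proof -
  have "E \<rhd> t \<in> range (T1 \<Delta>)" "t \<lhd> E \<in> range (T2 \<Delta>)" by (simp_all add: range_T1 range_T2)
  then show "\<exists>s. E \<rhd> t = T1 \<Delta> s" "\<exists>s. t \<lhd> E = T2 \<Delta> s" by auto
qed

lemma E_Delta: "E * \<Delta> a = \<Delta> a"
proof (rule multiplier_cancel(2))
  show "E * \<Delta> a * emb2 d = \<Delta> a * emb2 d" for d
    using arg_cong[OF E_T1[of "a \<otimes> d"], of emb] by (simp add: emb_act_mult emb_T1 mult.assoc)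
qed

lemma Delta_E: "\<Delta> a * E = \<Delta> a"
proof (rule multiplier_cancel(3))
  show "emb1 c * (\<Delta> a * E) = emb1 c * \<Delta> a" for c
    using arg_cong[OF T2_E[of "c \<otimes> a"], of emb] by (simp add: emb_act_mult emb_T2 mult.assoc)
qed

lemma E_Delta_assoc: "E * (\<Delta> a * m) = \<Delta> a * m" "\<Delta> a * (E * m) = \<Delta> a * m" "E * (E * m) = E * m"
  by (simp_all add: E_Delta Delta_E E_idem flip: mult.assoc)

lemma product_induct:
  assumes "csubspace W" "\<And>a b :: 'a. a * b \<in> W"
  shows "x \<in> W"
proof -
  have "cspan {a * b | a b :: 'a. True} \<subseteq> W"
    by (rule complex_vector.span_minimal) (use assms in auto)
  then show ?thesis using idempotent by (auto simp: idempotent_algebra_def)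
qed

lemma product_eq_induct:
  assumes "clinear f" "clinear g" "\<And>a b :: 'a. f (a * b) = g (a * b)"
  shows "\<forall>x. f x = g x"
  using product_induct[OF csubspace_eq[OF assms(1,2)]] assms(3) by simp

lemma extendable_emb: "extendable (emb :: 'a \<Rightarrow> _) 1"
proof -
  have *: "x \<in> cspan {a * b | a b :: 'a. True}" for x :: 'a
    using idempotent by (auto simp: idempotent_algebra_def)
  have "{emb b \<rhd> c' | b c' :: 'a. True} = {a * b | a b :: 'a. True}"
    "{c' \<lhd> emb b | b c' :: 'a. True} = {a * b | a b :: 'a. True}"
    by (auto simp: emb_act)
  with * show ?thesis
    by (simp add: extendable_def algebra_hom_emb left_act_simps right_act_simps)
qed

text \<open>\<open>E(A \<otimes> A)\<close> is the range of \<open>T1\<close>, and since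
  \<open>A\<close> is idempotent this range is spanned by elements
  \<open>\<Delta>(p) T1(q \<otimes> b)\<close>. The same holds for \<open>T2\<close> on the other
  side.\<close>

lemma extendable_Delta: "extendable \<Delta> E"
proof -
  have "T1 \<Delta> t \<in> cspan {\<Delta> b \<rhd> c' | b c'. True}" for t
  proof (induct t)
    case (pure a b)
    have "a \<in> {a. D1 a b \<in> cspan {\<Delta> b \<rhd> c' | b c'. True}}"
    proof (rule product_induct)
      show "csubspace {a. D1 a b \<in> cspan {\<Delta> b \<rhd> c' | b c'. True}}"
        by (rule complex_vector_pair.linear_subspace_vimage[where f = "\<lambda>a. D1 a b", unfolded vimage_def])
          (intro clin complex_vector.subspace_span)+
      fix p q
      have "D1 (p * q) b = \<Delta> p \<rhd> D1 q b"
        by (rule emb_eqI) (simp add: emb_T1 emb_act_mult Delta_mult mult.assoc)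
      then show "p * q \<in> {a. D1 a b \<in> cspan {\<Delta> b \<rhd> c' | b c'. True}}"
        by (auto intro: complex_vector.span_base)
    qed
    then show ?case by simp
  next
    case (add x y) then show ?case
      by (simp add: clinear_add[OF clin_T(1)[OF clinear_ident]] complex_vector.span_add)
  qed
  moreover have "T2 \<Delta> t \<in> cspan {c' \<lhd> \<Delta> b | b c'. True}" for t
  proof (induct t)
    case (pure b a)
    have "a \<in> {a. D2 b a \<in> cspan {c' \<lhd> \<Delta> b | b c'. True}}"
    proof (rule product_induct)
      show "csubspace {a. D2 b a \<in> cspan {c' \<lhd> \<Delta> b | b c'. True}}"
        by (rule complex_vector_pair.linear_subspace_vimage[where f = "\<lambda>a. D2 b a", unfolded vimage_def])
          (intro clin complex_vector.subspace_span)+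
      fix p q
      have "D2 b (p * q) = D2 b p \<lhd> \<Delta> q"
        by (rule emb_eqI) (simp add: emb_T2 emb_act_mult Delta_mult mult.assoc)
      then show "p * q \<in> {a. D2 b a \<in> cspan {c' \<lhd> \<Delta> b | b c'. True}}"
        by (auto intro: complex_vector.span_base)
    qed
    then show ?case by simp
  next
    case (add x y) then show ?case
      by (simp add: clinear_add[OF clin_T(2)[OF clinear_ident]] complex_vector.span_add)
  qed
  moreover note E_range
  ultimately show ?thesis
    unfolding extendable_def algebra_hom_def
    by (intro conjI allI clinear_Delta Delta_mult E_Delta Delta_E) (metis (no_types, lifting))+
qed

section \<open>The extensions of \<open>id \<otimes> \<Delta>\<close> and
  \<open>\<Delta> \<otimes> id\<close> to multipliers\<close>

lemma extendable_id_coprod: "extendable (id_coprod \<Delta>) (1 \<otimes>\<^sub>M E)"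
  unfolding id_coprod_def by (rule extendable_tensor[OF extendable_emb extendable_Delta])

lemma extendable_coprod_id: "extendable (coprod_id \<Delta>) (leg12 E)"
  using extendable_transport[OF extendable_tensor[OF extendable_Delta extendable_emb]
      algebra_hom_tensor_assoc bij_tensor_assoc]
  by (simp add: leg12_def coprod_id_def[abs_def])

lemma id_coprod_pure: "id_coprod \<Delta> (p \<otimes> q) = emb p \<otimes>\<^sub>M \<Delta> q"
  unfolding id_coprod_def by (rule tsum_pure) (intro clin)+

lemma coprod_id_pure: "coprod_id \<Delta> (p \<otimes> q) = assoc_transport (\<Delta> p \<otimes>\<^sub>M emb q)"
  unfolding coprod_id_def by (subst tsum_pure) (intro clin refl)+

lemma clin_coprod_id [clin]: "clinear f \<Longrightarrow> clinear (\<lambda>x. coprod_id \<Delta> (f x))"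
  and clin_id_coprod [clin]: "clinear f \<Longrightarrow> clinear (\<lambda>x. id_coprod \<Delta> (f x))"
  unfolding coprod_id_def id_coprod_def by (intro clin; assumption)+

abbreviation "coprod_id_hat \<equiv> multiplier_extension (coprod_id \<Delta>) (leg12 E)"
abbreviation "id_coprod_hat \<equiv> multiplier_extension (id_coprod \<Delta>) (1 \<otimes>\<^sub>M E)"

lemmas coprod_id_hat_simps = multiplier_extension[OF extendable_coprod_id] multiplier_extension_mult[OF extendable_coprod_id]
lemmas id_coprod_hat_simps = multiplier_extension[OF extendable_id_coprod] multiplier_extension_mult[OF extendable_id_coprod]
lemmas Delta_ext = multiplier_extension[OF extendable_Delta] multiplier_extension_mult[OF extendable_Delta]

lemma coprod_id_hat_1_emb: "coprod_id_hat (emb2 c) = leg12 E * (1 \<otimes>\<^sub>M 1 \<otimes>\<^sub>M emb c)"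
  and coprod_id_hat_emb_1: "coprod_id_hat (emb1 c) = assoc_transport (\<Delta> c \<otimes>\<^sub>M 1)"
proof -
  have 1: "leg12 E * (1 \<otimes>\<^sub>M 1 \<otimes>\<^sub>M emb c) = assoc_transport (E \<otimes>\<^sub>M emb c)"
    by (simp add: leg12_def multiplier_tensor_mult multiplier_tensor_one
        flip: assoc_transport_pure assoc_transport_hom(1))
  show "coprod_id_hat (emb2 c) = leg12 E * (1 \<otimes>\<^sub>M 1 \<otimes>\<^sub>M emb c)"
    unfolding 1
  proof (rule multiplier_extension_eqI[OF extendable_coprod_id])
    show "assoc_transport (E \<otimes>\<^sub>M emb c) * leg12 E = assoc_transport (E \<otimes>\<^sub>M emb c)"
      by (simp add: leg12_def multiplier_tensor_mult E_idem flip: assoc_transport_hom(1))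
    show "assoc_transport (E \<otimes>\<^sub>M emb c) * coprod_id \<Delta> t = coprod_id \<Delta> (emb2 c \<rhd> t)" for t
      by (induct t rule: tensor_eq_induct)
        (intro csubspace_eq clin, simp add: coprod_id_pure multiplier_tensor_act left_act_simps emb_act emb_mult
          multiplier_tensor_mult E_Delta flip: assoc_transport_hom(1))
  qed
  show "coprod_id_hat (emb1 c) = assoc_transport (\<Delta> c \<otimes>\<^sub>M 1)"
  proof (rule multiplier_extension_eqI[OF extendable_coprod_id])
    show "assoc_transport (\<Delta> c \<otimes>\<^sub>M 1) * leg12 E = assoc_transport (\<Delta> c \<otimes>\<^sub>M 1)"
      by (simp add: leg12_def multiplier_tensor_mult Delta_E flip: assoc_transport_hom(1))
    show "assoc_transport (\<Delta> c \<otimes>\<^sub>M 1) * coprod_id \<Delta> t = coprod_id \<Delta> (emb1 c \<rhd> t)" for t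
      by (induct t rule: tensor_eq_induct)
        (intro csubspace_eq clin, simp add: coprod_id_pure multiplier_tensor_act left_act_simps emb_act Delta_mult
          multiplier_tensor_mult flip: assoc_transport_hom(1))
  qed
qed

lemma id_coprod_hat_1_emb: "id_coprod_hat (emb2 c) = 1 \<otimes>\<^sub>M \<Delta> c"
  and id_coprod_hat_emb_1: "id_coprod_hat (emb1 c) = emb1 c * (1 \<otimes>\<^sub>M E)"
proof -
  show "id_coprod_hat (emb2 c) = 1 \<otimes>\<^sub>M \<Delta> c"
  proof (rule multiplier_extension_eqI[OF extendable_id_coprod])
    show "(1 \<otimes>\<^sub>M \<Delta> c) * id_coprod \<Delta> t = id_coprod \<Delta> (emb2 c \<rhd> t)" for t
      by (induct t rule: tensor_eq_induct)
        (intro csubspace_eq clin, simp add: id_coprod_pure multiplier_tensor_act left_act_simps emb_act Delta_mult multiplier_tensor_mult)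
  qed (simp add: multiplier_tensor_mult Delta_E)
  show "id_coprod_hat (emb1 c) = emb1 c * (1 \<otimes>\<^sub>M E)"
  proof (rule multiplier_extension_eqI[OF extendable_id_coprod])
    show "emb1 c * (1 \<otimes>\<^sub>M E) * id_coprod \<Delta> t = id_coprod \<Delta> (emb1 c \<rhd> t)" for t
      by (induct t rule: tensor_eq_induct)
        (intro csubspace_eq clin, simp add: id_coprod_pure multiplier_tensor_act left_act_simps emb_act E_Delta emb_mult multiplier_tensor_mult)
  qed (simp add: multiplier_tensor_mult E_idem)
qed

lemma coassoc_axiom:
  "(emb a \<otimes>\<^sub>M 1 \<otimes>\<^sub>M 1) * coprod_id \<Delta> (D1 b c) = id_coprod \<Delta> (D2 a b) * (1 \<otimes>\<^sub>M 1 \<otimes>\<^sub>M emb c)"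
  using is_coproduct by (simp add: coproduct_def)

text \<open>Covering with \<open>b\<close> on the left and \<open>c\<close> on the right gives the
  two sides of the coassociativity axiom; the copies of \<open>E\<close> that the extensions attach
  to \<open>b\<close> and \<open>c\<close> are absorbed.\<close>

lemma coprod_id_hat_Delta: "coprod_id_hat (\<Delta> a) = id_coprod_hat (\<Delta> a)"
proof (rule multiplier3_cancel, rule multiplier_cancel(3))
  fix b c
  have "coprod_id \<Delta> (D1 a c) = coprod_id_hat (\<Delta> a) * (1 \<otimes>\<^sub>M 1 \<otimes>\<^sub>M emb c)"
    by (simp add: coprod_id_hat_simps(2)[symmetric] emb_T1 coprod_id_hat_simps(4) coprod_id_hat_1_emb)
      (simp add: coprod_id_hat_simps(7) flip: mult.assoc)
  moreover have "id_coprod \<Delta> (D2 b a) = emb1 b * id_coprod_hat (\<Delta> a)"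
    by (simp add: id_coprod_hat_simps(2)[symmetric] emb_T2 id_coprod_hat_simps(4) id_coprod_hat_emb_1 mult.assoc id_coprod_hat_simps(8))
  ultimately show "emb1 b * (coprod_id_hat (\<Delta> a) * (1 \<otimes>\<^sub>M 1 \<otimes>\<^sub>M emb c)) =
      (emb1 b) * (id_coprod_hat (\<Delta> a) * (1 \<otimes>\<^sub>M 1 \<otimes>\<^sub>M emb c))"
    using coassoc_axiom[of b a c] by (simp add: multiplier_tensor_one mult.assoc)
qed

text \<open>Both sides are idempotents with the same range, spanned by the images of the twofold coproduct.\<close>

lemma coprod_id_hat_E: "coprod_id_hat E = leg12 E * leg23 E"
proof -
  have "coprod_id_hat E * id_coprod_hat E = id_coprod_hat E"
  proof (rule extendable_eqI[OF extendable_id_coprod])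
    fix t
    obtain s where s: "E \<rhd> t = T1 \<Delta> s" using E_range by blast
    have "\<forall>s. coprod_id_hat E * id_coprod \<Delta> (T1 \<Delta> s) = id_coprod \<Delta> (T1 \<Delta> s)"
    proof (rule tensor_all_eqI)
      fix a b
      have "id_coprod \<Delta> (D1 a b) = coprod_id_hat (\<Delta> a) * id_coprod_hat (emb2 b)"
        by (simp add: id_coprod_hat_simps(2)[symmetric] emb_T1 id_coprod_hat_simps(4) coprod_id_hat_Delta)
      moreover have "coprod_id_hat E * coprod_id_hat (\<Delta> a) = coprod_id_hat (\<Delta> a)"
        by (simp add: E_Delta flip: coprod_id_hat_simps(4))
      ultimately show "coprod_id_hat E * id_coprod \<Delta> (D1 a b) = id_coprod \<Delta> (D1 a b)"
        by (simp flip: mult.assoc)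
    qed (intro clin)+
    then show "coprod_id_hat E * id_coprod_hat E * id_coprod \<Delta> t = id_coprod_hat E * id_coprod \<Delta> t"
      by (simp add: mult.assoc id_coprod_hat_simps(5) s)
  qed (simp_all add: mult.assoc id_coprod_hat_simps(7))
  moreover have "coprod_id_hat E * id_coprod_hat E = coprod_id_hat E"
  proof (rule extendable_eqI_right[OF extendable_coprod_id])
    fix t
    obtain s where s: "t \<lhd> E = T2 \<Delta> s" using E_range by blast
    have "\<forall>s. coprod_id \<Delta> (T2 \<Delta> s) * id_coprod_hat E = coprod_id \<Delta> (T2 \<Delta> s)"
    proof (rule tensor_all_eqI)
      fix a b
      have "coprod_id \<Delta> (D2 a b) = coprod_id_hat (emb1 a) * id_coprod_hat (\<Delta> b)"
        by (simp add: coprod_id_hat_simps(2)[symmetric] emb_T2 coprod_id_hat_simps(4) coprod_id_hat_Delta)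
      moreover have "id_coprod_hat (\<Delta> b) * id_coprod_hat E = id_coprod_hat (\<Delta> b)"
        by (simp add: Delta_E flip: id_coprod_hat_simps(4))
      ultimately show "coprod_id \<Delta> (D2 a b) * id_coprod_hat E = coprod_id \<Delta> (D2 a b)"
        by (simp add: mult.assoc)
    qed (intro clin)+
    then show "coprod_id \<Delta> t * (coprod_id_hat E * id_coprod_hat E) = coprod_id \<Delta> t * coprod_id_hat E"
      by (simp add: coprod_id_hat_simps(6) s flip: mult.assoc)
  qed (simp_all add: coprod_id_hat_simps(8) flip: mult.assoc)
  ultimately show ?thesis using id_coprod_E by simp
qed

lemma coassoc_tensor:
  "tsum (D2 a b) (\<lambda>p q. p \<otimes> D1 q c) = tsum (D1 b c) (\<lambda>p q. tensor_assoc (D2 a p \<otimes> q))"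
proof -
  have 1: "emb a \<otimes>\<^sub>M 1 \<otimes>\<^sub>M 1 = assoc_transport ((emb a \<otimes>\<^sub>M (1 :: 'a multiplier)) \<otimes>\<^sub>M (1 :: 'a multiplier))"
    by (simp add: assoc_transport_pure)
  have "(emb a \<otimes>\<^sub>M 1 \<otimes>\<^sub>M 1) * coprod_id \<Delta> t = emb (tsum t (\<lambda>p q. tensor_assoc (D2 a p \<otimes> q)))" for t
    by (induct t rule: tensor_eq_induct) (intro csubspace_eq clin, subst tsum_pure, (intro clin)+,
        simp add: 1 coprod_id_pure multiplier_tensor_mult emb_tensor emb_T2 assoc_transport_hom(4)[symmetric]
          assoc_transport_hom(1)[symmetric])
  moreover have "id_coprod \<Delta> t * (1 \<otimes>\<^sub>M 1 \<otimes>\<^sub>M emb c) = emb (tsum t (\<lambda>p q. p \<otimes> D1 q c))" for t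
    by (induct t rule: tensor_eq_induct) (intro csubspace_eq clin, subst tsum_pure, (intro clin)+,
        simp add: id_coprod_pure multiplier_tensor_mult emb_tensor emb_T1)
  ultimately show ?thesis using coassoc_axiom[of a b c] by (simp add: emb_eq_iff)
qed

text \<open>Coassociativity as it enters Sweedler calculations, for any trilinear expression
  \<open>\<tau>(c a\<^sub>1, a\<^sub>2, a\<^sub>3 d)\<close>: the linear map induced by \<tau> on
  threefold tensors is applied to \<open>coassoc_tensor\<close>.\<close>

lemma coassoc:
  assumes "\<And>p q. clinear (\<tau> p q)" "\<And>p r. clinear (\<lambda>q. \<tau> p q r)" "\<And>q r. clinear (\<lambda>p. \<tau> p q r)"
  shows "tsum (D2 c a) (\<lambda>p q. tsum (D1 q d) (\<tau> p)) =
    tsum (D1 a d) (\<lambda>p q. tsum (D2 c p) (\<lambda>r u. \<tau> r u q))"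
proof -
  note [clin] = clin_o[OF assms(1)] clin_o[OF assms(2)] clin_o[OF assms(3)]
  have l: "cbilinear (\<tau> p)" "clinear (\<lambda>p. \<tau> p q r)" for p q r by (intro clin)+
  have b: "cbilinear (\<lambda>p w. tsum w (\<tau> p))"
    by (rule cbilinear_lin) (intro clin_tsum clin_basic l, intro clin_tsum_fun l)
  have p: "tsum (p \<otimes> w) (\<lambda>p w. tsum w (\<tau> p)) = tsum w (\<tau> p)" for p w
    by (rule tensor_lift_pure[OF b])
  have "tsum (tsum (D2 c a) (\<lambda>p q. p \<otimes> D1 q d)) (\<lambda>p w. tsum w (\<tau> p)) =
      tsum (D2 c a) (\<lambda>p q. tsum (D1 q d) (\<tau> p))"
    by (subst push_tsum[OF _ b], intro clin, simp add: p)
  moreover have "tsum (tensor_assoc (t \<otimes> q)) (\<lambda>p w. tsum w (\<tau> p)) = tsum t (\<lambda>r u. \<tau> r u q)" for t q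
    by (subst tensor_assoc_tsum, subst push_tsum[OF _ b], intro clin, simp add: p tensor_lift_pure[OF l(1)])
  then have "tsum (tsum (D1 a d) (\<lambda>p q. tensor_assoc (D2 c p \<otimes> q))) (\<lambda>p w. tsum w (\<tau> p)) =
      tsum (D1 a d) (\<lambda>p q. tsum (D2 c p) (\<lambda>r u. \<tau> r u q))"
    by (subst push_tsum[OF _ b], intro clin, simp)
  ultimately show ?thesis by (simp add: coassoc_tensor)
qed

text \<open>By \<open>mem_span_slice_left\<close>, a subspace that contains all these slices is
  admissible in the definition of \<open>right_leg\<close>, and fullness leaves only
  \<open>A\<close>. Fullness thus becomes an induction rule.\<close>

lemma right_full:
  assumes W: "csubspace W" and "\<And>f c a. clinear f \<Longrightarrow> slice_left f (D2 c a) \<in> W"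
  shows "x \<in> W"
proof -
  have "right_leg \<Delta> \<subseteq> W"
    unfolding right_leg_def by (rule Inter_lower, intro CollectI conjI W allI mem_span_slice_left assms(2))
  then show ?thesis using full_coproduct by (auto simp: full_coproduct_def)
qed

lemma left_full:
  assumes W: "csubspace W" and "\<And>f c a. clinear f \<Longrightarrow> slice_right f (D1 a c) \<in> W"
  shows "x \<in> W"
proof -
  have "left_leg \<Delta> \<subseteq> W"
    unfolding left_leg_def by (rule Inter_lower, intro CollectI conjI W allI mem_span_slice_right assms(2))
  then show ?thesis using full_coproduct by (auto simp: full_coproduct_def)
qed

lemma right_full_eqI:
  fixes \<Phi> \<Psi> :: "'a \<Rightarrow> 'v::complex_vector"
  assumes lin: "clinear \<Phi>" "clinear \<Psi>"
    and eq: "\<And>c a. tsum (D2 c a) (\<lambda>p q. p \<otimes> \<Phi> q) = tsum (D2 c a) (\<lambda>p q. p \<otimes> \<Psi> q)"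
  shows "\<Phi> x = \<Psi> x"
proof -
  note [clin] = clin_o[OF lin(1)] clin_o[OF lin(2)]
  have "x \<in> {x. \<Phi> x = \<Psi> x}"
  proof (rule right_full[OF csubspace_eq[OF lin]])
    fix f :: "'a \<Rightarrow> complex" and c a assume f [clin]: "clinear f"
    have "\<forall>t. \<Phi> (slice_left f t) = slice_left f (tsum t (\<lambda>p q. p \<otimes> \<Phi> q))"
      by (rule tensor_all_eqI, intro clin, intro clin, subst tsum_pure, (intro clin)+,
        simp add: slice_left_pure f clinear_scale[OF lin(1)])
    moreover have "\<forall>t. \<Psi> (slice_left f t) = slice_left f (tsum t (\<lambda>p q. p \<otimes> \<Psi> q))"
      by (rule tensor_all_eqI, intro clin, intro clin, subst tsum_pure, (intro clin)+,
        simp add: slice_left_pure f clinear_scale[OF lin(2)])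
    ultimately show "slice_left f (D2 c a) \<in> {x. \<Phi> x = \<Psi> x}" by (simp add: eq)
  qed
  then show ?thesis by simp
qed

lemma left_full_eqI:
  fixes \<Phi> \<Psi> :: "'a \<Rightarrow> 'v::complex_vector"
  assumes lin: "clinear \<Phi>" "clinear \<Psi>"
    and eq: "\<And>c a. tsum (D1 a c) (\<lambda>p q. \<Phi> p \<otimes> q) = tsum (D1 a c) (\<lambda>p q. \<Psi> p \<otimes> q)"
  shows "\<Phi> x = \<Psi> x"
proof -
  note [clin] = clin_o[OF lin(1)] clin_o[OF lin(2)]
  have "x \<in> {x. \<Phi> x = \<Psi> x}"
  proof (rule left_full[OF csubspace_eq[OF lin]])
    fix f :: "'a \<Rightarrow> complex" and c a assume f [clin]: "clinear f"
    have "\<forall>t. \<Phi> (slice_right f t) = slice_right f (tsum t (\<lambda>p q. \<Phi> p \<otimes> q))"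
      by (rule tensor_all_eqI, intro clin, intro clin, subst tsum_pure, (intro clin)+,
        simp add: slice_right_pure f clinear_scale[OF lin(1)])
    moreover have "\<forall>t. \<Psi> (slice_right f t) = slice_right f (tsum t (\<lambda>p q. \<Psi> p \<otimes> q))"
      by (rule tensor_all_eqI, intro clin, intro clin, subst tsum_pure, (intro clin)+,
        simp add: slice_right_pure f clinear_scale[OF lin(2)])
    ultimately show "slice_right f (D1 a c) \<in> {x. \<Phi> x = \<Psi> x}" by (simp add: eq)
  qed
  then show ?thesis by simp
qed

text \<open>Evaluating the multiplier at \<open>w\<close> and covering the first leg by
  \<open>d\<close> reduces this to \<open>right_full_eqI\<close>. It serves to read off identities
  for \<open>et\<close> from identities for \<open>E\<close>, whose second leg consists of values of
  \<open>et\<close>.\<close>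

lemma right_full_multiplier_eqI:
  fixes \<Phi> \<Psi> :: "'a \<Rightarrow> 'b::nondegenerate_algebra multiplier"
  assumes lin: "clinear \<Phi>" "clinear \<Psi>"
    and eq: "\<And>c a. tsum (D2 c a) (\<lambda>p q. emb p \<otimes>\<^sub>M \<Phi> q) = tsum (D2 c a) (\<lambda>p q. emb p \<otimes>\<^sub>M \<Psi> q)"
  shows "\<Phi> x = \<Psi> x"
proof (rule multiplier_eqI_left)
  fix w
  note [clin] = clin_o[OF lin(1)] clin_o[OF lin(2)]
  show "\<Phi> x \<rhd> w = \<Psi> x \<rhd> w"
  proof (rule right_full_eqI[where \<Phi> = "\<lambda>x. \<Phi> x \<rhd> w" and \<Psi> = "\<lambda>x. \<Psi> x \<rhd> w"])
    fix c a
    show "tsum (D2 c a) (\<lambda>p q. p \<otimes> (\<Phi> q \<rhd> w)) = tsum (D2 c a) (\<lambda>p q. p \<otimes> (\<Psi> q \<rhd> w))"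
    proof (rule cover1_right)
      fix d
      have *: "tsum (tsum (D2 c a) (\<lambda>p q. p \<otimes> (Z q \<rhd> w))) (\<lambda>p v. (p * d) \<otimes> v) =
          tsum (D2 c a) (\<lambda>p q. emb p \<otimes>\<^sub>M Z q) \<rhd> (d \<otimes> w)"
        if [clin]: "\<And>f :: 'a \<Rightarrow> 'a. clinear f \<Longrightarrow> clinear (\<lambda>x. Z (f x))" for Z :: "'a \<Rightarrow> 'b multiplier"
        by (subst push_tsum, intro clin, intro clin, subst push_act_multiplier(1),
          intro clin, subst tsum_pure, (intro clin)+, simp add: multiplier_tensor_act emb_act)
      show "tsum (tsum (D2 c a) (\<lambda>p q. p \<otimes> (\<Phi> q \<rhd> w))) (\<lambda>p v. (p * d) \<otimes> v) =
        tsum (tsum (D2 c a) (\<lambda>p q. p \<otimes> (\<Psi> q \<rhd> w))) (\<lambda>p v. (p * d) \<otimes> v)"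
        by (simp add: *[OF clin_o[OF lin(1)]] *[OF clin_o[OF lin(2)]] eq)
    qed
  qed (intro clin)+
qed

lemma left_full_multiplier_eqI:
  fixes \<Phi> \<Psi> :: "'a \<Rightarrow> 'b::nondegenerate_algebra multiplier"
  assumes lin: "clinear \<Phi>" "clinear \<Psi>"
    and eq: "\<And>c a. tsum (D1 a c) (\<lambda>p q. \<Phi> p \<otimes>\<^sub>M emb q) = tsum (D1 a c) (\<lambda>p q. \<Psi> p \<otimes>\<^sub>M emb q)"
  shows "\<Phi> x = \<Psi> x"
proof (rule multiplier_eqI_left)
  fix w
  note [clin] = clin_o[OF lin(1)] clin_o[OF lin(2)]
  show "\<Phi> x \<rhd> w = \<Psi> x \<rhd> w"
  proof (rule left_full_eqI[where \<Phi> = "\<lambda>x. \<Phi> x \<rhd> w" and \<Psi> = "\<lambda>x. \<Psi> x \<rhd> w"])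
    fix c a
    show "tsum (D1 a c) (\<lambda>p q. (\<Phi> p \<rhd> w) \<otimes> q) = tsum (D1 a c) (\<lambda>p q. (\<Psi> p \<rhd> w) \<otimes> q)"
    proof (rule cover2_right)
      fix d
      have *: "tsum (tsum (D1 a c) (\<lambda>p q. (Z p \<rhd> w) \<otimes> q)) (\<lambda>v q. v \<otimes> (q * d)) =
          tsum (D1 a c) (\<lambda>p q. Z p \<otimes>\<^sub>M emb q) \<rhd> (w \<otimes> d)"
        if [clin]: "\<And>f :: 'a \<Rightarrow> 'a. clinear f \<Longrightarrow> clinear (\<lambda>x. Z (f x))" for Z :: "'a \<Rightarrow> 'b multiplier"
        by (subst push_tsum, intro clin, intro clin, subst push_act_multiplier(1),
          intro clin, subst tsum_pure, (intro clin)+, simp add: multiplier_tensor_act emb_act)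
      show "tsum (tsum (D1 a c) (\<lambda>p q. (\<Phi> p \<rhd> w) \<otimes> q)) (\<lambda>v q. v \<otimes> (q * d)) =
        tsum (tsum (D1 a c) (\<lambda>p q. (\<Psi> p \<rhd> w) \<otimes> q)) (\<lambda>v q. v \<otimes> (q * d))"
        by (simp add: *[OF clin_o[OF lin(1)]] *[OF clin_o[OF lin(2)]] eq)
    qed
  qed (intro clin)+
qed

end


section \<open>The antipode\<close>

context regular_weak_multiplier_Hopf_algebra
begin

subsection \<open>The antipode and the source and target maps\<close>

definition ap :: "'a \<Rightarrow> 'a"
  where "ap a = elt (S a)"

lemma emb_ap: "emb (ap a) = S a"
  using bij_antipode unfolding ap_def by (intro emb_elt) (auto simp: bij_betw_def)

lemma clinear_S: "clinear S"
  using antihom by (simp add: algebra_antihom_def)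

lemma clin_S [clin]: "clinear f \<Longrightarrow> clinear (\<lambda>x. S (f x))"
  by (rule clin_o[OF clinear_S])

lemma ap_antihom: "algebra_antihom ap"
  unfolding algebra_antihom_def
proof (intro conjI allI clinearI)
  show "ap (a * b) = ap b * ap a" for a b
    using antihom by - (rule emb_eqI, simp add: emb_ap emb_mult algebra_antihom_def)
  show "ap (a + b) = ap a + ap b" for a b
    by (rule emb_eqI) (simp add: emb_ap clinear_add[OF clinear_emb] clinear_add[OF clinear_S])
  show "ap (c *\<^sub>C a) = c *\<^sub>C ap a" for a c
    by (rule emb_eqI) (simp add: emb_ap clinear_scale[OF clinear_emb] clinear_scale[OF clinear_S])
qed

lemma ap_mult: "ap (a * b) = ap b * ap a"
  and clinear_ap: "clinear ap"
  using ap_antihom by (simp_all add: algebra_antihom_def)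

lemma clin_ap [clin]: "clinear f \<Longrightarrow> clinear (\<lambda>x. ap (f x))"
  by (rule clin_o[OF clinear_ap])

lemma bij_ap: "bij ap"
proof (rule bijI)
  show "inj ap"
  proof (rule injI)
    fix a b assume "ap a = ap b"
    then have "S a = S b" by (simp flip: emb_ap)
    then show "a = b" using bij_antipode by (simp add: bij_betw_def inj_eq)
  qed
  show "surj ap"
  proof (rule surjI)
    fix b
    have "emb b \<in> range S" using bij_antipode by (simp add: bij_betw_def)
    then obtain a where "emb b = S a" by auto
    then have "b = ap a" by - (rule emb_eqI, simp add: emb_ap)
    then show "ap (inv ap b) = b" by (simp add: f_inv_into_f)
  qed
qed

definition ap' :: "'a \<Rightarrow> 'a"
  where "ap' = inv ap"

lemma ap_ap' [simp]: "ap (ap' a) = a" "ap' (ap a) = a"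
  using bij_ap by (simp_all add: ap'_def bij_is_inj bij_is_surj surj_f_inv_f)

lemma ap_eq_iff: "ap a = ap b \<longleftrightarrow> a = b"
  using bij_ap by (simp add: bij_is_inj inj_eq)

lemma ap_eqI: "ap a = ap b \<Longrightarrow> a = b"
  by (simp add: ap_eq_iff)

lemma clinear_ap': "clinear ap'"
  by (rule clinearI; rule ap_eqI)
    (simp_all add: clinear_add[OF clinear_ap] clinear_scale[OF clinear_ap])

lemma clin_ap' [clin]: "clinear f \<Longrightarrow> clinear (\<lambda>x. ap' (f x))"
  by (rule clin_o[OF clinear_ap'])

lemma antipode_inv_eq: "antipode_inv S a = ap' a"
proof -
  have "inv S (S (ap' a)) = ap' a" using bij_antipode by (simp add: bij_betw_def)
  then show ?thesis by (simp add: antipode_inv_def flip: emb_ap)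
qed

lemma ap_cases: obtains b where "a = ap b"
  by (rule that[of "ap' a"]) simp

abbreviation "et \<equiv> eps_t \<Delta> S"

lemma times_eps_t_eq: "times_eps_t \<Delta> S d a = tsum (D2 d a) (\<lambda>p q. p * ap q)"
  by (simp add: times_eps_t_def emb_act flip: emb_ap)

lemma eps_s_times_eq: "eps_s_times \<Delta> S a d = tsum (D1 a d) (\<lambda>p q. ap p * q)"
  by (simp add: eps_s_times_def emb_act flip: emb_ap)

lemma clin_eps [clin]:
  "clinear f \<Longrightarrow> clinear (\<lambda>x. times_eps_t \<Delta> S d (f x))"
  "clinear f \<Longrightarrow> clinear (\<lambda>x. times_eps_t \<Delta> S (f x) a)"
  "clinear f \<Longrightarrow> clinear (\<lambda>x. eps_s_times \<Delta> S (f x) a)"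
  "clinear f \<Longrightarrow> clinear (\<lambda>x. eps_s_times \<Delta> S d (f x))"
  unfolding times_eps_t_eq eps_s_times_eq by (intro clin; assumption)+

text \<open>To make \<open>times_eps_t\<close> a right action, a compatible left action is missing.
  On slices of \<open>D2 c a\<close> it is supplied by \<open>E_left\<close>, where
  \<open>E \<rhd> (a \<otimes> b)\<close> does not depend on \<open>d\<close>; fullness then reaches
  all of \<open>A\<close>.\<close>

lemma ex_eps_t: "\<exists>v. \<forall>d. times_eps_t \<Delta> S d a * b = d * v"
proof -
  have "a \<in> {a. \<exists>v. \<forall>d. times_eps_t \<Delta> S d a * b = d * v}"
  proof (rule right_full)
    show "csubspace {a. \<exists>v. \<forall>d. times_eps_t \<Delta> S d a * b = d * v}"
    proof (rule csubspaceI; clarsimp)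
      show "\<exists>v. \<forall>d. times_eps_t \<Delta> S d 0 * b = d * v"
        by (rule exI[of _ 0]) (simp add: clinear_zero[OF clin_eps(1)[OF clinear_ident]])
      show "\<exists>v. \<forall>d. times_eps_t \<Delta> S d (x + y) * b = d * v"
        if "\<forall>d. times_eps_t \<Delta> S d x * b = d * v" "\<forall>d. times_eps_t \<Delta> S d y * b = d * w" for x y v w
        by (rule exI[of _ "v + w"])
          (simp add: clinear_add[OF clin_eps(1)[OF clinear_ident]] distrib_left distrib_right that)
      show "\<exists>v. \<forall>d. times_eps_t \<Delta> S d (c *\<^sub>C x) * b = d * v"
        if "\<forall>d. times_eps_t \<Delta> S d x * b = d * v" for x v c
        by (rule exI[of _ "c *\<^sub>C v"])
          (simp add: clinear_scale[OF clin_eps(1)[OF clinear_ident]] mult_scaleC_left mult_scaleC_right that)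
    qed
    fix f :: "'a \<Rightarrow> complex" and c a assume f [clin]: "clinear f"
    have 1: "\<forall>t. times_eps_t \<Delta> S d (slice_left f t) * b =
        slice_left f (tsum t (\<lambda>p q. p \<otimes> (times_eps_t \<Delta> S d q * b)))" for d
      by (rule tensor_all_eqI, intro clin, intro clin, subst tsum_pure, (intro clin)+,
        simp add: slice_left_pure f clinear_scale[OF clin_eps(1)[OF clinear_ident]] mult_scaleC_left)
    have 2: "\<forall>t. slice_left f ((c \<otimes> d) * t) = d * slice_left f (tsum t (\<lambda>p q. (c * p) \<otimes> q))" for d :: 'a
      by (rule tensor_all_eqI, intro clin, intro clin, subst tsum_pure, (intro clin)+,
        simp add: slice_left_pure f times_tensor_pure mult_scaleC_right)
    show "slice_left f (D2 c a) \<in> {a. \<exists>v. \<forall>d. times_eps_t \<Delta> S d a * b = d * v}"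
      using 1 2 E_left[of c _ a b, symmetric] by auto
  qed
  then show ?thesis by simp
qed

lemma act_et: "d \<lhd> et a = times_eps_t \<Delta> S d a"
proof -
  obtain l where l: "\<And>b d. times_eps_t \<Delta> S d a * b = d * l b"
    using ex_eps_t by metis
  obtain x where x: "\<And>d. d \<lhd> x = times_eps_t \<Delta> S d a"
    using ex_multiplier[of "\<lambda>d. times_eps_t \<Delta> S d a" l, OF l] by blast
  have "et a = x"
    unfolding eps_t_def by (rule the_equality) (auto intro: multiplier_eqI_right simp: x)
  then show ?thesis by (simp add: x)
qed

lemma act_et_eq: "d \<lhd> et a = tsum (D2 d a) (\<lambda>p q. p * ap q)"
  by (simp add: act_et times_eps_t_eq)

lemma clin_et [clin]: "clinear f \<Longrightarrow> clinear (\<lambda>x. et (f x))"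
  by (rule clin_o) (rule clinearI; rule multiplier_eqI_right;
    simp add: act_et right_act_simps clinear_add[OF clin_eps(1)[OF clinear_ident]]
      clinear_scale[OF clin_eps(1)[OF clinear_ident]])+

text \<open>The source map \<open>\<epsilon>\<^sub>s(a) = \<Sum> S(a\<^sub>1) a\<^sub>2\<close>, the
  counterpart of \<open>eps_t\<close>, recovered from its left action.\<close>

definition es :: "'a \<Rightarrow> 'a multiplier"
  where "es a = (SOME x. \<forall>d. x \<rhd> d = eps_s_times \<Delta> S a d)"

lemma ex_eps_s: "\<exists>v. \<forall>d. b * eps_s_times \<Delta> S a d = v * d"
proof -
  have "a \<in> {a. \<exists>v. \<forall>d. b * eps_s_times \<Delta> S a d = v * d}"
  proof (rule left_full)
    show "csubspace {a. \<exists>v. \<forall>d. b * eps_s_times \<Delta> S a d = v * d}"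
    proof (rule csubspaceI; clarsimp)
      show "\<exists>v. \<forall>d. b * eps_s_times \<Delta> S 0 d = v * d"
        by (rule exI[of _ 0]) (simp add: clinear_zero[OF clin_eps(3)[OF clinear_ident]])
      show "\<exists>v. \<forall>d. b * eps_s_times \<Delta> S (x + y) d = v * d"
        if "\<forall>d. b * eps_s_times \<Delta> S x d = v * d" "\<forall>d. b * eps_s_times \<Delta> S y d = w * d" for x y v w
        by (rule exI[of _ "v + w"])
          (simp add: clinear_add[OF clin_eps(3)[OF clinear_ident]] distrib_left distrib_right that)
      show "\<exists>v. \<forall>d. b * eps_s_times \<Delta> S (c *\<^sub>C x) d = v * d"
        if "\<forall>d. b * eps_s_times \<Delta> S x d = v * d" for x v c
        by (rule exI[of _ "c *\<^sub>C v"])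
          (simp add: clinear_scale[OF clin_eps(3)[OF clinear_ident]] mult_scaleC_left mult_scaleC_right that)
    qed
    fix f :: "'a \<Rightarrow> complex" and c a assume f [clin]: "clinear f"
    have 1: "\<forall>t. b * eps_s_times \<Delta> S (slice_right f t) d =
        slice_right f (tsum t (\<lambda>p q. (b * eps_s_times \<Delta> S p d) \<otimes> q))" for d
      by (rule tensor_all_eqI, intro clin, intro clin, subst tsum_pure, (intro clin)+,
        simp add: slice_right_pure f clinear_scale[OF clin_eps(3)[OF clinear_ident]] mult_scaleC_right)
    have 2: "\<forall>t. slice_right f (t * (d \<otimes> c)) = slice_right f (tsum t (\<lambda>p q. p \<otimes> (q * c))) * d" for d :: 'a
      by (rule tensor_all_eqI, intro clin, intro clin, subst tsum_pure, (intro clin)+,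
        simp add: slice_right_pure f times_tensor_pure mult_scaleC_left)
    show "slice_right f (D1 a c) \<in> {a. \<exists>v. \<forall>d. b * eps_s_times \<Delta> S a d = v * d}"
      using 1 2 E_right[of b a _ c, symmetric] by auto
  qed
  then show ?thesis by simp
qed

lemma es_act: "es a \<rhd> d = eps_s_times \<Delta> S a d"
proof -
  have "\<forall>b. \<exists>v. \<forall>d. b * eps_s_times \<Delta> S a d = v * d"
    using ex_eps_s by simp
  then obtain r where r: "\<And>b d. b * eps_s_times \<Delta> S a d = r b * d"
    unfolding choice_iff by blast
  have "\<exists>x. \<forall>d. x \<rhd> d = eps_s_times \<Delta> S a d"
    using ex_multiplier[of r "\<lambda>d. eps_s_times \<Delta> S a d", OF r[symmetric]] by blast
  from someI_ex[OF this] show ?thesis unfolding es_def by simp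
qed

lemma es_act_eq: "es a \<rhd> d = tsum (D1 a d) (\<lambda>p q. ap p * q)"
  by (simp add: es_act eps_s_times_eq)

lemma clin_es [clin]: "clinear f \<Longrightarrow> clinear (\<lambda>x. es (f x))"
  by (rule clin_o) (rule clinearI; rule multiplier_eqI_left;
    simp add: es_act left_act_simps clinear_add[OF clin_eps(3)[OF clinear_ident]]
      clinear_scale[OF clin_eps(3)[OF clinear_ident]])+

section \<open>The legs of the canonical idempotent\<close>

lemma E_left_et: "emb1 c \<rhd> E \<rhd> (a \<otimes> b) = tsum (D2 c a) (\<lambda>p q. p \<otimes> (et q \<rhd> b))"
proof (rule cover2_left)
  fix d
  have "tsum (emb1 c \<rhd> E \<rhd> (a \<otimes> b)) (\<lambda>v p. v \<otimes> (d * p)) = (c \<otimes> d) * (E \<rhd> (a \<otimes> b))" (is "?l = _")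
    by (subst tsum_act, (intro clin)+, simp add: mult_tsum emb_act left_act_simps)
  also have "\<dots> = tsum (D2 c a) (\<lambda>p q. p \<otimes> (d * (et q \<rhd> b)))"
    unfolding E_left by (simp add: act_et flip: act_middle)
  also have "\<dots> = tsum (tsum (D2 c a) (\<lambda>p q. p \<otimes> (et q \<rhd> b))) (\<lambda>v p. v \<otimes> (d * p))" (is "_ = ?r")
    by (subst push_tsum, intro clin, intro clin, subst tsum_pure, (intro clin)+, rule refl)
  finally show "?l = ?r" .
qed

lemma E_right_es: "(a \<otimes> b) \<lhd> E \<lhd> emb2 c = tsum (D1 b c) (\<lambda>p q. (a \<lhd> es p) \<otimes> q)"
proof (rule cover1_right)
  fix d
  have "tsum ((a \<otimes> b) \<lhd> E \<lhd> emb2 c) (\<lambda>p v. (p * d) \<otimes> v) = ((a \<otimes> b) \<lhd> E) * (d \<otimes> c)" (is "?l = _")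
    by (subst tsum_act, (intro clin)+, simp add: mult_tsum emb_act right_act_simps)
  also have "\<dots> = tsum (D1 b c) (\<lambda>p q. ((a \<lhd> es p) * d) \<otimes> q)"
    unfolding E_right by (simp add: act_middle es_act)
  also have "\<dots> = tsum (tsum (D1 b c) (\<lambda>p q. (a \<lhd> es p) \<otimes> q)) (\<lambda>p v. (p * d) \<otimes> v)" (is "_ = ?r")
    by (subst push_tsum, intro clin, intro clin, subst tsum_pure, (intro clin)+, rule refl)
  finally show "?l = ?r" .
qed

lemma E_et: "emb1 c * E * emb1 a = tsum (D2 c a) (\<lambda>p q. emb p \<otimes>\<^sub>M et q)"
proof (rule multiplier_cancel(2))
  fix b
  have "emb1 c * E * emb1 a * emb2 b = emb (emb1 c \<rhd> E \<rhd> (a \<otimes> b))" (is "?l = _")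
    by (simp add: emb_act_mult emb_tensor multiplier_tensor_mult mult.assoc)
  also have "\<dots> = tsum (D2 c a) (\<lambda>p q. (emb p \<otimes>\<^sub>M et q) * emb2 b)"
    by (simp add: E_left_et, subst push_act(3), intro clin,
      simp add: emb_tensor emb_act_mult multiplier_tensor_mult)
  also have "\<dots> = tsum (D2 c a) (\<lambda>p q. emb p \<otimes>\<^sub>M et q) * emb2 b" (is "_ = ?r")
    by (subst push_mult(1), intro clin, rule refl)
  finally show "?l = ?r" .
qed

lemma E_es: "emb2 b * E * emb2 c = tsum (D1 b c) (\<lambda>p q. es p \<otimes>\<^sub>M emb q)"
proof (rule multiplier_cancel(3))
  fix a
  have "emb1 a * (emb2 b * E * emb2 c) = emb ((a \<otimes> b) \<lhd> E \<lhd> emb2 c)" (is "?l = _")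
    by (simp add: emb_act_mult emb_tensor multiplier_tensor_mult_assoc mult.assoc)
  also have "\<dots> = tsum (D1 b c) (\<lambda>p q. (emb1 a) * (es p \<otimes>\<^sub>M emb q))"
    by (simp add: E_right_es, subst push_act(3), intro clin,
      simp add: emb_tensor emb_act_mult multiplier_tensor_mult)
  also have "\<dots> = emb1 a * tsum (D1 b c) (\<lambda>p q. es p \<otimes>\<^sub>M emb q)" (is "_ = ?r")
    by (subst push_mult(2), intro clin, rule refl)
  finally show "?l = ?r" .
qed

lemma leg12_E_et:
  "emb1 d * leg12 E * emb1 a = tsum (D2 d a) (\<lambda>p q. emb p \<otimes>\<^sub>M (et q \<otimes>\<^sub>M 1))"
proof -
  have "leg12 (emb1 d * E * emb1 a) = tsum (D2 d a) (\<lambda>p q. leg12 (emb p \<otimes>\<^sub>M et q))"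
    unfolding E_et by (rule lin_tsum) (intro clin)+
  then show ?thesis by (simp add: leg12_mult leg12_pure multiplier_tensor_one)
qed

lemma leg23_E_es:
  "(1 \<otimes>\<^sub>M 1 \<otimes>\<^sub>M emb d) * leg23 E * (1 \<otimes>\<^sub>M 1 \<otimes>\<^sub>M emb c) =
    assoc_transport (tsum (D1 d c) (\<lambda>p q. (1 \<otimes>\<^sub>M es p) \<otimes>\<^sub>M emb q))"
proof -
  have "(1 \<otimes>\<^sub>M 1 \<otimes>\<^sub>M emb d) * leg23 E * (1 \<otimes>\<^sub>M 1 \<otimes>\<^sub>M emb c) = 1 \<otimes>\<^sub>M (emb2 d * E * emb2 c)"
    by (simp add: leg23_def multiplier_tensor_mult)
  also have "\<dots> = tsum (D1 d c) (\<lambda>p q. 1 \<otimes>\<^sub>M es p \<otimes>\<^sub>M emb q)"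
    unfolding E_es by (rule lin_tsum) (intro clin)+
  also have "\<dots> = assoc_transport (tsum (D1 d c) (\<lambda>p q. (1 \<otimes>\<^sub>M es p) \<otimes>\<^sub>M emb q))"
    by (subst lin_tsum[OF assoc_transport_hom(2)], intro clin, simp add: assoc_transport_pure)
  finally show ?thesis .
qed

lemma leg23_commute: "emb1 d * leg23 x = leg23 x * emb1 d"
  by (simp add: leg23_def multiplier_tensor_mult)

text \<open>\<open>E\<close> in legs 1 and 2 commutes with \<open>E\<close> in legs 2 and 3. The
  second leg of the former consists of values of \<open>et\<close>, which fullness isolates.\<close>

lemma et_E: "(et x \<otimes>\<^sub>M 1) * E = E * (et x \<otimes>\<^sub>M 1)"
proof (rule right_full_multiplier_eqI[where \<Phi> = "\<lambda>x. (et x \<otimes>\<^sub>M 1) * E" and \<Psi> = "\<lambda>x. E * (et x \<otimes>\<^sub>M 1)"])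
  fix c a
  let ?t = "tsum (D2 c a) (\<lambda>p q. emb p \<otimes>\<^sub>M (et q \<otimes>\<^sub>M 1))"
  have "tsum (D2 c a) (\<lambda>p q. emb p \<otimes>\<^sub>M ((et q \<otimes>\<^sub>M 1) * E)) = ?t * leg23 E" (is "?l = _")
    by (subst push_mult(1), intro clin, simp add: leg23_def multiplier_tensor_mult)
  also have "\<dots> = emb1 c * (leg12 E * leg23 E) * emb1 a"
    by (simp add: leg12_E_et[symmetric] mult.assoc leg23_commute)
  also have "\<dots> = leg23 E * ?t"
    by (simp add: leg12_E_et[symmetric] E_commute mult.assoc)
      (simp add: leg23_commute flip: mult.assoc)
  also have "\<dots> = tsum (D2 c a) (\<lambda>p q. emb p \<otimes>\<^sub>M (E * (et q \<otimes>\<^sub>M 1)))" (is "_ = ?r")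
    by (subst push_mult(2), intro clin, simp add: leg23_def multiplier_tensor_mult)
  finally show "?l = ?r" .
qed (intro clin)+

lemma id_coprod_left_emb: "id_coprod \<Delta> (emb1 d \<rhd> t) = emb1 d * id_coprod \<Delta> t"
  and id_coprod_right_emb: "id_coprod \<Delta> (t \<lhd> emb1 d) = id_coprod \<Delta> t * emb1 d"
proof -
  show "id_coprod \<Delta> (emb1 d \<rhd> t) = emb1 d * id_coprod \<Delta> t"
    by (induct t rule: tensor_eq_induct)
      (intro csubspace_eq clin, simp add: id_coprod_pure multiplier_tensor_act multiplier_tensor_mult left_act_simps emb_act_mult)
  show "id_coprod \<Delta> (t \<lhd> emb1 d) = id_coprod \<Delta> t * emb1 d"
    by (induct t rule: tensor_eq_induct)
      (intro csubspace_eq clin, simp add: id_coprod_pure multiplier_tensor_act multiplier_tensor_mult right_act_simps emb_act_mult)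
qed

text \<open>Second legs are compared in \<open>(id \<otimes> \<Delta>)E = E\<^sub>1\<^sub>2
  E\<^sub>2\<^sub>3\<close>: the factor \<open>E\<^sub>2\<^sub>3\<close> is absorbed by
  \<open>\<Delta>(b)\<close>, and fullness isolates \<open>et x\<close>.
  \<open>Delta_et_right\<close> uses the other order of the commuting factors.\<close>

lemma Delta_et_left: "\<Delta> (et x \<rhd> b) = (et x \<otimes>\<^sub>M 1) * \<Delta> b"
proof (rule right_full_multiplier_eqI[where \<Phi> = "\<lambda>x. \<Delta> (et x \<rhd> b)" and \<Psi> = "\<lambda>x. (et x \<otimes>\<^sub>M 1) * \<Delta> b"])
  fix c a
  have "tsum (D2 c a) (\<lambda>p q. emb p \<otimes>\<^sub>M \<Delta> (et q \<rhd> b)) = id_coprod \<Delta> (emb1 c \<rhd> E \<rhd> (a \<otimes> b))" (is "?l = _")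
    unfolding E_left_et
    by (subst lin_tsum[of "id_coprod \<Delta>"], intro clin, intro clin, simp add: id_coprod_pure)
  also have "\<dots> = emb1 c * (id_coprod_hat E * (emb a \<otimes>\<^sub>M \<Delta> b))"
    by (simp only: id_coprod_left_emb) (simp only: id_coprod_hat_simps(5)[symmetric] id_coprod_pure)
  also have "\<dots> = emb1 c * leg12 E * emb1 a * (1 \<otimes>\<^sub>M \<Delta> b)"
    by (simp add: id_coprod_E mult.assoc leg23_def multiplier_tensor_mult E_Delta)
  also have "\<dots> = tsum (D2 c a) (\<lambda>p q. emb p \<otimes>\<^sub>M ((et q \<otimes>\<^sub>M 1) * \<Delta> b))" (is "_ = ?r")
    unfolding leg12_E_et by (subst push_mult(1), intro clin, simp add: multiplier_tensor_mult)
  finally show "?l = ?r" .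
qed (intro clin)+

lemma E_left_et': "(c \<otimes> b) \<lhd> E \<lhd> emb1 a = tsum (D2 c a) (\<lambda>p q. p \<otimes> (b \<lhd> et q))"
proof (rule emb_eqI)
  have "emb ((c \<otimes> b) \<lhd> E \<lhd> emb1 a) = emb2 b * (emb1 c * E * emb1 a)" (is "?l = _")
    by (simp add: emb_act_mult emb_tensor multiplier_tensor_mult_assoc mult.assoc)
  also have "\<dots> = emb (tsum (D2 c a) (\<lambda>p q. p \<otimes> (b \<lhd> et q)))" (is "_ = ?r")
    unfolding E_et by (subst push_mult(2), intro clin, subst push_act(3), (intro clin)+,
      simp add: emb_tensor emb_act_mult multiplier_tensor_mult)
  finally show "?l = ?r" .
qed

lemma E_right_es': "emb2 b \<rhd> E \<rhd> (a \<otimes> c) = tsum (D1 b c) (\<lambda>p q. (es p \<rhd> a) \<otimes> q)"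
proof (rule emb_eqI)
  have "emb (emb2 b \<rhd> E \<rhd> (a \<otimes> c)) = emb2 b * E * emb2 c * emb1 a" (is "?l = _")
    by (simp add: emb_act_mult emb_tensor multiplier_tensor_mult mult.assoc)
  also have "\<dots> = emb (tsum (D1 b c) (\<lambda>p q. (es p \<rhd> a) \<otimes> q))" (is "_ = ?r")
    unfolding E_es by (subst push_mult(1), intro clin, subst push_act(3), (intro clin)+,
      simp add: emb_tensor emb_act_mult multiplier_tensor_mult)
  finally show "?l = ?r" .
qed

lemma Delta_et_right: "\<Delta> (b \<lhd> et x) = \<Delta> b * (et x \<otimes>\<^sub>M 1)"
proof (rule right_full_multiplier_eqI[where \<Phi> = "\<lambda>x. \<Delta> (b \<lhd> et x)" and \<Psi> = "\<lambda>x. \<Delta> b * (et x \<otimes>\<^sub>M 1)"])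
  fix c a
  have "tsum (D2 c a) (\<lambda>p q. emb p \<otimes>\<^sub>M \<Delta> (b \<lhd> et q)) = id_coprod \<Delta> ((c \<otimes> b) \<lhd> E \<lhd> emb1 a)" (is "?l = _")
    unfolding E_left_et'
    by (subst lin_tsum[of "id_coprod \<Delta>"], intro clin, intro clin, simp add: id_coprod_pure)
  also have "\<dots> = (emb c \<otimes>\<^sub>M \<Delta> b) * id_coprod_hat E * emb1 a"
    by (simp only: id_coprod_right_emb) (simp only: id_coprod_hat_simps(6)[symmetric] id_coprod_pure)
  also have "\<dots> = (emb c \<otimes>\<^sub>M \<Delta> b) * leg12 E * emb1 a"
  proof -
    have "(emb c \<otimes>\<^sub>M \<Delta> b) * id_coprod_hat E = (emb c \<otimes>\<^sub>M \<Delta> b) * leg23 E * leg12 E"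
      using id_coprod_E E_commute by (simp add: mult.assoc)
    then show ?thesis by (simp add: leg23_def multiplier_tensor_mult Delta_E)
  qed
  also have "\<dots> = (1 \<otimes>\<^sub>M \<Delta> b) * (emb1 c * leg12 E * emb1 a)"
    by (simp add: multiplier_tensor_mult_assoc mult.assoc)
  also have "\<dots> = tsum (D2 c a) (\<lambda>p q. emb p \<otimes>\<^sub>M (\<Delta> b * (et q \<otimes>\<^sub>M 1)))" (is "_ = ?r")
    unfolding leg12_E_et by (subst push_mult(2), intro clin, simp add: multiplier_tensor_mult)
  finally show "?l = ?r" .
qed (intro clin)+

lemma leg12_commute: "leg12 x * (1 \<otimes>\<^sub>M 1 \<otimes>\<^sub>M emb d) = (1 \<otimes>\<^sub>M 1 \<otimes>\<^sub>M emb d) * leg12 x"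
  for x :: "('a \<otimes> 'a) multiplier"
  by (simp add: leg12_def multiplier_tensor_mult multiplier_tensor_one
      flip: assoc_transport_pure assoc_transport_hom(1))

lemma es_E: "(1 \<otimes>\<^sub>M es x) * E = E * (1 \<otimes>\<^sub>M es x)"
proof (rule left_full_multiplier_eqI[where \<Phi> = "\<lambda>x. (1 \<otimes>\<^sub>M es x) * E" and \<Psi> = "\<lambda>x. E * (1 \<otimes>\<^sub>M es x)"],
    intro clin, intro clin, rule assoc_transport_hom(5))
  fix c a
  let ?t = "tsum (D1 a c) (\<lambda>p q. (1 \<otimes>\<^sub>M es p) \<otimes>\<^sub>M emb q)"
  have "assoc_transport (tsum (D1 a c) (\<lambda>p q. ((1 \<otimes>\<^sub>M es p) * E) \<otimes>\<^sub>M emb q)) = assoc_transport ?t * leg12 E" (is "?l = _")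
    unfolding leg12_def assoc_transport_hom(1)[symmetric]
    by (subst push_mult(1), intro clin, simp add: multiplier_tensor_mult)
  also have "\<dots> = (1 \<otimes>\<^sub>M 1 \<otimes>\<^sub>M emb a) * (leg23 E * leg12 E) * (1 \<otimes>\<^sub>M 1 \<otimes>\<^sub>M emb c)"
    by (simp add: leg23_E_es[symmetric] mult.assoc leg12_commute)
  also have "\<dots> = leg12 E * assoc_transport ?t"
    by (simp add: leg23_E_es[symmetric] E_commute[symmetric] mult.assoc)
      (simp add: leg12_commute flip: mult.assoc)
  also have "\<dots> = assoc_transport (tsum (D1 a c) (\<lambda>p q. (E * (1 \<otimes>\<^sub>M es p)) \<otimes>\<^sub>M emb q))" (is "_ = ?r")
    unfolding leg12_def assoc_transport_hom(1)[symmetric]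
    by (subst push_mult(2), intro clin, simp add: multiplier_tensor_mult)
  finally show "?l = ?r" .
qed

lemma coprod_id_left_emb: "coprod_id \<Delta> (emb2 d \<rhd> t) = (1 \<otimes>\<^sub>M 1 \<otimes>\<^sub>M emb d) * coprod_id \<Delta> t"
  and coprod_id_right_emb: "coprod_id \<Delta> (t \<lhd> emb2 d) = coprod_id \<Delta> t * (1 \<otimes>\<^sub>M 1 \<otimes>\<^sub>M emb d)"
proof -
  have 1: "1 \<otimes>\<^sub>M 1 \<otimes>\<^sub>M emb d = assoc_transport ((1 :: ('a \<otimes> 'a) multiplier) \<otimes>\<^sub>M emb d)"
    by (simp add: multiplier_tensor_one flip: assoc_transport_pure)
  show "coprod_id \<Delta> (emb2 d \<rhd> t) = (1 \<otimes>\<^sub>M 1 \<otimes>\<^sub>M emb d) * coprod_id \<Delta> t"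
    by (induct t rule: tensor_eq_induct)
      (intro csubspace_eq clin, simp add: 1 coprod_id_pure multiplier_tensor_act multiplier_tensor_mult left_act_simps emb_act_mult
        flip: assoc_transport_hom(1))
  show "coprod_id \<Delta> (t \<lhd> emb2 d) = coprod_id \<Delta> t * (1 \<otimes>\<^sub>M 1 \<otimes>\<^sub>M emb d)"
    by (induct t rule: tensor_eq_induct)
      (intro csubspace_eq clin, simp add: 1 coprod_id_pure multiplier_tensor_act multiplier_tensor_mult right_act_simps emb_act_mult
        flip: assoc_transport_hom(1))
qed

text \<open>The mirror image of \<open>Delta_et_left\<close>, with first legs of \<open>E\<close> in
  place of second ones. It rests on the value of \<open>(\<Delta> \<otimes> id)E\<close>, which is
  \<open>coprod_id_hat_E\<close>.\<close>

lemma Delta_es_left: "\<Delta> (es x \<rhd> b) = (1 \<otimes>\<^sub>M es x) * \<Delta> b"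
proof (rule left_full_multiplier_eqI[where \<Phi> = "\<lambda>x. \<Delta> (es x \<rhd> b)" and \<Psi> = "\<lambda>x. (1 \<otimes>\<^sub>M es x) * \<Delta> b"],
    intro clin, intro clin, rule assoc_transport_hom(5))
  fix c a
  have 1: "coprod_id \<Delta> (b \<otimes> c) = (1 \<otimes>\<^sub>M 1 \<otimes>\<^sub>M emb c) * assoc_transport (\<Delta> b \<otimes>\<^sub>M 1)"
    by (simp add: coprod_id_pure multiplier_tensor_mult multiplier_tensor_one
      flip: assoc_transport_pure assoc_transport_hom(1))
  have "assoc_transport (tsum (D1 a c) (\<lambda>p q. \<Delta> (es p \<rhd> b) \<otimes>\<^sub>M emb q)) =
      coprod_id \<Delta> (emb2 a \<rhd> E \<rhd> (b \<otimes> c))" (is "?l = _")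
    unfolding E_right_es'
    by (subst lin_tsum[of "coprod_id \<Delta>"], intro clin, intro clin,
      subst lin_tsum[OF assoc_transport_hom(2)], intro clin, simp add: coprod_id_pure)
  also have "\<dots> = (1 \<otimes>\<^sub>M 1 \<otimes>\<^sub>M emb a) * (coprod_id_hat E * coprod_id \<Delta> (b \<otimes> c))"
    by (simp only: coprod_id_left_emb) (simp only: coprod_id_hat_simps(5)[symmetric])
  also have "\<dots> = (1 \<otimes>\<^sub>M 1 \<otimes>\<^sub>M emb a) * (leg23 E * (leg12 E * coprod_id \<Delta> (b \<otimes> c)))"
    by (simp add: coprod_id_hat_E E_commute mult.assoc)
  also have "leg12 E * coprod_id \<Delta> (b \<otimes> c) = coprod_id \<Delta> (b \<otimes> c)"
    using extendable_coprod_id by (simp add: extendable_def)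
  also have "(1 \<otimes>\<^sub>M 1 \<otimes>\<^sub>M emb a) * (leg23 E * coprod_id \<Delta> (b \<otimes> c)) =
      assoc_transport (tsum (D1 a c) (\<lambda>p q. (1 \<otimes>\<^sub>M es p) \<otimes>\<^sub>M emb q) * (\<Delta> b \<otimes>\<^sub>M 1))"
    by (simp add: 1 assoc_transport_hom(1) leg23_E_es[symmetric] mult.assoc)
  also have "\<dots> = assoc_transport (tsum (D1 a c) (\<lambda>p q. ((1 \<otimes>\<^sub>M es p) * \<Delta> b) \<otimes>\<^sub>M emb q))" (is "_ = ?r")
    by (subst push_mult(1), intro clin, simp add: multiplier_tensor_mult)
  finally show "?l = ?r" .
qed

lemma Delta_es_right: "\<Delta> (b \<lhd> es x) = \<Delta> b * (1 \<otimes>\<^sub>M es x)"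
proof (rule left_full_multiplier_eqI[where \<Phi> = "\<lambda>x. \<Delta> (b \<lhd> es x)" and \<Psi> = "\<lambda>x. \<Delta> b * (1 \<otimes>\<^sub>M es x)"],
    intro clin, intro clin, rule assoc_transport_hom(5))
  fix c a
  have 1: "coprod_id \<Delta> (b \<otimes> a) = assoc_transport (\<Delta> b \<otimes>\<^sub>M 1) * (1 \<otimes>\<^sub>M 1 \<otimes>\<^sub>M emb a)"
    by (simp add: coprod_id_pure multiplier_tensor_mult multiplier_tensor_one
      flip: assoc_transport_pure assoc_transport_hom(1))
  have "assoc_transport (tsum (D1 a c) (\<lambda>p q. \<Delta> (b \<lhd> es p) \<otimes>\<^sub>M emb q)) =
      coprod_id \<Delta> ((b \<otimes> a) \<lhd> E \<lhd> emb2 c)" (is "?l = _")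
    unfolding E_right_es
    by (subst lin_tsum[of "coprod_id \<Delta>"], intro clin, intro clin,
      subst lin_tsum[OF assoc_transport_hom(2)], intro clin, simp add: coprod_id_pure)
  also have "\<dots> = coprod_id \<Delta> (b \<otimes> a) * coprod_id_hat E * (1 \<otimes>\<^sub>M 1 \<otimes>\<^sub>M emb c)"
    by (simp only: coprod_id_right_emb) (simp only: coprod_id_hat_simps(6)[symmetric])
  also have "\<dots> = coprod_id \<Delta> (b \<otimes> a) * leg12 E * leg23 E * (1 \<otimes>\<^sub>M 1 \<otimes>\<^sub>M emb c)"
    by (simp add: coprod_id_hat_E mult.assoc)
  also have "coprod_id \<Delta> (b \<otimes> a) * leg12 E = coprod_id \<Delta> (b \<otimes> a)"
    using extendable_coprod_id by (simp add: extendable_def)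
  also have "coprod_id \<Delta> (b \<otimes> a) * leg23 E * (1 \<otimes>\<^sub>M 1 \<otimes>\<^sub>M emb c) =
      assoc_transport ((\<Delta> b \<otimes>\<^sub>M 1) * tsum (D1 a c) (\<lambda>p q. (1 \<otimes>\<^sub>M es p) \<otimes>\<^sub>M emb q))"
    by (simp add: 1 assoc_transport_hom(1) leg23_E_es[symmetric] mult.assoc)
  also have "\<dots> = assoc_transport (tsum (D1 a c) (\<lambda>p q. (\<Delta> b * (1 \<otimes>\<^sub>M es p)) \<otimes>\<^sub>M emb q))" (is "_ = ?r")
    by (subst push_mult(2), intro clin, simp add: multiplier_tensor_mult)
  finally show "?l = ?r" .
qed

lemma et_target: "et a \<in> target_algebra \<Delta> E"
  unfolding target_algebra_def
  by (simp, rule multiplier_extension_eqI[OF extendable_Delta])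
    (simp_all add: E_idem mult.assoc Delta_et_left E_Delta)

lemma es_source: "es a \<in> source_algebra \<Delta> E"
  unfolding source_algebra_def
  by (simp, rule multiplier_extension_eqI[OF extendable_Delta])
    (simp_all add: mult.assoc E_Delta_assoc es_E Delta_es_left flip: es_E,
     simp_all add: E_idem E_Delta es_E mult.assoc flip: Delta_es_left)

text \<open>The first leg of \<open>E\<close> consists of values of \<open>es\<close>, so a map
  \<open>L\<close> that carries \<open>es r\<close> to its second factor lets \<open>E\<close> pass.
  For \<open>L a = D1 a d\<close> or \<open>L a = D2 c a\<close>, applying \<open>E\<close> before
  the coproduct of the first leg amounts to applying it to the second factor of that coproduct and
  the other leg. \<open>G\<close> stands for whatever is done with the result.\<close>

lemma E_past_source:
  fixes L :: "'a \<Rightarrow> 'v::complex_vector \<otimes> 'a"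
  assumes L: "clinear L" "\<And>r a. L (es r \<rhd> a) = tsum (L a) (\<lambda>v p. v \<otimes> (es r \<rhd> p))"
    and G: "\<And>w. clinear (\<lambda>v. G v w)" "\<And>v. clinear (G v)"
  shows "tsum (E \<rhd> t) (\<lambda>p q. tsum (L p) (\<lambda>v p'. G v (p' \<otimes> q))) =
    tsum t (\<lambda>p q. tsum (L p) (\<lambda>v p'. G v (E \<rhd> (p' \<otimes> q))))"
proof -
  note [clin] = clin_o[OF L(1)]
  \<comment> \<open>The universal expression comes first, because there the last factor can be
    covered; an arbitrary \<open>G\<close> offers no place for a cover.\<close>
  have *: "tsum (E \<rhd> (a \<otimes> c)) (\<lambda>p q. tsum (L p) (\<lambda>v p'. (v \<otimes> p') \<otimes> q)) =
      tsum (L a) (\<lambda>v p'. tsum (E \<rhd> (p' \<otimes> c)) (\<lambda>\<alpha> \<beta>. (v \<otimes> \<alpha>) \<otimes> \<beta>))" for a c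
  proof (rule cover2_left)
    fix d
    have "tsum (tsum (E \<rhd> (a \<otimes> c)) (\<lambda>p q. tsum (L p) (\<lambda>v p'. (v \<otimes> p') \<otimes> q))) (\<lambda>x q. x \<otimes> (d * q)) =
        tsum (emb2 d \<rhd> E \<rhd> (a \<otimes> c)) (\<lambda>p q. tsum (L p) (\<lambda>v p'. (v \<otimes> p') \<otimes> q))" (is "?l = _")
      by (simp add: tsum_pure push clin tsum_act emb_act left_act_simps)
    also have "\<dots> = tsum (D1 d c) (\<lambda>r q. tsum (L a) (\<lambda>v p'. (v \<otimes> (es r \<rhd> p')) \<otimes> q))"
      by (simp add: E_right_es' tsum_pure push clin L(2))
    also have "\<dots> = tsum (L a) (\<lambda>v p'. tsum (D1 d c) (\<lambda>r q. (v \<otimes> (es r \<rhd> p')) \<otimes> q))"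
      by (rule tsum_swap) (intro clin)+
    also have "\<dots> = tsum (L a) (\<lambda>v p'. tsum (emb2 d \<rhd> E \<rhd> (p' \<otimes> c)) (\<lambda>\<alpha> \<beta>. (v \<otimes> \<alpha>) \<otimes> \<beta>))"
      by (simp add: E_right_es' tsum_pure push clin)
    also have "\<dots> = tsum (tsum (L a) (\<lambda>v p'. tsum (E \<rhd> (p' \<otimes> c)) (\<lambda>\<alpha> \<beta>. (v \<otimes> \<alpha>) \<otimes> \<beta>))) (\<lambda>x q. x \<otimes> (d * q))" (is "_ = ?r")
      by (simp add: tsum_pure push clin tsum_act emb_act left_act_simps)
    finally show "?l = ?r" .
  qed
  note [clin] = clin_o[OF G(1)] clin_o[OF G(2)]
  have "\<forall>t. tsum (E \<rhd> t) (\<lambda>p q. tsum (L p) (\<lambda>v p'. G v (p' \<otimes> q))) =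
    tsum t (\<lambda>p q. tsum (L p) (\<lambda>v p'. G v (E \<rhd> (p' \<otimes> q))))"
  proof (rule tensor_all_eqI)
    fix a c
    have b: "cbilinear (\<lambda>x q. tsum x (\<lambda>v p'. G v (p' \<otimes> q)))" by (intro clin)
    have "tsum (tsum (E \<rhd> (a \<otimes> c)) (\<lambda>p q. tsum (L p) (\<lambda>v p'. (v \<otimes> p') \<otimes> q))) (\<lambda>x q. tsum x (\<lambda>v p'. G v (p' \<otimes> q))) =
        tsum (tsum (L a) (\<lambda>v p'. tsum (E \<rhd> (p' \<otimes> c)) (\<lambda>\<alpha> \<beta>. (v \<otimes> \<alpha>) \<otimes> \<beta>))) (\<lambda>x q. tsum x (\<lambda>v p'. G v (p' \<otimes> q)))"
      by (simp only: *)
    moreover have "tsum w (\<lambda>\<alpha> \<beta>. G v (\<alpha> \<otimes> \<beta>)) = G v w" for v w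
      using lin_tsum[OF G(2) cbilinear_pure_tensor, of v w] by (simp add: tsum_id)
    ultimately show "tsum (E \<rhd> (a \<otimes> c)) (\<lambda>p q. tsum (L p) (\<lambda>v p'. G v (p' \<otimes> q))) =
      tsum (a \<otimes> c) (\<lambda>p q. tsum (L p) (\<lambda>v p'. G v (E \<rhd> (p' \<otimes> q))))"
      by (simp add: tsum_pure push clin)
  qed (intro clin)+
  then show ?thesis by simp
qed

text \<open>The second leg of \<open>E\<close> consists of values of \<open>et\<close>, so here a
  coproduct of the second leg is passed, along its first factor.\<close>

lemma E_past_target:
  fixes U :: "'a \<Rightarrow> 'a \<otimes> 'v::complex_vector"
  assumes U: "clinear U" "\<And>r a. U (et r \<rhd> a) = tsum (U a) (\<lambda>q v. (et r \<rhd> q) \<otimes> v)"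
    and G: "\<And>v. clinear (\<lambda>w. G w v)" "\<And>w. clinear (G w)"
  shows "tsum (E \<rhd> t) (\<lambda>p q. tsum (U q) (\<lambda>q' v. G (p \<otimes> q') v)) =
    tsum t (\<lambda>p q. tsum (U q) (\<lambda>q' v. G (E \<rhd> (p \<otimes> q')) v))"
proof -
  note [clin] = clin_o[OF U(1)]
  have *: "tsum (E \<rhd> (a \<otimes> c)) (\<lambda>p q. tsum (U q) (\<lambda>q' v. p \<otimes> (q' \<otimes> v))) =
      tsum (U c) (\<lambda>q' v. tsum (E \<rhd> (a \<otimes> q')) (\<lambda>\<alpha> \<beta>. \<alpha> \<otimes> (\<beta> \<otimes> v)))" for a c
  proof (rule cover1_left)
    fix d
    have "tsum (tsum (E \<rhd> (a \<otimes> c)) (\<lambda>p q. tsum (U q) (\<lambda>q' v. p \<otimes> (q' \<otimes> v)))) (\<lambda>q x. (d * q) \<otimes> x) =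
        tsum (emb1 d \<rhd> E \<rhd> (a \<otimes> c)) (\<lambda>p q. tsum (U q) (\<lambda>q' v. p \<otimes> (q' \<otimes> v)))" (is "?l = _")
      by (simp add: tsum_pure push clin tsum_act emb_act left_act_simps)
    also have "\<dots> = tsum (D2 d a) (\<lambda>p r. tsum (U c) (\<lambda>q' v. p \<otimes> ((et r \<rhd> q') \<otimes> v)))"
      by (simp add: E_left_et tsum_pure push clin U(2))
    also have "\<dots> = tsum (U c) (\<lambda>q' v. tsum (D2 d a) (\<lambda>p r. p \<otimes> ((et r \<rhd> q') \<otimes> v)))"
      by (rule tsum_swap) (intro clin)+
    also have "\<dots> = tsum (U c) (\<lambda>q' v. tsum (emb1 d \<rhd> E \<rhd> (a \<otimes> q')) (\<lambda>\<alpha> \<beta>. \<alpha> \<otimes> (\<beta> \<otimes> v)))"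
      by (simp add: E_left_et tsum_pure push clin)
    also have "\<dots> = tsum (tsum (U c) (\<lambda>q' v. tsum (E \<rhd> (a \<otimes> q')) (\<lambda>\<alpha> \<beta>. \<alpha> \<otimes> (\<beta> \<otimes> v)))) (\<lambda>q x. (d * q) \<otimes> x)" (is "_ = ?r")
      by (simp add: tsum_pure push clin tsum_act emb_act left_act_simps)
    finally show "?l = ?r" .
  qed
  note [clin] = clin_o[OF G(1)] clin_o[OF G(2)]
  have "\<forall>t. tsum (E \<rhd> t) (\<lambda>p q. tsum (U q) (\<lambda>q' v. G (p \<otimes> q') v)) =
    tsum t (\<lambda>p q. tsum (U q) (\<lambda>q' v. G (E \<rhd> (p \<otimes> q')) v))"
  proof (rule tensor_all_eqI)
    fix a c
    have "tsum (tsum (E \<rhd> (a \<otimes> c)) (\<lambda>p q. tsum (U q) (\<lambda>q' v. p \<otimes> (q' \<otimes> v)))) (\<lambda>p x. tsum x (\<lambda>q' v. G (p \<otimes> q') v)) =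
        tsum (tsum (U c) (\<lambda>q' v. tsum (E \<rhd> (a \<otimes> q')) (\<lambda>\<alpha> \<beta>. \<alpha> \<otimes> (\<beta> \<otimes> v)))) (\<lambda>p x. tsum x (\<lambda>q' v. G (p \<otimes> q') v))"
      by (simp only: *)
    moreover have "tsum w (\<lambda>\<alpha> \<beta>. G (\<alpha> \<otimes> \<beta>) v) = G w v" for v w
      using lin_tsum[OF G(1) cbilinear_pure_tensor, of w v] by (simp add: tsum_id)
    ultimately show "tsum (E \<rhd> (a \<otimes> c)) (\<lambda>p q. tsum (U q) (\<lambda>q' v. G (p \<otimes> q') v)) =
      tsum (a \<otimes> c) (\<lambda>p q. tsum (U q) (\<lambda>q' v. G (E \<rhd> (p \<otimes> q')) v))"
      by (simp add: tsum_pure push clin)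
  qed (intro clin)+
  then show ?thesis by simp
qed

lemma E_past_target_right:
  fixes U :: "'a \<Rightarrow> 'a \<otimes> 'v::complex_vector"
  assumes U: "clinear U" "\<And>r a. U (a \<lhd> et r) = tsum (U a) (\<lambda>q v. (q \<lhd> et r) \<otimes> v)"
    and G: "\<And>v. clinear (\<lambda>w. G w v)" "\<And>w. clinear (G w)"
  shows "tsum (t \<lhd> E) (\<lambda>p q. tsum (U q) (\<lambda>q' v. G (p \<otimes> q') v)) =
    tsum t (\<lambda>p q. tsum (U q) (\<lambda>q' v. G ((p \<otimes> q') \<lhd> E) v))"
proof -
  note [clin] = clin_o[OF U(1)]
  have *: "tsum ((a \<otimes> c) \<lhd> E) (\<lambda>p q. tsum (U q) (\<lambda>q' v. p \<otimes> (q' \<otimes> v))) =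
      tsum (U c) (\<lambda>q' v. tsum ((a \<otimes> q') \<lhd> E) (\<lambda>\<alpha> \<beta>. \<alpha> \<otimes> (\<beta> \<otimes> v)))" for a c
  proof (rule cover1_right)
    fix d
    have "tsum (tsum ((a \<otimes> c) \<lhd> E) (\<lambda>p q. tsum (U q) (\<lambda>q' v. p \<otimes> (q' \<otimes> v)))) (\<lambda>q x. (q * d) \<otimes> x) =
        tsum ((a \<otimes> c) \<lhd> E \<lhd> emb1 d) (\<lambda>p q. tsum (U q) (\<lambda>q' v. p \<otimes> (q' \<otimes> v)))" (is "?l = _")
      by (simp add: tsum_pure push clin tsum_act emb_act right_act_simps)
    also have "\<dots> = tsum (D2 a d) (\<lambda>p r. tsum (U c) (\<lambda>q' v. p \<otimes> ((q' \<lhd> et r) \<otimes> v)))"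
      by (simp add: E_left_et' tsum_pure push clin U(2))
    also have "\<dots> = tsum (U c) (\<lambda>q' v. tsum (D2 a d) (\<lambda>p r. p \<otimes> ((q' \<lhd> et r) \<otimes> v)))"
      by (rule tsum_swap) (intro clin)+
    also have "\<dots> = tsum (U c) (\<lambda>q' v. tsum ((a \<otimes> q') \<lhd> E \<lhd> emb1 d) (\<lambda>\<alpha> \<beta>. \<alpha> \<otimes> (\<beta> \<otimes> v)))"
      by (simp add: E_left_et' tsum_pure push clin)
    also have "\<dots> = tsum (tsum (U c) (\<lambda>q' v. tsum ((a \<otimes> q') \<lhd> E) (\<lambda>\<alpha> \<beta>. \<alpha> \<otimes> (\<beta> \<otimes> v)))) (\<lambda>q x. (q * d) \<otimes> x)" (is "_ = ?r")
      by (simp add: tsum_pure push clin tsum_act emb_act right_act_simps)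
    finally show "?l = ?r" .
  qed
  note [clin] = clin_o[OF G(1)] clin_o[OF G(2)]
  have "\<forall>t. tsum (t \<lhd> E) (\<lambda>p q. tsum (U q) (\<lambda>q' v. G (p \<otimes> q') v)) =
    tsum t (\<lambda>p q. tsum (U q) (\<lambda>q' v. G ((p \<otimes> q') \<lhd> E) v))"
  proof (rule tensor_all_eqI)
    fix a c
    have "tsum (tsum ((a \<otimes> c) \<lhd> E) (\<lambda>p q. tsum (U q) (\<lambda>q' v. p \<otimes> (q' \<otimes> v)))) (\<lambda>p x. tsum x (\<lambda>q' v. G (p \<otimes> q') v)) =
        tsum (tsum (U c) (\<lambda>q' v. tsum ((a \<otimes> q') \<lhd> E) (\<lambda>\<alpha> \<beta>. \<alpha> \<otimes> (\<beta> \<otimes> v)))) (\<lambda>p x. tsum x (\<lambda>q' v. G (p \<otimes> q') v))"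
      by (simp only: *)
    moreover have "tsum w (\<lambda>\<alpha> \<beta>. G (\<alpha> \<otimes> \<beta>) v) = G w v" for v w
      using lin_tsum[OF G(1) cbilinear_pure_tensor, of w v] by (simp add: tsum_id)
    ultimately show "tsum ((a \<otimes> c) \<lhd> E) (\<lambda>p q. tsum (U q) (\<lambda>q' v. G (p \<otimes> q') v)) =
      tsum (a \<otimes> c) (\<lambda>p q. tsum (U q) (\<lambda>q' v. G ((p \<otimes> q') \<lhd> E) v))"
      by (simp add: tsum_pure push clin)
  qed (intro clin)+
  then show ?thesis by simp
qed

lemma T1_Delta: "D1 (q * e) y = \<Delta> q \<rhd> D1 e y"
  and Delta_act: "\<Delta> q \<rhd> (x \<otimes> y) = D1 q y \<lhd> emb1 x"
  and T1_cover: "emb1 c \<rhd> D1 q x = D2 c q \<lhd> emb2 x"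
  by (rule emb_eqI, simp add: emb_T1 emb_T2 emb_act_mult emb_tensor Delta_mult mult.assoc multiplier_tensor_mult)+

lemma T1_act:
  "D1 (es r \<rhd> a) d = (1 \<otimes>\<^sub>M es r) \<rhd> D1 a d"
  "D1 (et r \<rhd> a) d = (et r \<otimes>\<^sub>M 1) \<rhd> D1 a d"
  "D1 (a \<lhd> et r) d = D1 a d \<lhd> (et r \<otimes>\<^sub>M 1)"
  by (rule emb_eqI, simp add: emb_T1 emb_T2 emb_act_mult Delta_es_left Delta_et_left Delta_et_right
      mult.assoc multiplier_tensor_mult)+

lemma T2_act:
  "D2 c (es r \<rhd> a) = (1 \<otimes>\<^sub>M es r) \<rhd> D2 c a"
  "D2 c (a \<lhd> et r) = D2 c a \<lhd> (et r \<otimes>\<^sub>M 1)"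
  "D2 c (a \<lhd> es r) = D2 c a \<lhd> (1 \<otimes>\<^sub>M es r)"
  by (rule emb_eqI, simp add: emb_T1 emb_T2 emb_act_mult Delta_es_left Delta_es_right Delta_et_right
      mult.assoc multiplier_tensor_mult_assoc)+

lemma ap_mult_sum: "tsum (E \<rhd> (a \<otimes> b)) (\<lambda>p q. ap p * q) = ap a * b"
  and mult_ap_sum: "tsum ((b \<otimes> a) \<lhd> E) (\<lambda>p q. p * ap q) = b * ap a"
  using antipode_left[of a b] antipode_right[of b a] by (simp_all add: emb_act flip: emb_ap)

section \<open>The maps \<open>G1\<close> and \<open>G2\<close> in terms of the antipode\<close>

lemma clinear_G: "clinear G1" "clinear G2"
  using G1 G2 by (simp_all add: G1_map_def G2_map_def)

lemma clin_G [clin]: "clinear f \<Longrightarrow> clinear (\<lambda>x. G1 (f x))" "clinear f \<Longrightarrow> clinear (\<lambda>x. G2 (f x))"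
  by (rule clin_o[OF clinear_G(1)] clin_o[OF clinear_G(2)]; assumption)+

lemma G1_es: "emb1 c \<rhd> G1 (a \<otimes> b) = tsum (D2 c a) (\<lambda>p q. p \<otimes> (es q \<rhd> b))"
  and G2_et: "G2 (a \<otimes> b) \<lhd> emb2 c = tsum (D1 b c) (\<lambda>p q. (a \<lhd> et p) \<otimes> q)"
  by (simp_all add: G1_antipode G2_antipode es_act act_et)

text \<open>By coassociativity \<open>G1\<close> depends on \<open>t\<close> only through
  \<open>T1 \<Delta> t\<close>: it is \<open>T1\<close> followed by \<open>p \<otimes> q \<mapsto>
  \<Sum> p\<^sub>1 \<otimes> S(p\<^sub>2) q\<close>, a map that so far makes sense only after
  covering by \<open>c\<close>.\<close>

lemma G1_T1: "emb1 c \<rhd> G1 t = tsum (T1 \<Delta> t) (\<lambda>p q. tsum (D2 c p) (\<lambda>r v. r \<otimes> (ap v * q)))"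
proof -
  have "\<forall>t. (emb1 c) \<rhd> G1 t = tsum (T1 \<Delta> t) (\<lambda>p q. tsum (D2 c p) (\<lambda>r v. r \<otimes> (ap v * q)))"
  proof (rule tensor_all_eqI)
    fix x y
    have "emb1 c \<rhd> G1 (x \<otimes> y) = tsum (D2 c x) (\<lambda>p q. tsum (D1 q y) (\<lambda>r v. p \<otimes> (ap r * v)))" (is "?l = _")
      by (simp add: G1_es es_act_eq push clin)
    also have "\<dots> = tsum (D1 x y) (\<lambda>p q. tsum (D2 c p) (\<lambda>r v. r \<otimes> (ap v * q)))" (is "_ = ?r")
      by (rule coassoc) (intro clin)+
    finally show "?l = ?r" .
  qed (intro clin)+
  then show ?thesis by simp
qed

lemma G2_T2: "G2 t \<lhd> emb2 c = tsum (T2 \<Delta> t) (\<lambda>p q. tsum (D1 q c) (\<lambda>r v. (p * ap r) \<otimes> v))"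
proof -
  have "\<forall>t. G2 t \<lhd> emb2 c = tsum (T2 \<Delta> t) (\<lambda>p q. tsum (D1 q c) (\<lambda>r v. (p * ap r) \<otimes> v))"
  proof (rule tensor_all_eqI)
    fix x y
    have "tsum (D2 x y) (\<lambda>p q. tsum (D1 q c) (\<lambda>r v. (p * ap r) \<otimes> v)) =
        tsum (D1 y c) (\<lambda>p q. tsum (D2 x p) (\<lambda>r v. (r * ap v) \<otimes> q))"
      by (rule coassoc) (intro clin)+
    then show "G2 (x \<otimes> y) \<lhd> emb2 c =
      tsum (D2 x y) (\<lambda>p q. tsum (D1 q c) (\<lambda>r v. (p * ap r) \<otimes> v))"
      by (simp add: G2_et act_et_eq push clin)
  qed (intro clin)+
  then show ?thesis by simp
qed

subsection \<open>Regularity\<close>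

text \<open>That these products lie in \<open>A \<otimes> A\<close> is the content of
  \<open>emb_T3\<close> and \<open>emb_T4\<close>; the locale states regularity as bijectivity of
  \<open>S\<close> alone.\<close>

definition T3 :: "'a \<Rightarrow> 'a \<Rightarrow> 'a \<otimes> 'a"
  where "T3 z a = elt (\<Delta> a * emb1 z)"

definition T4 :: "'a \<Rightarrow> 'a \<Rightarrow> 'a \<otimes> 'a"
  where "T4 d a = elt (emb2 d * \<Delta> a)"

text \<open>Formally \<open>G1 t = \<Sum> a\<^sub>1 \<otimes> S(a\<^sub>2) S(d)\<close>, because the
  \<open>E\<close> in \<open>T1 \<Delta> t\<close> passes the coproduct and is absorbed in
  \<open>\<Sum> S(p) q\<close>. The second leg is \<open>S(d a\<^sub>2)\<close>, so applying
  \<open>ap'\<close> there to the element \<open>G1 t\<close> of \<open>A \<otimes> A\<close> yields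
  \<open>(1 \<otimes> d)\<Delta>(a)\<close>.\<close>

lemma regular_T4:
  assumes t: "T1 \<Delta> t = E \<rhd> (a \<otimes> ap d)"
  shows "emb (tsum (G1 t) (\<lambda>p q. p \<otimes> ap' q)) = emb2 d * \<Delta> a"
proof (rule multiplier_cancel(3))
  fix c
  have "emb1 c \<rhd> G1 t = tsum (E \<rhd> (a \<otimes> ap d)) (\<lambda>p q. tsum (D2 c p) (\<lambda>v p'. v \<otimes> tsum (p' \<otimes> q) (\<lambda>\<alpha> \<beta>. ap \<alpha> * \<beta>)))"
    by (simp add: G1_T1 t tsum_pure clin)
  also have "\<dots> = tsum (a \<otimes> ap d) (\<lambda>p q. tsum (D2 c p) (\<lambda>v p'. v \<otimes> tsum (E \<rhd> (p' \<otimes> q)) (\<lambda>\<alpha> \<beta>. ap \<alpha> * \<beta>)))"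
    by (rule E_past_source) (intro clin | simp add: T2_act act_tsum left_act_simps)+
  also have "\<dots> = tsum (D2 c a) (\<lambda>v p. v \<otimes> ap (d * p))"
    by (simp add: ap_mult_sum tsum_pure clin ap_mult)
  finally have 1: "emb1 c \<rhd> G1 t = tsum (D2 c a) (\<lambda>v p. v \<otimes> ap (d * p))" .
  have "emb1 c * emb (tsum (G1 t) (\<lambda>p q. p \<otimes> ap' q)) = emb (tsum (emb1 c \<rhd> G1 t) (\<lambda>p q. p \<otimes> ap' q))" (is "?l = _")
    by (simp only: emb_act_mult[symmetric])
      (simp add: tsum_act push clin multiplier_tensor_act left_act_simps)
  also have "\<dots> = emb (emb2 d \<rhd> D2 c a)"
    unfolding 1 by (simp add: act_tsum push clin tsum_pure left_act_simps emb_act)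
  also have "\<dots> = emb1 c * (emb2 d * \<Delta> a)" (is "_ = ?r")
    by (simp add: emb_act_mult emb_T2 multiplier_tensor_mult_assoc)
  finally show "?l = ?r" .
qed

lemma regular_T3:
  assumes t: "T2 \<Delta> t = (ap z \<otimes> a) \<lhd> E"
  shows "emb (tsum (G2 t) (\<lambda>p q. ap' p \<otimes> q)) = \<Delta> a * emb1 z"
proof (rule multiplier_cancel(2))
  fix c
  have "G2 t \<lhd> emb2 c = tsum ((ap z \<otimes> a) \<lhd> E) (\<lambda>p q. tsum (D1 q c) (\<lambda>q' v. tsum (p \<otimes> q') (\<lambda>\<alpha> \<beta>. \<alpha> * ap \<beta>) \<otimes> v))"
    by (simp add: G2_T2 t tsum_pure clin)
  also have "\<dots> = tsum (ap z \<otimes> a) (\<lambda>p q. tsum (D1 q c) (\<lambda>q' v. tsum ((p \<otimes> q') \<lhd> E) (\<lambda>\<alpha> \<beta>. \<alpha> * ap \<beta>) \<otimes> v))"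
    by (rule E_past_target_right) (intro clin | simp add: T1_act act_tsum right_act_simps)+
  also have "\<dots> = tsum (D1 a c) (\<lambda>p v. ap (p * z) \<otimes> v)"
    by (simp add: mult_ap_sum tsum_pure clin ap_mult)
  finally have 1: "G2 t \<lhd> emb2 c = tsum (D1 a c) (\<lambda>p v. ap (p * z) \<otimes> v)" .
  have "emb (tsum (G2 t) (\<lambda>p q. ap' p \<otimes> q)) * emb2 c = emb (tsum (G2 t \<lhd> emb2 c) (\<lambda>p q. ap' p \<otimes> q))" (is "?l = _")
    by (simp only: emb_act_mult[symmetric])
      (simp add: tsum_act push clin multiplier_tensor_act right_act_simps)
  also have "\<dots> = emb (D1 a c \<lhd> emb1 z)"
    unfolding 1 by (simp add: act_tsum push clin tsum_pure right_act_simps emb_act)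
  also have "\<dots> = \<Delta> a * emb1 z * emb2 c" (is "_ = ?r")
    by (simp add: emb_act_mult emb_T1 multiplier_tensor_mult mult.assoc)
  finally show "?l = ?r" .
qed

lemma emb_T4: "emb (T4 d a) = emb2 d * \<Delta> a"
  unfolding T4_def by (rule emb_elt) (metis regular_T4 E_range(1) rangeI)

lemma emb_T3: "emb (T3 z a) = \<Delta> a * emb1 z"
  unfolding T3_def by (rule emb_elt) (metis regular_T3 E_range(2) rangeI)

lemma clin_T34 [clin]:
  "clinear f \<Longrightarrow> clinear (\<lambda>x. T3 (f x) a)" "clinear f \<Longrightarrow> clinear (\<lambda>x. T3 z (f x))"
  "clinear f \<Longrightarrow> clinear (\<lambda>x. T4 (f x) a)" "clinear f \<Longrightarrow> clinear (\<lambda>x. T4 z (f x))"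
  unfolding T3_def T4_def
  by (rule clin_elt, intro clin, assumption, metis emb_T3 emb_T4 rangeI)+

lemma T1_G1: "T1 \<Delta> (G1 t) = T1 \<Delta> t"
proof -
  have "t - G1 t \<in> {t. T1 \<Delta> t = 0}" unfolding ker_T1 by simp
  then show ?thesis by (simp add: clinear_diff[OF clin_T(1)[OF clinear_ident]])
qed

text \<open>In Sweedler notation \<open>\<Sum> a\<^sub>1 \<otimes> a\<^sub>2 S(a\<^sub>3) S(d) = E(a
  \<otimes> S(d))\<close>. Applying the antipode to the second leg of \<open>T4 d a\<close> gives
  \<open>G1 t\<close>, and \<open>T1\<close> takes the same value on \<open>t\<close> and on
  \<open>G1 t\<close>.\<close>

lemma T1_antipode: "tsum (T4 d a) (\<lambda>p q. D1 p (ap q)) = E \<rhd> (a \<otimes> ap d)"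
proof -
  obtain t where t: "E \<rhd> (a \<otimes> ap d) = T1 \<Delta> t" using E_range by blast
  then have "T4 d a = tsum (G1 t) (\<lambda>p q. p \<otimes> ap' q)"
    by (intro emb_eqI[of "T4 d a"]) (simp add: regular_T4[OF t[symmetric]] emb_T4)
  then have "tsum (T4 d a) (\<lambda>p q. p \<otimes> ap q) = G1 t"
    by (simp add: tsum_pure push clin tsum_id)
  then have "T1 \<Delta> (tsum (T4 d a) (\<lambda>p q. p \<otimes> ap q)) = E \<rhd> (a \<otimes> ap d)"
    by (simp add: T1_G1 t)
  then show ?thesis
    by (subst (asm) lin_tsum[of "T1 \<Delta>"]) (intro clin)+
qed

text \<open>The uncovered form of \<open>G1_T1\<close>, available now that \<open>T4\<close>
  provides genuine tensors.\<close>

lemma G1_eq: "G1 t = tsum (T1 \<Delta> t) (\<lambda>p q. tsum (T4 (ap' q) p) (\<lambda>r v. r \<otimes> ap v))"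
proof (rule cover1_left)
  fix c
  have *: "tsum (T4 (ap' q) p) (\<lambda>r v. (c * r) \<otimes> ap v) = tsum (D2 c p) (\<lambda>r v. r \<otimes> (ap v * q))" for p q
  proof -
    have "emb1 c \<rhd> T4 (ap' q) p = emb2 (ap' q) \<rhd> D2 c p"
      by (rule emb_eqI) (simp add: emb_act_mult emb_T4 emb_T2 multiplier_tensor_mult_assoc)
    then have "tsum (emb1 c \<rhd> T4 (ap' q) p) (\<lambda>r v. r \<otimes> ap v) =
      tsum (emb2 (ap' q) \<rhd> D2 c p) (\<lambda>r v. r \<otimes> ap v)" by simp
    then show ?thesis by (simp add: tsum_act clin left_act_simps emb_act ap_mult)
  qed
  show "tsum (G1 t) (\<lambda>p v. (c * p) \<otimes> v) =
    tsum (tsum (T1 \<Delta> t) (\<lambda>p q. tsum (T4 (ap' q) p) (\<lambda>r v. r \<otimes> ap v))) (\<lambda>p v. (c * p) \<otimes> v)"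
    using G1_T1[of c t] by (simp add: act_tsum left_act_simps emb_act tsum_pure push clin *)
qed

lemma G2_eq: "G2 t = tsum (T2 \<Delta> t) (\<lambda>p q. tsum (T3 (ap' p) q) (\<lambda>r v. ap r \<otimes> v))"
proof (rule cover2_right)
  fix c
  have *: "tsum (T3 (ap' p) q) (\<lambda>r v. ap r \<otimes> (v * c)) = tsum (D1 q c) (\<lambda>r v. (p * ap r) \<otimes> v)" for p q
  proof -
    have "T3 (ap' p) q \<lhd> emb2 c = D1 q c \<lhd> emb1 (ap' p)"
      by (rule emb_eqI) (simp add: emb_act_mult emb_T3 emb_T1 multiplier_tensor_mult mult.assoc)
    then have "tsum (T3 (ap' p) q \<lhd> emb2 c) (\<lambda>r v. ap r \<otimes> v) =
      tsum (D1 q c \<lhd> emb1 (ap' p)) (\<lambda>r v. ap r \<otimes> v)" by simp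
    then show ?thesis by (simp add: tsum_act clin right_act_simps emb_act ap_mult)
  qed
  show "tsum (G2 t) (\<lambda>p v. p \<otimes> (v * c)) =
    tsum (tsum (T2 \<Delta> t) (\<lambda>p q. tsum (T3 (ap' p) q) (\<lambda>r v. ap r \<otimes> v))) (\<lambda>p v. p \<otimes> (v * c))"
    using G2_T2[of t c] by (simp add: act_tsum right_act_simps emb_act tsum_pure push clin *)
qed

subsection \<open>The antipode on the source and target algebras\<close>

abbreviation "antipode_ext \<equiv> anti_ext ap"

lemmas antipode_ext_act = anti_ext_act[OF ap_antihom bij_ap]
lemmas antipode_ext_hom = anti_ext_hom[OF ap_antihom bij_ap]

text \<open>For \<open>y = es r\<close> one has
  \<open>\<Delta>(y q) = (1 \<otimes> y)\<Delta>(q)\<close>, so in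
  \<open>\<Sum> q\<^sub>1 S(y q\<^sub>2)\<close> the factor \<open>S(y)\<close> comes out on the
  right.\<close>

lemma et_es: "et (es r \<rhd> q) = et q * antipode_ext (es r)"
  by (rule multiplier_eqI_right)
    (simp add: act_et_eq right_act_simps T2_act tsum_act push clin left_act_simps right_act_mult antipode_ext_act)

lemma es_et: "es (q \<lhd> et r) = antipode_ext (et r) * es q"
  by (rule multiplier_eqI_left)
    (simp add: es_act_eq left_act_simps T1_act tsum_act push clin right_act_simps left_act_mult antipode_ext_act)

text \<open>By \<open>E_left_et\<close> the second leg of \<open>E(a \<otimes> b)\<close> is formed
  with \<open>et\<close> of the second leg of \<open>\<Delta>(a)\<close>. By \<open>et_es\<close>, a
  factor \<open>es r\<close> in front of \<open>a\<close> therefore reappears, under the antipode,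
  in front of \<open>b\<close>.\<close>

lemma E_es_eq: "E * (es r \<otimes>\<^sub>M 1) = E * (1 \<otimes>\<^sub>M antipode_ext (es r))"
proof (rule multiplier_tensor_eqI(1))
  fix a b
  have "E \<rhd> ((es r \<rhd> a) \<otimes> b) = E \<rhd> (a \<otimes> (antipode_ext (es r) \<rhd> b))"
  proof (rule cover1_left)
    fix c
    have "emb1 c \<rhd> E \<rhd> ((es r \<rhd> a) \<otimes> b) = emb1 c \<rhd> E \<rhd> (a \<otimes> (antipode_ext (es r) \<rhd> b))"
      by (simp add: E_left_et T2_act tsum_act clin left_act_simps et_es)
    then show "tsum (E \<rhd> ((es r \<rhd> a) \<otimes> b)) (\<lambda>p v. (c * p) \<otimes> v) =
        tsum (E \<rhd> (a \<otimes> (antipode_ext (es r) \<rhd> b))) (\<lambda>p v. (c * p) \<otimes> v)"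
      by (simp add: act_tsum left_act_simps emb_act)
  qed
  then show "(E * (es r \<otimes>\<^sub>M 1)) \<rhd> (a \<otimes> b) = (E * (1 \<otimes>\<^sub>M antipode_ext (es r))) \<rhd> (a \<otimes> b)"
    by (simp add: left_act_simps multiplier_tensor_act)
qed

lemma E_et_eq: "(1 \<otimes>\<^sub>M et r) * E = (antipode_ext (et r) \<otimes>\<^sub>M 1) * E"
proof (rule multiplier_tensor_eqI(2))
  fix a b
  have "(a \<otimes> (b \<lhd> et r)) \<lhd> E = ((a \<lhd> antipode_ext (et r)) \<otimes> b) \<lhd> E"
  proof (rule cover2_right)
    fix c
    have "(a \<otimes> (b \<lhd> et r)) \<lhd> E \<lhd> emb2 c = ((a \<lhd> antipode_ext (et r)) \<otimes> b) \<lhd> E \<lhd> emb2 c"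
      by (simp add: E_right_es T1_act tsum_act clin right_act_simps es_et)
    then show "tsum ((a \<otimes> (b \<lhd> et r)) \<lhd> E) (\<lambda>v p. v \<otimes> (p * c)) =
        tsum (((a \<lhd> antipode_ext (et r)) \<otimes> b) \<lhd> E) (\<lambda>v p. v \<otimes> (p * c))"
      by (simp add: act_tsum right_act_simps emb_act)
  qed
  then show "(a \<otimes> b) \<lhd> ((1 \<otimes>\<^sub>M et r) * E) = (a \<otimes> b) \<lhd> ((antipode_ext (et r) \<otimes>\<^sub>M 1) * E)"
    by (simp add: right_act_simps multiplier_tensor_act)
qed

subsection \<open>The antipode reverses the coproduct\<close>

definition tau :: "'a \<otimes> 'a \<Rightarrow> 'a \<otimes> 'a"
  where "tau t = tsum t (\<lambda>p q. ap q \<otimes> ap p)"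

lemma clin_tau [clin]: "clinear f \<Longrightarrow> clinear (\<lambda>x. tau (f x))"
  unfolding tau_def by (intro clin)

lemma tau_pure: "tau (a \<otimes> b) = ap b \<otimes> ap a"
  unfolding tau_def by (simp add: tsum_pure clin)

lemma tau_mult: "tau (s * t) = tau t * tau s"
proof -
  have "\<forall>s. tau (s * (c \<otimes> d)) = tau (c \<otimes> d) * tau s" for c d
    by (rule tensor_all_eqI) (intro clin, intro clin, simp add: tau_pure times_tensor_pure ap_mult)
  then have "\<forall>t. tau (s * t) = tau t * tau s"
    by (intro tensor_all_eqI) (intro clin, intro clin, simp)
  then show ?thesis by simp
qed

lemma bij_tau: "bij tau"
proof (rule o_bij[of "\<lambda>t. tsum t (\<lambda>p q. ap' q \<otimes> ap' p)"])
  show "(\<lambda>t. tsum t (\<lambda>p q. ap' q \<otimes> ap' p)) \<circ> tau = id"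
    by (simp add: fun_eq_iff tau_def push clin tsum_pure tsum_id)
  show "tau \<circ> (\<lambda>t. tsum t (\<lambda>p q. ap' q \<otimes> ap' p)) = id"
    by (simp add: fun_eq_iff tau_def push clin tsum_pure tsum_id)
qed

lemma tau_antihom: "algebra_antihom tau"
  using clin_tau[OF clinear_ident] by (simp add: algebra_antihom_def tau_mult)

abbreviation "tauM \<equiv> anti_ext tau"

lemmas tauM_act = anti_ext_act[OF tau_antihom bij_tau]
lemmas tauM_hom = anti_ext_hom[OF tau_antihom bij_tau]

lemma tauM_pure: "tauM (x \<otimes>\<^sub>M y) = antipode_ext y \<otimes>\<^sub>M antipode_ext x"
proof (rule multiplier_tensor_eqI(1))
  fix a b
  show "tauM (x \<otimes>\<^sub>M y) \<rhd> (a \<otimes> b) = (antipode_ext y \<otimes>\<^sub>M antipode_ext x) \<rhd> (a \<otimes> b)"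
    using tauM_act(1)[of "x \<otimes>\<^sub>M y" "ap' b \<otimes> ap' a"] antipode_ext_act(1)[of y "ap' a"] antipode_ext_act(1)[of x "ap' b"]
    by (simp add: tau_pure multiplier_tensor_act)
qed

lemma tau_left_act: "tau ((m \<otimes>\<^sub>M n) \<rhd> t) = tau t \<lhd> (antipode_ext n \<otimes>\<^sub>M antipode_ext m)"
  and tau_right_act: "tau (t \<lhd> (m \<otimes>\<^sub>M n)) = (antipode_ext n \<otimes>\<^sub>M antipode_ext m) \<rhd> tau t"
  by (simp_all add: tauM_act[symmetric] tauM_pure)

text \<open>The pentagon identity for \<open>T1\<close>: in Sweedler notation both sides are
  \<open>\<Sum> v\<^sub>1 \<otimes> v\<^sub>2 e\<^sub>1 \<otimes> v\<^sub>3 e\<^sub>2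
  y\<close>.\<close>

lemma T1_twice:
  "tsum (D1 e y) (\<lambda>x y. tsum (D1 v y) (\<lambda>p q. tsum (D1 p x) (\<lambda>r u. r \<otimes> u \<otimes> q))) =
    tsum (D1 v e) (\<lambda>p q. p \<otimes> D1 q y)"
proof (rule cover1_left)
  fix c
  have *: "tsum (D1 v y) (\<lambda>p q. tsum (D1 p x) (\<lambda>r u. (c * r) \<otimes> u \<otimes> q)) =
      tsum (D2 c v) (\<lambda>p q. p \<otimes> (\<Delta> q \<rhd> (x \<otimes> y)))" for x y
  proof -
    have "tsum (emb1 c \<rhd> D1 p x) (\<lambda>r u. r \<otimes> u \<otimes> q) =
        tsum (D2 c p \<lhd> emb2 x) (\<lambda>r u. r \<otimes> u \<otimes> q)" for p and q :: 'a
      by (simp only: T1_cover)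
    then have "tsum (D1 p x) (\<lambda>r u. (c * r) \<otimes> u \<otimes> q) =
        tsum (D2 c p) (\<lambda>r u. r \<otimes> (u * x) \<otimes> q)" for p and q :: 'a
      by (simp add: tsum_act clin left_act_simps right_act_simps emb_act)
    then have "tsum (D1 v y) (\<lambda>p q. tsum (D1 p x) (\<lambda>r u. (c * r) \<otimes> u \<otimes> q)) =
        tsum (D1 v y) (\<lambda>p q. tsum (D2 c p) (\<lambda>r u. r \<otimes> (u * x) \<otimes> q))" by simp
    also have "\<dots> = tsum (D2 c v) (\<lambda>p q. tsum (D1 q y) (\<lambda>r u. p \<otimes> (r * x) \<otimes> u))"
      by (rule coassoc[symmetric]) (intro clin)+
    also have "\<dots> = tsum (D2 c v) (\<lambda>p q. p \<otimes> (\<Delta> q \<rhd> (x \<otimes> y)))"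
      by (simp add: Delta_act act_tsum push clin right_act_simps emb_act)
    finally show ?thesis .
  qed
  have "tsum (tsum (D1 e y) (\<lambda>x y. tsum (D1 v y) (\<lambda>p q. tsum (D1 p x) (\<lambda>r u. r \<otimes> u \<otimes> q))))
        (\<lambda>p v. (c * p) \<otimes> v) =
      tsum (D1 e y) (\<lambda>x y. tsum (D2 c v) (\<lambda>p q. p \<otimes> (\<Delta> q \<rhd> (x \<otimes> y))))" (is "?l = _")
    by (simp add: tsum_pure push clin *)
  also have "\<dots> = tsum (D2 c v) (\<lambda>p q. tsum (D1 e y) (\<lambda>x y. p \<otimes> (\<Delta> q \<rhd> (x \<otimes> y))))"
    by (rule tsum_swap) (intro clin)+
  also have "\<dots> = tsum (D2 c v) (\<lambda>p q. p \<otimes> (\<Delta> q \<rhd> tsum (D1 e y) (\<otimes>)))"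
    by (simp add: push clin)
  also have "\<dots> = tsum (D2 c v \<lhd> emb2 e) (\<lambda>p q. p \<otimes> D1 q y)"
    by (simp add: tsum_id tsum_act clin right_act_simps emb_act T1_Delta)
  also have "\<dots> = tsum (emb1 c \<rhd> D1 v e) (\<lambda>p q. p \<otimes> D1 q y)"
    by (simp only: T1_cover)
  also have "\<dots> = tsum (tsum (D1 v e) (\<lambda>p q. p \<otimes> D1 q y)) (\<lambda>p v. (c * p) \<otimes> v)" (is "_ = ?r")
    by (simp add: tsum_pure push clin tsum_act left_act_simps emb_act)
  finally show "?l = ?r" .
qed

text \<open>Contracting the first two factors of \<open>T1_twice\<close> with \<open>S(r) u\<close>
  produces \<open>es\<close>, hence \<open>(1 \<otimes> v)E\<close>, and \<open>E\<close> is
  absorbed by \<open>\<Delta>(e)\<close>.\<close>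

lemma antipode_Delta_sum: "tsum (D1 v e) (\<lambda>p q. (S p \<otimes>\<^sub>M 1) * \<Delta> q) = emb2 v * \<Delta> e"
proof (rule multiplier_cancel(2))
  fix y
  have "tsum (tsum (D1 v e) (\<lambda>p q. p \<otimes> D1 q y)) (\<lambda>r w. tsum w (\<lambda>u q. (ap r * u) \<otimes> q)) =
      tsum (tsum (D1 e y) (\<lambda>x y. tsum (D1 v y) (\<lambda>p q. tsum (D1 p x) (\<lambda>r u. r \<otimes> u \<otimes> q))))
        (\<lambda>r w. tsum w (\<lambda>u q. (ap r * u) \<otimes> q))"
    by (simp only: T1_twice)
  then have "tsum (D1 v e) (\<lambda>p q. tsum (D1 q y) (\<lambda>u q. (ap p * u) \<otimes> q)) =
      tsum (D1 e y) (\<lambda>x y. tsum (D1 v y) (\<lambda>p q. (es p \<rhd> x) \<otimes> q))"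
    by (simp add: tsum_pure push clin es_act_eq)
  also have "\<dots> = emb2 v \<rhd> E \<rhd> tsum (D1 e y) (\<otimes>)"
    by (simp add: push clin E_right_es')
  also have "\<dots> = emb2 v \<rhd> D1 e y"
    by (simp add: tsum_id E_T1)
  finally have *: "tsum (D1 v e) (\<lambda>p q. tsum (D1 q y) (\<lambda>u q. (ap p * u) \<otimes> q)) =
    (emb2 v) \<rhd> D1 e y" .
  have "tsum (D1 v e) (\<lambda>p q. (S p \<otimes>\<^sub>M 1) * \<Delta> q) * emb2 y =
      tsum (D1 v e) (\<lambda>p q. emb (emb1 (ap p) \<rhd> D1 q y))" (is "?l = _")
    by (simp add: push clin emb_act_mult emb_T1 emb_ap mult.assoc)
  also have "\<dots> = emb (tsum (D1 v e) (\<lambda>p q. tsum (D1 q y) (\<lambda>u q. (ap p * u) \<otimes> q)))"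
    by (simp add: push clin act_tsum emb_act left_act_simps)
  also have "\<dots> = emb2 v * \<Delta> e * emb2 y" (is "_ = ?r")
    by (simp add: * emb_act_mult emb_T1 mult.assoc)
  finally show "?l = ?r" .
qed

text \<open>Coassociativity for \<open>\<tau>(a\<^sub>1 z, a\<^sub>2, a\<^sub>3 y)\<close>, with the
  first factor covered from the right. A further cover \<open>c\<close> from the left reduces it to
  \<open>coassoc\<close> and is then cancelled.\<close>

lemma coassoc_T3:
  assumes "\<And>p q. clinear (\<tau> p q)" "\<And>p r. clinear (\<lambda>q. \<tau> p q r)" "\<And>q r. clinear (\<lambda>p. \<tau> p q r)"
  shows "tsum (D1 a y) (\<lambda>p q. tsum (T3 z p) (\<lambda>r v. \<tau> r v q)) =
    tsum (T3 z a) (\<lambda>r v. tsum (D1 v y) (\<tau> r))"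
proof -
  have T3: "emb1 c \<rhd> T3 z p = D2 c p \<lhd> emb1 z" for c p
    by (rule emb_eqI) (simp add: emb_act_mult emb_T3 emb_T2 mult.assoc)
  have T3_sum: "tsum (T3 z p) (\<lambda>r v. f (c * r) v) = tsum (D2 c p) (\<lambda>r v. f (r * z) v)"
    if f: "\<And>a. clinear (f a)" "\<And>b. clinear (\<lambda>a. f a b)" for c p and f :: "'a \<Rightarrow> 'a \<Rightarrow> 'c::complex_vector"
    using arg_cong[OF T3[of c p], of "\<lambda>t. tsum t f"]
    by (simp add: tsum_act f left_act_simps right_act_simps emb_act)
  have *: "tsum (D1 a y) (\<lambda>p q. tsum (T3 z p) (\<lambda>r v. r \<otimes> v \<otimes> q)) =
      tsum (T3 z a) (\<lambda>r v. tsum (D1 v y) (\<lambda>p q. r \<otimes> p \<otimes> q))"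
  proof (rule cover1_left)
    fix c
    have "tsum (tsum (D1 a y) (\<lambda>p q. tsum (T3 z p) (\<lambda>r v. r \<otimes> v \<otimes> q))) (\<lambda>p v. (c * p) \<otimes> v) =
        tsum (D1 a y) (\<lambda>p q. tsum (D2 c p) (\<lambda>r v. (r * z) \<otimes> v \<otimes> q))" (is "?l = _")
    proof -
      have "tsum (T3 z p) (\<lambda>r v. (c * r) \<otimes> v \<otimes> q) = tsum (D2 c p) (\<lambda>r v. (r * z) \<otimes> v \<otimes> q)"
        for p and q :: 'a
        by (rule T3_sum) (intro clin)+
      then show ?thesis by (simp add: tsum_pure push clin)
    qed
    also have "\<dots> = tsum (D2 c a) (\<lambda>p q. tsum (D1 q y) (\<lambda>r v. (p * z) \<otimes> r \<otimes> v))"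
      by (rule coassoc[symmetric]) (intro clin)+
    also have "\<dots> = tsum (T3 z a) (\<lambda>p v. tsum (D1 v y) (\<lambda>r v. (c * p) \<otimes> r \<otimes> v))"
      by (rule T3_sum[of "\<lambda>p v. tsum (D1 v y) (\<lambda>r v. p \<otimes> r \<otimes> v)", symmetric]) (intro clin)+
    also have "\<dots> = tsum (tsum (T3 z a) (\<lambda>r v. tsum (D1 v y) (\<lambda>p q. r \<otimes> p \<otimes> q))) (\<lambda>p v. (c * p) \<otimes> v)" (is "_ = ?r")
      by (simp add: tsum_pure push clin)
    finally show "?l = ?r" .
  qed
  note [clin] = clin_o[OF assms(1)] clin_o[OF assms(2)] clin_o[OF assms(3)]
  show ?thesis
    using arg_cong[OF *, of "\<lambda>t. tsum t (\<lambda>p w. tsum w (\<tau> p))"] by (simp add: tsum_pure push clin)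
qed

lemma T3_es: "tsum (T3 z a) (\<lambda>r v. ap r * v) = ap z \<lhd> es a"
proof (rule mult_cancel_all(1))
  fix d
  have "T3 z a \<lhd> emb2 d = D1 a d \<lhd> emb1 z"
    by (rule emb_eqI) (simp add: emb_act_mult emb_T3 emb_T1 multiplier_tensor_mult mult.assoc)
  from arg_cong[OF this, of "\<lambda>t. tsum t (\<lambda>r v. ap r * v)"]
  show "tsum (T3 z a) (\<lambda>r v. ap r * v) * d = (ap z \<lhd> es a) * d"
    by (simp add: tsum_act push clin right_act_simps emb_act act_middle es_act_eq ap_mult mult.assoc)
qed

text \<open>The left side is the sum of \<open>(S(a\<^sub>2) \<otimes> S(z) S(a\<^sub>1))
  \<Delta>(a\<^sub>3 e)\<close>. By \<open>antipode_Delta_sum\<close> the factors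
  \<open>S(a\<^sub>2)\<close> and \<open>\<Delta>(a\<^sub>3 e)\<close> combine to
  \<open>(1 \<otimes> a\<^sub>2)\<Delta>(e)\<close>, which leaves
  \<open>S(z) S(a\<^sub>1) a\<^sub>2\<close> in the second leg.\<close>

lemma tau_Delta_sum:
  "tsum (D1 a e) (\<lambda>p q. emb (tau (T3 z p)) * \<Delta> q) = (1 \<otimes>\<^sub>M (emb (ap z) * es a)) * \<Delta> e"
proof -
  have "tsum (D1 a e) (\<lambda>p q. emb (tau (T3 z p)) * \<Delta> q) =
      tsum (D1 a e) (\<lambda>p q. tsum (T3 z p) (\<lambda>r v. emb (ap v \<otimes> ap r) * \<Delta> q))"
    by (simp add: tau_def push clin)
  also have "\<dots> = tsum (T3 z a) (\<lambda>r v. tsum (D1 v e) (\<lambda>p q. emb (ap p \<otimes> ap r) * \<Delta> q))"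
    by (rule coassoc_T3) (intro clin)+
  also have "\<dots> = tsum (T3 z a) (\<lambda>r v. (emb2 (ap r)) * tsum (D1 v e) (\<lambda>p q. (S p \<otimes>\<^sub>M 1) * \<Delta> q))"
    by (simp add: push clin multiplier_tensor_mult_assoc emb_tensor emb_ap)
  also have "\<dots> = (emb2 (tsum (T3 z a) (\<lambda>r v. ap r * v))) * \<Delta> e"
    by (simp add: antipode_Delta_sum push clin multiplier_tensor_mult_assoc emb_mult)
  finally show ?thesis by (simp add: T3_es emb_act_mult)
qed

text \<open>\<open>tau_Delta_sum\<close> under another cover, \<open>S(d)\<close> in the first
  factor in place of \<open>S(z)\<close> in the second. By \<open>Delta_es_left\<close> the right
  side is \<open>(S(d) \<otimes> 1)\<Delta>(\<epsilon>\<^sub>s(a) c)(1 \<otimes> e)\<close>.\<close>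

lemma tau_T1_sum:
  "tsum (D1 a c) (\<lambda>p q. tau (D1 p d) * D1 q e) =
    (emb (ap d) \<otimes>\<^sub>M es a) \<rhd> D1 c e"
proof (rule emb_eqI, rule multiplier_cancel(4))
  fix z'
  obtain z where z: "z' = ap z" by (rule ap_cases)
  have "emb2 z' \<rhd> tau (D1 p d) = emb1 (ap d) \<rhd> tau (T3 z p)" for p
  proof -
    have "D1 p d \<lhd> emb1 z = T3 z p \<lhd> emb2 d"
      by (rule emb_eqI) (simp add: emb_act_mult emb_T3 emb_T1 multiplier_tensor_mult mult.assoc)
    from arg_cong[OF this, of tau] show ?thesis
      by (simp add: tau_right_act antipode_ext_hom z)
  qed
  then have 1: "emb2 z' * emb (tau (D1 p d)) = emb1 (ap d) * emb (tau (T3 z p))" for p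
    by (simp flip: emb_act_mult)
  have "emb2 z' * emb (tsum (D1 a c) (\<lambda>p q. tau (D1 p d) * D1 q e)) =
      tsum (D1 a c) (\<lambda>p q. (emb2 z') * emb (tau (D1 p d)) * emb (D1 q e))" (is "?l = _")
    by (simp add: push clin emb_mult mult.assoc)
  also have "\<dots> = emb1 (ap d) * tsum (D1 a c) (\<lambda>p q. emb (tau (T3 z p)) * \<Delta> q) * emb2 e"
    by (simp add: 1 push clin emb_T1 mult.assoc)
  also have "\<dots> = emb2 z' * emb ((emb (ap d) \<otimes>\<^sub>M es a) \<rhd> D1 c e)" (is "_ = ?r")
    by (simp add: tau_Delta_sum emb_act_mult emb_T1 multiplier_tensor_mult_assoc multiplier_tensor_mult mult.assoc z)
  finally show "?l = ?r" .
qed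

text \<open>\<open>E\<close> is moved through the coproduct of the first leg and then through that
  of the second, until it stands inside \<open>\<Sum> S(\<alpha>) \<beta>\<close>, which absorbs it
  by \<open>ap_mult_sum\<close>.\<close>

lemma tau_T1_E:
  "tsum (E \<rhd> (a \<otimes> c)) (\<lambda>p q. tau (D1 p d) * D1 q e) = tau (D1 a d) * D1 c e"
proof -
  \<comment> \<open>For \<open>D1 p d = \<Sum> v \<otimes> p'\<close> the product is
    \<open>\<Sum> G v (p' \<otimes> q)\<close>; in this form \<open>E\<close> can be inserted on
    \<open>p' \<otimes> q\<close>.\<close>
  define G where "G v w = tsum w (\<lambda>p' q. tsum (D1 q e) (\<lambda>q' v'. (ap p' * q') \<otimes> (ap v * v')))" for v w
  have G: "G v (E \<rhd> t) = G v t" for v t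
  proof -
    have "G v (E \<rhd> t) = tsum (E \<rhd> t) (\<lambda>p' q. tsum (D1 q e) (\<lambda>q' v'. tsum (p' \<otimes> q') (\<lambda>\<alpha> \<beta>. ap \<alpha> * \<beta>) \<otimes> (ap v * v')))"
      by (simp add: G_def tsum_pure clin)
    also have "\<dots> = tsum t (\<lambda>p' q. tsum (D1 q e) (\<lambda>q' v'. tsum (E \<rhd> (p' \<otimes> q')) (\<lambda>\<alpha> \<beta>. ap \<alpha> * \<beta>) \<otimes> (ap v * v')))"
      by (rule E_past_target) (intro clin | simp add: T1_act act_tsum left_act_simps)+
    also have "\<dots> = G v t" by (simp add: G_def ap_mult_sum)
    finally show ?thesis .
  qed
  have H: "tau (D1 p d) * D1 q e = tsum (D1 p d) (\<lambda>v p'. G v (p' \<otimes> q))" for p q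
    by (simp add: tau_def push clin mult_tsum G_def tsum_pure)
  have "tsum (E \<rhd> (a \<otimes> c)) (\<lambda>p q. tsum (D1 p d) (\<lambda>v p'. G v (p' \<otimes> q))) =
      tsum (a \<otimes> c) (\<lambda>p q. tsum (D1 p d) (\<lambda>v p'. G v (E \<rhd> (p' \<otimes> q))))"
    by (rule E_past_source) (unfold G_def, (intro clin | simp add: T1_act act_tsum left_act_simps)+)
  also have "\<dots> = tsum (D1 a d) (\<lambda>v p'. G v (p' \<otimes> c))"
    by (simp add: G) (simp add: G_def tsum_pure clin)
  finally show ?thesis by (simp add: H)
qed

text \<open>Write \<open>X(a) = S(a\<^sub>2) \<otimes> S(a\<^sub>1)\<close>. Both \<open>\<Sum> X(p) \<Delta>(q)\<close> and \<open>\<Sum> \<Delta>(S(p)) \<Delta>(q)\<close> over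
  \<open>\<Delta>(a)(1 \<otimes> c) = \<Sum> p \<otimes> q\<close> equal \<open>\<Delta>(\<epsilon>\<^sub>s(a) c)\<close>, hence they agree over \<open>E(a \<otimes> c)\<close>; there they are
  \<open>X(a) \<Delta>(c)\<close> and \<open>\<Delta>(S(a)) \<Delta>(c)\<close>.\<close>

lemma T2_ap: "D2 (ap d) (ap a) = tau (D1 a d) \<lhd> E"
proof -
  have *: "D2 (ap d) (ap a) * D1 c e = tau (D1 a d) * D1 c e" for c e
  proof -
    have T2: "D2 (ap d) (ap p) * D1 q e = D2 (ap d) (ap p * q) \<lhd> emb2 e" for p q
      by (rule emb_eqI) (simp add: emb_mult emb_act_mult emb_T1 emb_T2 Delta_mult mult.assoc)
    obtain t where t: "E \<rhd> (a \<otimes> c) = T1 \<Delta> t" using E_range by blast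
    have "\<forall>t. tsum (T1 \<Delta> t) (\<lambda>p q. tau (D1 p d) * D1 q e) =
        D2 (ap d) (tsum (T1 \<Delta> t) (\<lambda>p q. ap p * q)) \<lhd> emb2 e"
    proof (rule tensor_all_eqI)
      fix x y
      show "tsum (D1 x y) (\<lambda>p q. tau (D1 p d) * D1 q e) =
        D2 (ap d) (tsum (D1 x y) (\<lambda>p q. ap p * q)) \<lhd> emb2 e"
        unfolding tau_T1_sum es_act_eq[symmetric]
        by (rule emb_eqI) (simp add: emb_act_mult emb_T1 emb_T2 Delta_es_left multiplier_tensor_mult_assoc mult.assoc)
    qed (intro clin)+
    then have "tau (D1 a d) * D1 c e = D2 (ap d) (tsum (T1 \<Delta> t) (\<lambda>p q. ap p * q)) \<lhd> emb2 e"
      using tau_T1_E[where a = a and c = c and d = d and e = e] by (simp add: t)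
    also have "\<dots> = D2 (ap d) (ap a) * D1 c e"
      by (simp add: T2 ap_mult_sum flip: t)
    finally show ?thesis by simp
  qed
  have "\<forall>t. D2 (ap d) (ap a) * T1 \<Delta> t = tau (D1 a d) * T1 \<Delta> t"
    by (rule tensor_all_eqI) (intro clin *)+
  then have "D2 (ap d) (ap a) * (E \<rhd> t) = tau (D1 a d) * (E \<rhd> t)" for t
    using E_range(1)[of t] by auto
  then have "(D2 (ap d) (ap a) \<lhd> E) * t = (tau (D1 a d) \<lhd> E) * t" for t
    by (simp add: act_middle)
  then have "D2 (ap d) (ap a) \<lhd> E = tau (D1 a d) \<lhd> E"
    by (rule mult_cancel_all(1))
  then show ?thesis by (simp add: T2_E)
qed

lemma mult_ap_E: "tsum (t \<lhd> E) (\<lambda>p q. p * ap q) = tsum t (\<lambda>p q. p * ap q)"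
  by (induct t rule: tensor_eq_induct) (intro csubspace_eq clin, simp add: mult_ap_sum tsum_pure clin)

lemma ap_tsum: "cbilinear f \<Longrightarrow> ap (tsum t f) = tsum t (\<lambda>p q. ap (f p q))"
  by (rule lin_tsum[OF clinear_ap])

text \<open>\<open>T2_ap\<close> carries a factor \<open>E\<close>, because the invariance of
  \<open>E\<close> under \<open>tauM\<close> is not yet available. The factor disappears here since
  \<open>\<Sum> p S(q)\<close> does not see it.\<close>

lemma et_ap: "et (ap a) = antipode_ext (es a)"
proof (rule multiplier_eqI_right)
  fix d'
  obtain d where d: "d' = ap d" by (rule ap_cases)
  show "d' \<lhd> et (ap a) = d' \<lhd> antipode_ext (es a)"
    by (simp add: d act_et_eq T2_ap mult_ap_E tau_def push clin tsum_pure antipode_ext_act es_act_eq ap_tsum ap_mult)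
qed

subsection \<open>The separability idempotent\<close>

lemma E_et_star: "E * (1 \<otimes>\<^sub>M et r) = E * (es (ap' r) \<otimes>\<^sub>M 1)"
  using E_es_eq[of "ap' r"] et_ap[of "ap' r"] by simp

lemma act_E_cong:
  "E * m = E * n \<Longrightarrow> E \<rhd> m \<rhd> t = E \<rhd> n \<rhd> t"
  "m * E = n * E \<Longrightarrow> t \<lhd> m \<lhd> E = t \<lhd> n \<lhd> E"
  by (metis left_act_simps(7), metis right_act_simps(7))

text \<open>The counit turns \<open>T2\<close> into the multiplication, and \<open>T2\<close> does
  not distinguish \<open>t\<close> from \<open>G2 t\<close>.\<close>

lemma mult_G2: "tsum (G2 t) (\<lambda>p q. p * q) = tsum t (\<lambda>p q. p * q)"
proof -
  have lin [clin]: "clinear \<epsilon>" using counit by (simp add: counit_def)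
  have "\<forall>t. slice_right \<epsilon> (T2 \<Delta> t) = tsum t (\<lambda>p q. p * q)"
    by (rule tensor_all_eqI, intro clin, intro clin)
      (use counit in \<open>simp add: counit_def tsum_pure clin\<close>)
  moreover have "T2 \<Delta> (G2 t) = T2 \<Delta> t"
  proof -
    have "t - G2 t \<in> {t. T2 \<Delta> t = 0}" unfolding ker_T2 by simp
    then show ?thesis by (simp add: clinear_diff[OF clin_T(2)[OF clinear_ident]])
  qed
  ultimately show ?thesis by metis
qed

lemma mult_G1: "tsum (G1 t) (\<lambda>p q. p * q) = tsum t (\<lambda>p q. p * q)"
proof -
  have lin [clin]: "clinear \<epsilon>" using counit by (simp add: counit_def)
  have "\<forall>t. slice_left \<epsilon> (T1 \<Delta> t) = tsum t (\<lambda>p q. p * q)"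
    by (rule tensor_all_eqI, intro clin, intro clin)
      (use counit in \<open>simp add: counit_def tsum_pure clin\<close>)
  then show ?thesis using T1_G1[of t] by metis
qed

text \<open>\<open>\<Sum> \<epsilon>\<^sub>t(c\<^sub>1) c\<^sub>2 = c\<close>, read off from
  \<open>mult_G2\<close>. As \<open>A\<close> is idempotent, it shows in addition that the elements
  \<open>et p \<rhd> q\<close> span \<open>A\<close>.\<close>

lemma et_sum: "tsum (D1 c e) (\<lambda>p q. et p \<rhd> q) = c * e"
proof (rule mult_cancel_all(2))
  fix d
  have "d * tsum (D1 c e) (\<lambda>p q. et p \<rhd> q) = tsum (G2 (d \<otimes> c) \<lhd> emb2 e) (\<lambda>p q. p * q)"
    by (simp add: G2_et push clin tsum_pure act_middle)
  also have "\<dots> = tsum (G2 (d \<otimes> c)) (\<lambda>p q. p * q) * e"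
    by (simp add: tsum_act push clin right_act_simps emb_act mult.assoc)
  finally show "d * tsum (D1 c e) (\<lambda>p q. et p \<rhd> q) = d * (c * e)"
    by (simp add: mult_G2 tsum_pure clin mult.assoc)
qed

lemma es_sum: "tsum (D2 c a) (\<lambda>p q. p \<lhd> es q) = c * a"
proof (rule mult_cancel_all(1))
  fix d
  have "tsum (D2 c a) (\<lambda>p q. p \<lhd> es q) * d = tsum (emb1 c \<rhd> G1 (a \<otimes> d)) (\<lambda>p q. p * q)"
    by (simp add: G1_es push clin tsum_pure act_middle)
  also have "\<dots> = c * tsum (G1 (a \<otimes> d)) (\<lambda>p q. p * q)"
    by (simp add: tsum_act push clin left_act_simps emb_act mult.assoc)
  finally show "tsum (D2 c a) (\<lambda>p q. p \<lhd> es q) * d = c * a * d"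
    by (simp add: mult_G1 tsum_pure clin mult.assoc)
qed

text \<open>\<open>G2\<close> is multiplication by \<open>(S \<otimes> id)(E)\<close>: both maps are idempotent, and they absorb each other.\<close>

lemma G2_E: "G2 t = tsum (E \<rhd> tsum t (\<lambda>b c. ap' b \<otimes> c)) (\<lambda>p q. ap p \<otimes> q)"
proof -
  define K where "K t = tsum (E \<rhd> tsum t (\<lambda>b c. ap' b \<otimes> c)) (\<lambda>p q. ap p \<otimes> q)" for t
  have K_lin [clin]: "clinear f \<Longrightarrow> clinear (\<lambda>x. K (f x))" for f :: "_ \<Rightarrow> 'a \<otimes> 'a"
    unfolding K_def by (intro clin)
  have "K (G2 t) = G2 t" for t
  proof -
    have "E \<rhd> T3 z a = T3 z a" for z a
      by (rule emb_eqI) (simp add: emb_act_mult emb_T3 E_Delta_assoc)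
    then show ?thesis
      by (simp add: K_def G2_eq push clin tsum_pure tsum_id)
  qed
  moreover have K_G: "K (G2 (b \<otimes> c)) = K (b \<otimes> c)" for b c
  proof (rule cover2_right)
    fix e
    have K_right: "K t \<lhd> emb2 e = K (t \<lhd> emb2 e)" for t
    proof -
      have "tsum (s \<lhd> emb2 e) (\<lambda>b c. ap' b \<otimes> c) = tsum s (\<lambda>b c. ap' b \<otimes> c) \<lhd> emb2 e"
        "tsum (s \<lhd> emb2 e) (\<lambda>b c. ap b \<otimes> c) = tsum s (\<lambda>b c. ap b \<otimes> c) \<lhd> emb2 e" for s
        by (simp_all add: tsum_act push clin multiplier_tensor_act right_act_simps)
      then show ?thesis by (simp add: K_def flip: act_assoc)
    qed
    \<comment> \<open>Under \<open>ap'\<close> the right action of \<open>et p\<close> on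
      \<open>b\<close> becomes a left action of \<open>es (ap' p)\<close>, which \<open>E\<close>
      transfers to the other leg as \<open>et p\<close>.\<close>
    have K_et: "K ((b \<lhd> et p) \<otimes> q) = K (b \<otimes> (et p \<rhd> q))" for p q
    proof -
      have "b \<lhd> et p = ap (es (ap' p) \<rhd> ap' b)"
        using et_ap[of "ap' p"] antipode_ext_act(2)[of "ap' b" "es (ap' p)"] by simp
      then have "E \<rhd> (ap' (b \<lhd> et p) \<otimes> q) = E \<rhd> (es (ap' p) \<otimes>\<^sub>M 1) \<rhd> (ap' b \<otimes> q)"
        by (simp add: multiplier_tensor_act left_act_simps)
      also have "\<dots> = E \<rhd> (1 \<otimes>\<^sub>M et p) \<rhd> (ap' b \<otimes> q)"
        by (rule act_E_cong(1)) (simp add: E_et_star)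
      finally show ?thesis by (simp add: K_def tsum_pure clin multiplier_tensor_act left_act_simps)
    qed
    have K_sum: "K (b \<otimes> tsum s f) = tsum s (\<lambda>p q. K (b \<otimes> f p q))" if "cbilinear f" for s and f :: "'a \<Rightarrow> 'a \<Rightarrow> 'a"
      by (rule lin_tsum[of "\<lambda>x. K (b \<otimes> x)"]) (intro clin that)+
    have "K (G2 (b \<otimes> c)) \<lhd> emb2 e = tsum (D1 c e) (\<lambda>p q. K ((b \<lhd> et p) \<otimes> q))"
      unfolding K_right G2_et by (rule lin_tsum) (intro clin)+
    also have "\<dots> = K (b \<otimes> (c * e))"
      by (simp add: K_et et_sum flip: K_sum[OF cbilinear_lin[OF clin_act(1)[OF clinear_ident] clin_act(3)[OF clin_et[OF clinear_ident]]]])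
    also have "\<dots> = K (b \<otimes> c) \<lhd> emb2 e"
      by (simp add: K_right multiplier_tensor_act right_act_simps emb_act)
    finally show "tsum (K (G2 (b \<otimes> c))) (\<lambda>v p. v \<otimes> (p * e)) = tsum (K (b \<otimes> c)) (\<lambda>v p. v \<otimes> (p * e))"
      by (simp add: act_tsum right_act_simps emb_act)
  qed
  have "\<forall>t. K (G2 t) = K t"
    by (rule tensor_all_eqI) (intro clin K_lin[OF clinear_ident] K_G)+
  ultimately show ?thesis by (simp add: K_def)
qed

text \<open>Write \<open>\<sigma>(S \<otimes> S)E = \<Sum> S(E'\<^sub>2) \<otimes> S(E'\<^sub>1)\<close>. Since \<open>E(1 \<otimes> S(y)) = E(y \<otimes> 1)\<close> for \<open>y\<close> in the source
  algebra, its product with \<open>E\<close> from the left is \<open>E\<close>, by \<open>\<Sum> E'\<^sub>1 S(E'\<^sub>2) = 1\<close>. Dually, the same relation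
  for \<open>S\<^sup>-\<^sup>1\<close> shows that this product is also \<open>\<sigma>(S \<otimes> S)E\<close>.\<close>

lemma E_tauM: "E * tauM E = E"
proof -
  \<comment> \<open>On such \<open>u\<close>, acting by \<open>es p\<close> in the first leg and by
    its antipode in the second is the same. This transfers the first leg of the inner
    \<open>E\<close> onto \<open>z\<close>, where it meets the second leg in
    \<open>\<Sum> \<alpha> S(\<beta>)\<close> and is absorbed.\<close>
  have *: "u * tau ((a \<otimes> b) \<lhd> E) = u * (ap b \<otimes> ap a)" if u: "u \<lhd> E = u" for u a b
  proof -
    have u_es: "u \<lhd> (1 \<otimes>\<^sub>M antipode_ext (es p)) = u \<lhd> (es p \<otimes>\<^sub>M 1)" for p
      using E_es_eq[of p] u by (metis right_act_simps(7))
    have "tsum ((a \<otimes> b) \<lhd> E) (\<lambda>\<alpha> \<beta>. \<beta> \<otimes> (u \<lhd> emb2 (ap \<alpha>))) =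
        tsum u (\<lambda>z w. tsum ((z \<otimes> b) \<lhd> E) (\<lambda>\<alpha> \<beta>. \<beta> \<otimes> \<alpha> \<otimes> (w * ap a)))"
    proof (rule cover1_right)
      fix c
      have "tsum (tsum ((a \<otimes> b) \<lhd> E) (\<lambda>\<alpha> \<beta>. \<beta> \<otimes> (u \<lhd> emb2 (ap \<alpha>)))) (\<lambda>p v. (p * c) \<otimes> v) =
          tsum ((a \<otimes> b) \<lhd> E \<lhd> emb2 c) (\<lambda>\<alpha> \<beta>. \<beta> \<otimes> (u \<lhd> emb2 (ap \<alpha>)))" (is "?l = _")
        by (simp add: tsum_pure push clin tsum_act right_act_simps emb_act)
      also have "\<dots> = tsum (D1 b c) (\<lambda>p q. q \<otimes> (u \<lhd> (1 \<otimes>\<^sub>M antipode_ext (es p)) \<lhd> emb2 (ap a)))"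
      proof -
        have "u \<lhd> (emb2 (ap (a \<lhd> es p))) = u \<lhd> (1 \<otimes>\<^sub>M antipode_ext (es p)) \<lhd> emb2 (ap a)" for p
          by (simp add: multiplier_tensor_mult emb_act_mult flip: antipode_ext_act(1) right_act_simps(7))
        then show ?thesis by (simp add: E_right_es tsum_pure push clin)
      qed
      also have "\<dots> = tsum (D1 b c) (\<lambda>p q. tsum u (\<lambda>z w. q \<otimes> (z \<lhd> es p) \<otimes> (w * ap a)))"
        unfolding u_es by (simp add: act_tsum tsum_pure push clin right_act_simps emb_act)
      also have "\<dots> = tsum u (\<lambda>z w. tsum (D1 b c) (\<lambda>p q. q \<otimes> (z \<lhd> es p) \<otimes> (w * ap a)))"
        by (rule tsum_swap) (intro clin)+
      also have "\<dots> = tsum u (\<lambda>z w. tsum ((z \<otimes> b) \<lhd> E \<lhd> emb2 c) (\<lambda>\<alpha> \<beta>. \<beta> \<otimes> \<alpha> \<otimes> (w * ap a)))"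
        by (simp add: E_right_es tsum_pure push clin)
      also have "\<dots> = tsum (tsum u (\<lambda>z w. tsum ((z \<otimes> b) \<lhd> E) (\<lambda>\<alpha> \<beta>. \<beta> \<otimes> \<alpha> \<otimes> (w * ap a)))) (\<lambda>p v. (p * c) \<otimes> v)" (is "_ = ?r")
        by (simp add: tsum_pure push clin tsum_act right_act_simps emb_act)
      finally show "?l = ?r" .
    qed
    from arg_cong[OF this, of "\<lambda>x. tsum x (\<lambda>\<beta> v. tsum v (\<lambda>\<alpha> w. (\<alpha> * ap \<beta>) \<otimes> w))"]
    have "tsum ((a \<otimes> b) \<lhd> E) (\<lambda>\<alpha> \<beta>. tsum u (\<lambda>z w. (z * ap \<beta>) \<otimes> (w * ap \<alpha>))) =
        tsum u (\<lambda>z w. tsum ((z \<otimes> b) \<lhd> E) (\<lambda>\<alpha> \<beta>. (\<alpha> * ap \<beta>) \<otimes> (w * ap a)))"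
      by (simp add: tsum_pure push clin tsum_act right_act_simps emb_act)
    also have "\<dots> = tsum u (\<lambda>z w. (z * ap b) \<otimes> (w * ap a))"
      by (simp add: mult_ap_sum clin flip: push_basic(1))
    finally show ?thesis
      by (simp add: tau_def push clin mult_tsum)
  qed
  have u: "u \<lhd> E \<lhd> tauM E = u \<lhd> E" for u
  proof (rule mult_cancel_all(1))
    have t: "tauM E \<rhd> (ap b \<otimes> ap a) = tau ((a \<otimes> b) \<lhd> E)" for a b
      using tauM_act(1)[of E "a \<otimes> b"] by (simp add: tau_pure)
    have "u \<lhd> E \<lhd> E = u \<lhd> E" by (simp add: E_idem flip: right_act_simps(7))
    then have "\<forall>t. (u \<lhd> E) * (tauM E \<rhd> tau t) = (u \<lhd> E) * tau t"
      by (intro tensor_all_eqI) (intro clin, intro clin, simp add: t tau_pure *)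
    then show "(u \<lhd> E \<lhd> tauM E) * t = (u \<lhd> E) * t" for t
      using bij_tau by (metis act_middle bij_pointE)
  qed
  show ?thesis by (rule multiplier_eqI_right) (simp add: right_act_simps u)
qed

text \<open>The transfer of \<open>E_tauM\<close> with the other leg of \<open>E\<close>:
  \<open>et q\<close> passes \<open>S(z)\<close> as \<open>es (ap' q)\<close> acting on
  \<open>z\<close>, and by \<open>E_et_star\<close> this moves to \<open>w\<close> as
  \<open>et q\<close>, so that \<open>E\<close> is absorbed in
  \<open>\<Sum> \<alpha> S(\<beta>)\<close>.\<close>

lemma E_tau: "E \<rhd> tau (t \<lhd> E) = tau (t \<lhd> E)"
proof (rule mult_cancel_all(2))
  define u where "u = t \<lhd> E"
  have u: "u \<lhd> E = u" by (simp add: u_def E_idem flip: right_act_simps(7))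
  have u_et: "u \<lhd> (es (ap' q) \<otimes>\<^sub>M 1) = u \<lhd> (1 \<otimes>\<^sub>M et q)" for q
    using E_et_star[of q] u by (metis right_act_simps(7))
  have *: "((a \<otimes> b) \<lhd> E) * tau u = (a \<otimes> b) * tau u" for a b
  proof -
    have et_mult: "(b \<lhd> et q) * ap z = b * ap (z \<lhd> es (ap' q))" for q z
      using et_ap[of "ap' q"] by (simp add: act_middle antipode_ext_act)
    have "tsum ((a \<otimes> b) \<lhd> E) (\<lambda>\<alpha> \<beta>. tsum u (\<lambda>z w. \<alpha> \<otimes> w \<otimes> (\<beta> * ap z))) =
        tsum u (\<lambda>z w. tsum ((a \<otimes> w) \<lhd> E) (\<lambda>\<alpha> \<beta>. \<alpha> \<otimes> \<beta> \<otimes> (b * ap z)))"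
    proof (rule cover1_right)
      fix c
      have "tsum (tsum ((a \<otimes> b) \<lhd> E) (\<lambda>\<alpha> \<beta>. tsum u (\<lambda>z w. \<alpha> \<otimes> w \<otimes> (\<beta> * ap z)))) (\<lambda>p v. (p * c) \<otimes> v) =
          tsum ((a \<otimes> b) \<lhd> E \<lhd> emb1 c) (\<lambda>\<alpha> \<beta>. tsum u (\<lambda>z w. \<alpha> \<otimes> w \<otimes> (\<beta> * ap z)))" (is "?l = _")
        by (simp add: tsum_pure push clin tsum_act right_act_simps emb_act)
      also have "\<dots> = tsum (D2 a c) (\<lambda>p q. tsum (u \<lhd> (es (ap' q) \<otimes>\<^sub>M 1)) (\<lambda>z w. p \<otimes> w \<otimes> (b * ap z)))"
        by (simp add: E_left_et' tsum_pure push clin tsum_act right_act_simps et_mult)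
      also have "\<dots> = tsum (D2 a c) (\<lambda>p q. tsum u (\<lambda>z w. p \<otimes> (w \<lhd> et q) \<otimes> (b * ap z)))"
        unfolding u_et by (simp add: tsum_act clin right_act_simps)
      also have "\<dots> = tsum u (\<lambda>z w. tsum (D2 a c) (\<lambda>p q. p \<otimes> (w \<lhd> et q) \<otimes> (b * ap z)))"
        by (rule tsum_swap) (intro clin)+
      also have "\<dots> = tsum u (\<lambda>z w. tsum ((a \<otimes> w) \<lhd> E \<lhd> emb1 c) (\<lambda>\<alpha> \<beta>. \<alpha> \<otimes> \<beta> \<otimes> (b * ap z)))"
        by (simp add: E_left_et' tsum_pure push clin)
      also have "\<dots> = tsum (tsum u (\<lambda>z w. tsum ((a \<otimes> w) \<lhd> E) (\<lambda>\<alpha> \<beta>. \<alpha> \<otimes> \<beta> \<otimes> (b * ap z)))) (\<lambda>p v. (p * c) \<otimes> v)" (is "_ = ?r")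
        by (simp add: tsum_pure push clin tsum_act right_act_simps emb_act)
      finally show "?l = ?r" .
    qed
    from arg_cong[OF this, of "\<lambda>x. tsum x (\<lambda>\<alpha> v. tsum v (\<lambda>w m. (\<alpha> * ap w) \<otimes> m))"]
    have "tsum ((a \<otimes> b) \<lhd> E) (\<lambda>\<alpha> \<beta>. tsum u (\<lambda>z w. (\<alpha> * ap w) \<otimes> (\<beta> * ap z))) =
        tsum u (\<lambda>z w. tsum ((a \<otimes> w) \<lhd> E) (\<lambda>\<alpha> \<beta>. (\<alpha> * ap \<beta>) \<otimes> (b * ap z)))"
      by (simp add: tsum_pure push clin)
    also have "\<dots> = tsum u (\<lambda>z w. (a * ap w) \<otimes> (b * ap z))"
      by (simp add: mult_ap_sum clin flip: push_basic(1))
    also have "\<dots> = (a \<otimes> b) * tau u"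
      by (simp add: tau_def push clin times_tensor_pure)
    also have "tsum ((a \<otimes> b) \<lhd> E) (\<lambda>\<alpha> \<beta>. tsum u (\<lambda>z w. (\<alpha> * ap w) \<otimes> (\<beta> * ap z))) = ((a \<otimes> b) \<lhd> E) * tau u"
    proof -
      have "((a \<otimes> b) \<lhd> E) * tau u = tsum ((a \<otimes> b) \<lhd> E) (\<otimes>) * tau u" by (simp add: tsum_id)
      also have "\<dots> = tsum ((a \<otimes> b) \<lhd> E) (\<lambda>\<alpha> \<beta>. (\<alpha> \<otimes> \<beta>) * tau u)" by (rule push_mult(1)) (intro clin)
      finally show ?thesis by (simp add: tau_def push clin times_tensor_pure)
    qed
    finally show ?thesis .
  qed
  have "\<forall>s. (s \<lhd> E) * tau u = s * tau u"
    by (rule tensor_all_eqI) (intro clin *)+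
  then show "s * (E \<rhd> tau (t \<lhd> E)) = s * tau (t \<lhd> E)" for s
    by (simp add: u_def act_middle)
qed

lemma tauM_E: "tauM E = E"
proof -
  have "E \<rhd> tauM E \<rhd> s = tauM E \<rhd> s" for s
  proof -
    obtain t where "s = tau t" using bij_tau by (metis bij_pointE)
    then show ?thesis by (simp add: tauM_act E_tau)
  qed
  then have "E * tauM E = tauM E"
    by (intro multiplier_eqI_left) (simp add: left_act_simps)
  with E_tauM show ?thesis by simp
qed

text \<open>With \<open>E\<close> invariant under \<open>tauM\<close>, the factor \<open>E\<close>
  left over in \<open>T2_ap\<close> is absorbed by \<open>tau (D1 a d)\<close>.\<close>

lemma Delta_ap: "\<Delta> (ap a) = tauM (\<Delta> a)"
proof (rule multiplier_cancel(3))
  fix d'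
  obtain d where d: "d' = ap d" by (rule ap_cases)
  have "emb1 d' * \<Delta> (ap a) = emb (tau (D1 a d) \<lhd> tauM E)"
    by (simp add: d tauM_E flip: emb_T2 T2_ap)
  also have "\<dots> = tauM (emb (D1 a d))"
    by (simp add: tauM_act E_T1 tauM_hom)
  also have "\<dots> = emb1 d' * tauM (\<Delta> a)"
    by (simp add: emb_T1 tauM_hom tauM_pure antipode_ext_hom d)
  finally show "emb1 d' * \<Delta> (ap a) = emb1 d' * tauM (\<Delta> a)" .
qed

lemma T1_ap: "D1 (ap a) (ap d) = tau (D2 d a)"
  by (rule emb_eqI) (simp add: emb_T1 emb_T2 Delta_ap tauM_hom tauM_pure antipode_ext_hom flip: tauM_hom(4))

lemma es_ap: "es (ap a) = antipode_ext (et a)"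
proof (rule multiplier_eqI_left)
  fix d'
  obtain d where d: "d' = ap d" by (rule ap_cases)
  show "es (ap a) \<rhd> d' = antipode_ext (et a) \<rhd> d'"
    by (simp add: d es_act_eq T1_ap tau_def push clin tsum_pure antipode_ext_act act_et_eq ap_tsum ap_mult)
qed

lemma E_es_star: "(1 \<otimes>\<^sub>M et (ap' r)) * E = (es r \<otimes>\<^sub>M 1) * E"
  using E_et_eq[of "ap' r"] es_ap[of "ap' r"] by simp

text \<open>The counterpart of \<open>G2_E\<close>. It turns \<open>es\<close> into
  \<open>et\<close> through the antipode by \<open>es_ap\<close>, and so depends on
  \<open>Delta_ap\<close>, whereas \<open>G2_E\<close> gets by with \<open>et_ap\<close>.\<close>

lemma G1_E: "G1 t = tsum (tsum t (\<lambda>b c. b \<otimes> ap' c) \<lhd> E) (\<lambda>p q. p \<otimes> ap q)"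
proof -
  define K where "K t = tsum (tsum t (\<lambda>b c. b \<otimes> ap' c) \<lhd> E) (\<lambda>p q. p \<otimes> ap q)" for t
  have K_lin [clin]: "clinear f \<Longrightarrow> clinear (\<lambda>x. K (f x))" for f :: "_ \<Rightarrow> 'a \<otimes> 'a"
    unfolding K_def by (intro clin)
  have "K (G1 t) = G1 t" for t
  proof -
    have "T4 z a \<lhd> E = T4 z a" for z a
      by (rule emb_eqI) (simp add: emb_act_mult emb_T4 Delta_E mult.assoc)
    then show ?thesis
      by (simp add: K_def G1_eq push clin tsum_pure tsum_id)
  qed
  moreover have K_G: "K (G1 (a \<otimes> b)) = K (a \<otimes> b)" for a b
  proof (rule cover1_left)
    fix c
    have K_left: "emb1 c \<rhd> K t = K (emb1 c \<rhd> t)" for t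
    proof -
      have "tsum (emb1 c \<rhd> s) (\<lambda>b c. b \<otimes> ap' c) = emb1 c \<rhd> tsum s (\<lambda>b c. b \<otimes> ap' c)"
        "tsum (emb1 c \<rhd> s) (\<lambda>b c. b \<otimes> ap c) = emb1 c \<rhd> tsum s (\<lambda>b c. b \<otimes> ap c)" for s
        by (simp_all add: tsum_act push clin multiplier_tensor_act left_act_simps)
      then show ?thesis by (simp add: K_def act_assoc)
    qed
    have K_es: "K (p \<otimes> (es q \<rhd> b)) = K ((p \<lhd> es q) \<otimes> b)" for p q
    proof -
      have "es q \<rhd> b = ap (ap' b \<lhd> et (ap' q))"
        using es_ap[of "ap' q"] antipode_ext_act(1)[of "et (ap' q)" "ap' b"] by simp
      then have "(p \<otimes> ap' (es q \<rhd> b)) \<lhd> E = (p \<otimes> ap' b) \<lhd> (1 \<otimes>\<^sub>M et (ap' q)) \<lhd> E"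
        by (simp add: multiplier_tensor_act right_act_simps)
      also have "\<dots> = (p \<otimes> ap' b) \<lhd> (es q \<otimes>\<^sub>M 1) \<lhd> E"
        by (rule act_E_cong(2)) (simp add: E_es_star)
      finally show ?thesis by (simp add: K_def tsum_pure clin multiplier_tensor_act right_act_simps)
    qed
    have K_sum: "K (tsum s f \<otimes> b) = tsum s (\<lambda>p q. K (f p q \<otimes> b))" if "cbilinear f" for s and f :: "'a \<Rightarrow> 'a \<Rightarrow> 'a"
      by (rule lin_tsum[of "\<lambda>x. K (x \<otimes> b)"]) (intro clin that)+
    have "emb1 c \<rhd> K (G1 (a \<otimes> b)) = tsum (D2 c a) (\<lambda>p q. K (p \<otimes> (es q \<rhd> b)))"
      unfolding K_left G1_es by (rule lin_tsum) (intro clin)+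
    also have "\<dots> = K (tsum (D2 c a) (\<lambda>p q. p \<lhd> es q) \<otimes> b)"
      unfolding K_es by (rule K_sum[symmetric]) (intro clin)
    also have "\<dots> = emb1 c \<rhd> K (a \<otimes> b)"
      by (simp add: es_sum K_left multiplier_tensor_act left_act_simps emb_act)
    finally show "tsum (K (G1 (a \<otimes> b))) (\<lambda>p v. (c * p) \<otimes> v) = tsum (K (a \<otimes> b)) (\<lambda>p v. (c * p) \<otimes> v)"
      by (simp add: act_tsum left_act_simps emb_act)
  qed
  have "\<forall>t. K (G1 t) = K t"
    by (rule tensor_all_eqI) (intro clin K_lin[OF clinear_ident] K_G)+
  ultimately show ?thesis by (simp add: K_def)
qed

subsection \<open>The source and target algebras\<close>

lemma coprod_ext_linear: "clinear (coprod_ext \<Delta> E)"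
  using Delta_ext(1) by (simp add: algebra_hom_def)

lemma csubspace_target: "csubspace (target_algebra \<Delta> E)"
  and csubspace_source: "csubspace (source_algebra \<Delta> E)"
  unfolding target_algebra_def source_algebra_def
  by (rule csubspace_eq, rule coprod_ext_linear, intro clin)+

text \<open>Membership in the target algebra speaks of \<open>(x \<otimes> 1)E\<close> only. Since
  \<open>et (x \<rhd> a) = x * et a\<close>, the two sides agree after multiplication by
  \<open>et a \<otimes> 1\<close>, where \<open>et_E\<close> applies; by \<open>et_sum\<close> these
  multiplications reach all of \<open>A\<close>.\<close>

lemma target_E:
  assumes x: "x \<in> target_algebra \<Delta> E"
  shows "E * (x \<otimes>\<^sub>M 1) = (x \<otimes>\<^sub>M 1) * E"
proof -
  have Dx: "\<Delta> (x \<rhd> b) = (x \<otimes>\<^sub>M 1) * \<Delta> b" for b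
    using x by (simp add: target_algebra_def mult.assoc E_Delta flip: Delta_ext(5))
  have et_x: "et (x \<rhd> a) = x * et a" for a
  proof (rule multiplier_eqI_right)
    fix d
    have "D2 d (x \<rhd> a) = D2 (d \<lhd> x) a"
      by (rule emb_eqI) (simp add: emb_T2 Dx emb_act_mult multiplier_tensor_mult_assoc)
    then show "d \<lhd> et (x \<rhd> a) = d \<lhd> (x * et a)"
      by (simp add: act_et_eq right_act_simps)
  qed
  have *: "E * (x \<otimes>\<^sub>M 1) * (et a \<otimes>\<^sub>M 1) = (x \<otimes>\<^sub>M 1) * E * (et a \<otimes>\<^sub>M 1)" for a
  proof -
    have "E * (x \<otimes>\<^sub>M 1) * (et a \<otimes>\<^sub>M 1) = E * (et (x \<rhd> a) \<otimes>\<^sub>M 1)"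
      by (simp add: et_x multiplier_tensor_mult mult.assoc)
    also have "\<dots> = (x \<otimes>\<^sub>M 1) * ((et a \<otimes>\<^sub>M 1) * E)"
      using et_E[of "x \<rhd> a"] by (simp add: et_x multiplier_tensor_mult_assoc)
    finally show ?thesis by (simp add: et_E mult.assoc)
  qed
  show ?thesis
  proof (rule multiplier_tensor_eqI(1))
    fix c b
    have "\<forall>c. (E * (x \<otimes>\<^sub>M 1)) \<rhd> (c \<otimes> b) = ((x \<otimes>\<^sub>M 1) * E) \<rhd> (c \<otimes> b)"
    proof (rule product_eq_induct)
      fix a e
      have "(E * (x \<otimes>\<^sub>M 1)) \<rhd> ((et p \<rhd> q) \<otimes> b) = ((x \<otimes>\<^sub>M 1) * E) \<rhd> ((et p \<rhd> q) \<otimes> b)" for p q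
        using arg_cong[OF *[of p], of "\<lambda>m. m \<rhd> (q \<otimes> b)"]
        by (simp add: left_act_simps multiplier_tensor_act)
      then have "(E * (x \<otimes>\<^sub>M 1)) \<rhd> (tsum (D1 a e) (\<lambda>p q. et p \<rhd> q) \<otimes> b) =
          ((x \<otimes>\<^sub>M 1) * E) \<rhd> (tsum (D1 a e) (\<lambda>p q. et p \<rhd> q) \<otimes> b)"
        by (simp add: push clin)
      then show "(E * (x \<otimes>\<^sub>M 1)) \<rhd> ((a * e) \<otimes> b) = ((x \<otimes>\<^sub>M 1) * E) \<rhd> ((a * e) \<otimes> b)"
        by (simp only: et_sum)
    qed (intro clin)+
    then show "(E * (x \<otimes>\<^sub>M 1)) \<rhd> (c \<otimes> b) = ((x \<otimes>\<^sub>M 1) * E) \<rhd> (c \<otimes> b)" by simp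
  qed
qed

lemma Delta_target:
  assumes x: "x \<in> target_algebra \<Delta> E"
  shows "\<Delta> (b \<lhd> x) = \<Delta> b * (x \<otimes>\<^sub>M 1)"
proof -
  have "\<Delta> (b \<lhd> x) = \<Delta> b * coprod_ext \<Delta> E x" by (rule Delta_ext(6)[symmetric])
  also have "coprod_ext \<Delta> E x = E * (x \<otimes>\<^sub>M 1)"
    using x target_E[OF x] by (simp add: target_algebra_def)
  finally show ?thesis by (simp add: E_Delta_assoc)
qed

lemma Delta_source: "y \<in> source_algebra \<Delta> E \<Longrightarrow> \<Delta> (b \<lhd> y) = \<Delta> b * (1 \<otimes>\<^sub>M y)"
  using Delta_ext(6)[symmetric, of b y] by (simp add: source_algebra_def E_Delta_assoc)

text \<open>For \<open>(id \<otimes> \<Phi>)\<Delta>(a)\<close> the right action comes from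
  \<open>D2\<close> and the left action from \<open>T3\<close>, which is where regularity enters.
  The result gives meaning to the definite description in \<open>times_E_t\<close>.\<close>

lemma ex_right_leg_multiplier:
  assumes lin: "clinear \<Phi>"
  shows "\<exists>x. \<forall>c. (emb1 c) * x = tsum (D2 c a) (\<lambda>p q. emb p \<otimes>\<^sub>M (\<Phi> q :: 'a multiplier))"
proof -
  note [clin] = clin_o[OF lin]
  define l where "l w = tsum w (\<lambda>c d. tsum (T3 c a) (\<lambda>p q. p \<otimes> (\<Phi> q \<rhd> d)))" for w
  define r where "r w = tsum w (\<lambda>c d. tsum (D2 c a) (\<lambda>p q. p \<otimes> (d \<lhd> \<Phi> q)))" for w
  have lr_lin [clin]: "clinear f \<Longrightarrow> clinear (\<lambda>x. l (f x))" "clinear f \<Longrightarrow> clinear (\<lambda>x. r (f x))"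
    for f :: "_ \<Rightarrow> 'a \<otimes> 'a"
    unfolding l_def r_def by (intro clin; assumption)+
  have *: "r (c \<otimes> d) * (c' \<otimes> d') = (c \<otimes> d) * l (c' \<otimes> d')" for c d c' d'
  proof -
    have "D2 c a \<lhd> emb1 c' = emb1 c \<rhd> T3 c' a"
      by (rule emb_eqI) (simp add: emb_act_mult emb_T3 emb_T2 mult.assoc)
    from arg_cong[OF this, of "\<lambda>t. tsum t (\<lambda>p q. p \<otimes> (d * (\<Phi> q \<rhd> d')))"]
    show ?thesis
      by (simp add: l_def r_def tsum_pure clin push times_tensor_pure tsum_act left_act_simps
          right_act_simps emb_act act_middle)
  qed
  have "\<forall>s. r s * (c' \<otimes> d') = s * l (c' \<otimes> d')" for c' d'
    by (rule tensor_all_eqI) (intro clin *)+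
  then have "\<forall>t. r s * t = s * l t" for s
    by (intro tensor_all_eqI) (intro clin, intro clin, simp)
  then obtain x where x: "\<And>w. x \<rhd> w = l w" "\<And>w. w \<lhd> x = r w"
    using ex_multiplier[of r l] by blast
  have "emb1 c * x = tsum (D2 c a) (\<lambda>p q. emb p \<otimes>\<^sub>M \<Phi> q)" for c
  proof (rule multiplier_tensor_eqI(2))
    fix k d
    have "D2 (k * c) a = emb1 k \<rhd> D2 c a"
      by (rule emb_eqI) (simp add: emb_act_mult emb_T2 emb_mult multiplier_tensor_mult_assoc)
    then show "(k \<otimes> d) \<lhd> (emb1 c * x) = (k \<otimes> d) \<lhd> tsum (D2 c a) (\<lambda>p q. emb p \<otimes>\<^sub>M \<Phi> q)"
      by (simp add: right_act_simps multiplier_tensor_act emb_act x r_def tsum_pure push clin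
          tsum_act left_act_simps)
  qed
  then show ?thesis by blast
qed

lemma ex_left_leg_multiplier:
  assumes lin: "clinear \<Phi>"
  shows "\<exists>x. \<forall>c. x * emb2 c = tsum (D1 a c) (\<lambda>p q. (\<Phi> p :: 'a multiplier) \<otimes>\<^sub>M emb q)"
proof -
  note [clin] = clin_o[OF lin]
  define l where "l w = tsum w (\<lambda>c d. tsum (D1 a d) (\<lambda>p q. (\<Phi> p \<rhd> c) \<otimes> q))" for w
  define r where "r w = tsum w (\<lambda>c d. tsum (T4 d a) (\<lambda>p q. (c \<lhd> \<Phi> p) \<otimes> q))" for w
  have lr_lin [clin]: "clinear f \<Longrightarrow> clinear (\<lambda>x. l (f x))" "clinear f \<Longrightarrow> clinear (\<lambda>x. r (f x))"
    for f :: "_ \<Rightarrow> 'a \<otimes> 'a"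
    unfolding l_def r_def by (intro clin; assumption)+
  have *: "r (c \<otimes> d) * (c' \<otimes> d') = (c \<otimes> d) * l (c' \<otimes> d')" for c d c' d'
  proof -
    have "T4 d a \<lhd> emb2 d' = emb2 d \<rhd> D1 a d'"
      by (rule emb_eqI) (simp add: emb_act_mult emb_T4 emb_T1 mult.assoc)
    from arg_cong[OF this, of "\<lambda>t. tsum t (\<lambda>p q. (c * (\<Phi> p \<rhd> c')) \<otimes> q)"]
    show ?thesis
      by (simp add: l_def r_def tsum_pure clin push times_tensor_pure tsum_act left_act_simps
          right_act_simps emb_act act_middle)
  qed
  have "\<forall>s. r s * (c' \<otimes> d') = s * l (c' \<otimes> d')" for c' d'
    by (rule tensor_all_eqI) (intro clin *)+
  then have "\<forall>t. r s * t = s * l t" for s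
    by (intro tensor_all_eqI) (intro clin, intro clin, simp)
  then obtain x where x: "\<And>w. x \<rhd> w = l w" "\<And>w. w \<lhd> x = r w"
    using ex_multiplier[of r l] by blast
  have "x * emb2 c = tsum (D1 a c) (\<lambda>p q. \<Phi> p \<otimes>\<^sub>M emb q)" for c
  proof (rule multiplier_tensor_eqI(1))
    fix k d
    have "D1 a (c * d) = D1 a c \<lhd> emb2 d"
      by (rule emb_eqI) (simp add: emb_act_mult emb_T1 emb_mult multiplier_tensor_mult mult.assoc)
    then show "(x * emb2 c) \<rhd> (k \<otimes> d) = tsum (D1 a c) (\<lambda>p q. \<Phi> p \<otimes>\<^sub>M emb q) \<rhd> (k \<otimes> d)"
      by (simp add: left_act_simps multiplier_tensor_act emb_act x l_def tsum_pure push clin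
          tsum_act right_act_simps)
  qed
  then show ?thesis by blast
qed

text \<open>In \<open>\<Sum> S(p) q\<^sub>1 \<otimes> q\<^sub>2\<close> the idempotent passes the
  coproduct of \<open>q\<close> and is absorbed in \<open>S(p) q\<^sub>1\<close>.\<close>

lemma antipode_Delta_E:
  "tsum (E \<rhd> t) (\<lambda>p q. (S p \<otimes>\<^sub>M 1) * \<Delta> q) = tsum t (\<lambda>p q. (S p \<otimes>\<^sub>M 1) * \<Delta> q)"
proof (rule multiplier_cancel(2))
  fix y
  have *: "tsum s (\<lambda>p q. (S p \<otimes>\<^sub>M 1) * \<Delta> q) * emb2 y =
      emb (tsum s (\<lambda>p q. tsum (D1 q y) (\<lambda>q' v. tsum (p \<otimes> q') (\<lambda>\<alpha> \<beta>. ap \<alpha> * \<beta>) \<otimes> v)))" for s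
  proof -
    have "tsum s (\<lambda>p q. (S p \<otimes>\<^sub>M 1) * \<Delta> q) * emb2 y =
        tsum s (\<lambda>p q. emb (emb1 (ap p) \<rhd> D1 q y))"
      by (simp add: push clin emb_act_mult emb_T1 emb_ap mult.assoc)
    then show ?thesis by (simp add: push clin tsum_pure act_tsum emb_act left_act_simps)
  qed
  have "tsum (E \<rhd> t) (\<lambda>p q. tsum (D1 q y) (\<lambda>q' v. tsum (p \<otimes> q') (\<lambda>\<alpha> \<beta>. ap \<alpha> * \<beta>) \<otimes> v)) =
      tsum t (\<lambda>p q. tsum (D1 q y) (\<lambda>q' v. tsum (E \<rhd> (p \<otimes> q')) (\<lambda>\<alpha> \<beta>. ap \<alpha> * \<beta>) \<otimes> v))"
    by (rule E_past_target) (intro clin | simp add: T1_act act_tsum left_act_simps)+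
  then show "tsum (E \<rhd> t) (\<lambda>p q. (S p \<otimes>\<^sub>M 1) * \<Delta> q) * emb2 y =
      tsum t (\<lambda>p q. (S p \<otimes>\<^sub>M 1) * \<Delta> q) * emb2 y"
    by (simp add: * ap_mult_sum tsum_pure clin)
qed

text \<open>This is \<open>E(b \<otimes> a) = \<Sum> a\<^sub>2 S\<^sup>-\<^sup>1(a\<^sub>1) b
  \<otimes> a\<^sub>3\<close> for \<open>b = S\<^sup>-\<^sup>1(d)\<close>. It compares the two
  descriptions \<open>G2_eq\<close> and \<open>G2_E\<close> of \<open>G2 (d \<otimes> a)\<close>;
  both carry the antipode in the first leg, which \<open>ap'\<close> undoes.\<close>

lemma T3_antipode: "tsum (D2 d a) (\<lambda>p q. T3 (ap' p) q) = E \<rhd> (ap' d \<otimes> a)"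
proof -
  have "tsum (tsum (D2 d a) (\<lambda>p q. T3 (ap' p) q)) (\<lambda>p q. ap p \<otimes> q) =
      tsum (E \<rhd> (ap' d \<otimes> a)) (\<lambda>p q. ap p \<otimes> q)"
    using G2_E[of "d \<otimes> a"] by (simp add: G2_eq push clin tsum_pure)
  from arg_cong[OF this, of "\<lambda>t. tsum t (\<lambda>p q. ap' p \<otimes> q)"]
  have "tsum (tsum (D2 d a) (\<lambda>p q. T3 (ap' p) q)) (\<otimes>) = tsum (E \<rhd> (ap' d \<otimes> a)) (\<otimes>)"
    by (simp add: push_tsum clin tsum_pure)
  then show ?thesis by (simp only: tsum_id)
qed

section \<open>Faithful left cointegrals\<close>

context
  fixes h :: 'a
  assumes cointegral: "left_cointegral \<Delta> S (emb h)"
    and faithful: "faithful_cointegral \<Delta> h"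
begin

section \<open>Products of the cointegral with coproducts\<close>

lemma mult_h: "a * h = et a \<rhd> h"
  using cointegral by (intro emb_eqI[of "a * h"]) (simp add: left_cointegral_def emb_mult emb_act_mult)

lemma T1_h: "D1 a h = E \<rhd> (a \<otimes> h)"
proof (rule cover1_left)
  fix c
  have "emb1 c \<rhd> D1 a h = emb1 c \<rhd> E \<rhd> (a \<otimes> h)"
    by (simp add: T1_cover E_left_et) (simp add: act_tsum right_act_simps emb_act mult_h)
  then show "tsum (D1 a h) (\<lambda>p v. (c * p) \<otimes> v) = tsum (E \<rhd> (a \<otimes> h)) (\<lambda>p v. (c * p) \<otimes> v)"
    by (simp add: act_tsum left_act_simps emb_act)
qed

lemma Delta_1_h: "\<Delta> a * emb2 h = E * (emb a \<otimes>\<^sub>M emb h)"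
  using arg_cong[OF T1_h[of a], of emb] by (simp add: emb_T1 emb_act_mult emb_tensor)

lemma emb_Delta_h: "emb2 a * \<Delta> h = (S a \<otimes>\<^sub>M 1) * \<Delta> h"
  using antipode_Delta_sum[of a h] by (simp add: T1_h antipode_Delta_E tsum_pure clin)

lemma emb_Delta_h': "emb1 a * \<Delta> h = emb2 (antipode_inv S a) * \<Delta> h"
  using emb_Delta_h[of "ap' a"] by (simp add: antipode_inv_eq flip: emb_ap)

text \<open>For \<open>y = es r\<close> the elements \<open>a y\<close> and \<open>a S(y)\<close>
  have the same image under \<open>et\<close>, both giving
  \<open>\<Sum> a\<^sub>1 S(y) S(a\<^sub>2)\<close>. By \<open>mult_h\<close> they have the same
  product with \<open>h\<close>.\<close>

lemma es_h: "antipode_ext (es r) \<rhd> h = es r \<rhd> h"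
proof (rule mult_cancel_all(2))
  fix a
  have "et (a \<lhd> es r) = et (a \<lhd> et (ap r))"
  proof (rule multiplier_eqI_right)
    fix d
    show "d \<lhd> et (a \<lhd> es r) = d \<lhd> et (a \<lhd> et (ap r))"
      by (simp add: act_et_eq[of d] T2_act tsum_act clin right_act_simps act_middle) (simp add: et_ap antipode_ext_act)
  qed
  then have "(a \<lhd> es r) * h = (a \<lhd> antipode_ext (es r)) * h"
    by (simp add: mult_h et_ap)
  then show "a * (antipode_ext (es r) \<rhd> h) = a * (es r \<rhd> h)"
    by (simp add: act_middle)
qed

text \<open>Multiplied by \<open>b' = S(b)\<close> in the first leg, the left side is
  \<open>G2 (b' \<otimes> a)\<close> times \<open>h \<otimes> 1\<close>, because
  \<open>a\<^sub>1 h = \<epsilon>\<^sub>t(a\<^sub>1) h\<close>. \<open>G2_E\<close> expresses this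
  by \<open>E\<close> with the antipode on its first leg. For a value \<open>y\<close> of
  \<open>es\<close>, \<open>S(y b) h = S(b) S(y) h = S(b) y h\<close> by \<open>es_h\<close>, so the
  antipode can be removed from \<open>E\<close>.\<close>

lemma T3_h: "T3 h a = E \<rhd> (h \<otimes> a)"
proof (rule cover1_left)
  fix b'
  obtain b where b: "b' = ap b" by (rule ap_cases)
  have 1: "emb1 b' \<rhd> T3 h a = G2 (b' \<otimes> a) \<lhd> emb1 h"
  proof (rule cover2_right)
    fix e
    have "T3 h a \<lhd> emb2 e = D1 a e \<lhd> emb1 h"
      by (rule emb_eqI) (simp add: emb_act_mult emb_T3 emb_T1 multiplier_tensor_mult mult.assoc)
    then have "emb1 b' \<rhd> (T3 h a \<lhd> emb2 e) =
        tsum (D1 a e) (\<lambda>p q. (b' * (et p \<rhd> h)) \<otimes> q)"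
      by (simp add: act_tsum push clin tsum_pure left_act_simps right_act_simps emb_act mult_h)
    also have "\<dots> = G2 (b' \<otimes> a) \<lhd> emb2 e \<lhd> emb1 h"
      by (simp add: G2_et) (simp add: act_tsum push clin tsum_pure right_act_simps emb_act act_middle)
    also have "\<dots> = G2 (b' \<otimes> a) \<lhd> emb1 h \<lhd> emb2 e"
      by (simp add: multiplier_tensor_mult flip: right_act_simps(7))
    finally have "(emb1 b' \<rhd> T3 h a) \<lhd> emb2 e = G2 (b' \<otimes> a) \<lhd> emb1 h \<lhd> emb2 e"
      by (simp add: act_assoc)
    then show "tsum (emb1 b' \<rhd> T3 h a) (\<lambda>v p. v \<otimes> (p * e)) =
      tsum (G2 (b' \<otimes> a) \<lhd> emb1 h) (\<lambda>v p. v \<otimes> (p * e))"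
      by (simp only: act_tsum(2)[of _ 1 "emb e"] right_act_simps emb_act)
  qed
  have 2: "G2 (b' \<otimes> a) \<lhd> emb1 h = tsum (E \<rhd> (b \<otimes> a)) (\<lambda>p q. (ap p * h) \<otimes> q)"
    by (simp add: G2_E b tsum_pure clin act_tsum push right_act_simps emb_act)
  have 3: "tsum (E \<rhd> (b \<otimes> a)) (\<lambda>p q. (ap p * h) \<otimes> q) = emb1 b' \<rhd> E \<rhd> (h \<otimes> a)"
  proof (rule cover2_left)
    fix d
    have es: "ap (es p \<rhd> b) * h = b' * (es p \<rhd> h)" for p
      by (simp add: b act_middle es_h flip: antipode_ext_act(2))
    have "tsum (tsum (E \<rhd> (b \<otimes> a)) (\<lambda>p q. (ap p * h) \<otimes> q)) (\<lambda>v p. v \<otimes> (d * p)) =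
        tsum (emb2 d \<rhd> E \<rhd> (b \<otimes> a)) (\<lambda>p q. (ap p * h) \<otimes> q)" (is "?l = _")
      by (simp add: tsum_act push clin tsum_pure left_act_simps emb_act)
    also have "\<dots> = tsum (D1 d a) (\<lambda>p q. (b' * (es p \<rhd> h)) \<otimes> q)"
      by (simp add: E_right_es' push clin tsum_pure es)
    also have "\<dots> = tsum (emb2 d \<rhd> E \<rhd> (h \<otimes> a)) (\<lambda>p q. (b' * p) \<otimes> q)"
      by (simp add: E_right_es' push clin tsum_pure)
    also have "\<dots> = tsum (emb1 b' \<rhd> E \<rhd> (h \<otimes> a)) (\<lambda>v p. v \<otimes> (d * p))" (is "_ = ?r")
      by (simp add: tsum_act clin left_act_simps emb_act)
    finally show "?l = ?r" .
  qed
  have "emb1 b' \<rhd> T3 h a = emb1 b' \<rhd> E \<rhd> (h \<otimes> a)"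
    using 1 2 3 by simp
  then show "tsum (T3 h a) (\<lambda>p v. (b' * p) \<otimes> v) = tsum (E \<rhd> (h \<otimes> a)) (\<lambda>p v. (b' * p) \<otimes> v)"
    by (simp add: act_tsum left_act_simps emb_act)
qed

lemma Delta_h_1: "\<Delta> a * emb1 h = E * (emb h \<otimes>\<^sub>M emb a)"
  using arg_cong[OF T3_h[of a], of emb] by (simp add: emb_T3 emb_act_mult emb_tensor)

text \<open>\<open>S(h)\<close>, and likewise \<open>S\<^sup>-\<^sup>1(h)\<close>, is a right
  cointegral: the antipode and its inverse reverse the defining property of \<open>h\<close> and
  exchange \<open>et\<close> and \<open>es\<close>.\<close>

lemma ap_h_mult: "ap h * a = ap h \<lhd> es a"
proof -
  have "ap h * ap b = ap h \<lhd> es (ap b)" for b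
    by (simp add: mult_h es_ap antipode_ext_act flip: ap_mult)
  from this[of "ap' a"] show ?thesis by simp
qed

lemma ap'_h_mult: "ap' h * a = ap' h \<lhd> es a"
proof -
  have "ap (ap' h * a) = et (ap a) \<rhd> h" by (simp add: ap_mult mult_h)
  also have "\<dots> = ap (ap' h \<lhd> es a)" by (simp add: et_ap flip: antipode_ext_act)
  finally show ?thesis by (rule ap_eqI)
qed

lemma T2_h: "D2 (ap h) a = (ap h \<otimes> a) \<lhd> E"
proof (rule cover2_right)
  fix e
  have "D2 (ap h) a \<lhd> emb2 e = (ap h \<otimes> a) \<lhd> E \<lhd> emb2 e"
    by (simp add: E_right_es flip: T1_cover) (simp add: act_tsum left_act_simps emb_act ap_h_mult)
  then show "tsum (D2 (ap h) a) (\<lambda>v p. v \<otimes> (p * e)) = tsum ((ap h \<otimes> a) \<lhd> E) (\<lambda>v p. v \<otimes> (p * e))"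
    by (simp add: act_tsum right_act_simps emb_act)
qed

section \<open>Faithfulness and the maps \<open>gamma_t\<close> and \<open>gamma_s\<close>\<close>

lemma faithful_right: "clinear f \<Longrightarrow> (\<And>c. slice_right f (D2 c h) = 0) \<Longrightarrow> f x = 0"
  and faithful_left: "clinear f \<Longrightarrow> (\<And>c. slice_left f (D1 h c) = 0) \<Longrightarrow> f x = 0"
proof -
  assume f: "clinear f"
  have "f = (\<lambda>_. 0)"
    if "(\<forall>c. slice_right f (D2 c h) = 0) \<or> (\<forall>c. slice_left f (D1 h c) = 0)"
    using faithful that f unfolding faithful_cointegral_def by blast
  then show "(\<And>c. slice_right f (D2 c h) = 0) \<Longrightarrow> f x = 0"
    "(\<And>c. slice_left f (D1 h c) = 0) \<Longrightarrow> f x = 0"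
    by auto
qed

text \<open>If \<open>W\<close> were proper, a non-zero functional vanishing on \<open>W\<close>
  would give \<open>(f \<otimes> id)\<Delta>(h) = 0\<close>, against faithfulness. So the left leg
  of \<open>\<Delta>(h)\<close> is all of \<open>A\<close>.\<close>

lemma left_leg_h:
  assumes W: "csubspace W" and sl: "\<And>g c. clinear g \<Longrightarrow> slice_right g (D1 h c) \<in> W"
  shows "x \<in> W"
proof (rule ccontr)
  assume "x \<notin> W"
  then obtain f :: "'a \<Rightarrow> complex" where f: "clinear f" "\<forall>u\<in>W. f u = 0" "f x = 1"
    using exists_separating_functional[OF W] by blast
  have "slice_left f (D1 h c) = 0" for c
  proof (rule ccontr)
    assume "slice_left f (D1 h c) \<noteq> 0"
    then obtain g :: "'a \<Rightarrow> complex" where g: "clinear g" "g (slice_left f (D1 h c)) = 1"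
      using exists_functional by blast
    then show False using functional_slice[OF f(1) g(1), of "D1 h c"] sl[OF g(1), of c] f(2) by simp
  qed
  then show False using faithful_left[OF f(1), of x] f(3) by simp
qed

lemma right_leg_h:
  assumes W: "csubspace W" and sl: "\<And>g c. clinear g \<Longrightarrow> slice_left g (D2 c h) \<in> W"
  shows "x \<in> W"
proof (rule ccontr)
  assume "x \<notin> W"
  then obtain f :: "'a \<Rightarrow> complex" where f: "clinear f" "\<forall>u\<in>W. f u = 0" "f x = 1"
    using exists_separating_functional[OF W] by blast
  have "slice_right f (D2 c h) = 0" for c
  proof (rule ccontr)
    assume "slice_right f (D2 c h) \<noteq> 0"
    then obtain g :: "'a \<Rightarrow> complex" where g: "clinear g" "g (slice_right f (D2 c h)) = 1"
      using exists_functional by blast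
    then show False using functional_slice[OF g(1) f(1), of "D2 c h"] sl[OF g(1), of c] f(2) by simp
  qed
  then show False using faithful_right[OF f(1), of x] f(3) by simp
qed

text \<open>A functional that vanishes on \<open>h A\<^sub>t\<close> vanishes on \<open>h A\<close>, since
  \<open>(1 \<otimes> h) \<Delta>(h) = (S(h) \<otimes> 1) \<Delta>(h) = (S(h) \<otimes> h) E\<close>.\<close>

lemma ex_gamma_t: "\<exists>x. x \<in> target_algebra \<Delta> E \<and> h * a = h \<lhd> x"
proof (rule ccontr)
  let ?U = "(\<lambda>x. h \<lhd> x) ` target_algebra \<Delta> E"
  assume "\<not> ?thesis"
  then have "h * a \<notin> ?U" by auto
  moreover have "csubspace ?U"
    by (rule complex_vector_pair.linear_subspace_image[OF _ csubspace_target]) (intro clin)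
  ultimately obtain f :: "'a \<Rightarrow> complex" where f: "clinear f" "\<forall>u\<in>?U. f u = 0" "f (h * a) = 1"
    using exists_separating_functional by blast
  note [clin] = clin_o[OF f(1)]
  have "f (h * a) = 0"
  proof (rule faithful_right[where f = "\<lambda>a. f (h * a)"])
    fix c
    have "emb2 h \<rhd> D2 c h = emb1 c \<rhd> D2 (ap h) h"
    proof (rule emb_eqI)
      have "emb (emb2 h \<rhd> D2 c h) = emb1 c * (emb2 h * \<Delta> h)" (is "?l = _")
        by (simp add: emb_act_mult emb_T2 multiplier_tensor_mult_assoc)
      also have "\<dots> = emb (emb1 c \<rhd> D2 (ap h) h)" (is "_ = ?r")
        by (simp add: emb_Delta_h emb_act_mult emb_T2 emb_ap)
      finally show "?l = ?r" .
    qed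
    then have 1: "emb2 h \<rhd> D2 c h = ((c * ap h) \<otimes> h) \<lhd> E"
      by (simp add: T2_h multiplier_tensor_act left_act_simps emb_act flip: act_assoc)
    have "slice_right f (((c * ap h) \<otimes> h) \<lhd> E) = 0"
    proof (rule nondegenerate_left)
      fix a'
      have "slice_right f (((c * ap h) \<otimes> h) \<lhd> E) * a' = slice_right f (((c * ap h) \<otimes> h) \<lhd> E \<lhd> emb1 a')"
        by (simp add: slice_act f(1) emb_act)
      also have "\<dots> = tsum (D2 (c * ap h) a') (\<lambda>p q. f (h \<lhd> et q) *\<^sub>C p)"
        by (simp add: E_left_et' push_slice_right slice_right_pure f(1) clin)
      also have "\<dots> = 0"
      proof -
        have "f (h \<lhd> et q) = 0" for q using f(2) et_target[of q] by blast
        then show ?thesis using lin_tsum[of "\<lambda>_. 0 :: 'a", OF clin_basic(2) cbilinear_pure_tensor] by simp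
      qed
      finally show "slice_right f (((c * ap h) \<otimes> h) \<lhd> E) * a' = 0" .
    qed
    with 1 show "slice_right (\<lambda>a. f (h * a)) (D2 c h) = 0"
      using slice_act(3)[OF f(1), of "emb h" "D2 c h"] by (simp add: emb_act)
  qed (intro clin)
  with f(3) show False by simp
qed

text \<open>\<open>h \<lhd> x\<close> determines \<open>\<Delta>(h)(x \<otimes> 1)\<close>, and the
  left leg of \<open>\<Delta>(h)\<close> is all of \<open>A\<close>. Linearity of
  \<open>gamma_t\<close> follows from the same uniqueness.\<close>

lemma unique_gamma_t:
  assumes x: "x \<in> target_algebra \<Delta> E" and y: "y \<in> target_algebra \<Delta> E" and eq: "h \<lhd> x = h \<lhd> y"
  shows "x = y"
proof (rule multiplier_eqI_right)
  have T1: "D1 (h \<lhd> z) c = D1 h c \<lhd> (z \<otimes>\<^sub>M 1)" if "z \<in> target_algebra \<Delta> E" for z c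
    by (rule emb_eqI) (simp add: emb_T1 emb_act_mult Delta_target[OF that] multiplier_tensor_mult mult.assoc)
  have "csubspace {q. q \<lhd> x = q \<lhd> y}" by (intro csubspace_eq clin)
  moreover have "slice_right g (D1 h c) \<in> {q. q \<lhd> x = q \<lhd> y}" if "clinear g" for g c
    using T1[OF x, of c] T1[OF y, of c] eq by (simp flip: slice_act(1)[OF that])
  ultimately show "q \<lhd> x = q \<lhd> y" for q
    using left_leg_h[of "{q. q \<lhd> x = q \<lhd> y}"] by blast
qed

text \<open>A functional that vanishes on \<open>h A\<^sub>s\<close> vanishes on \<open>h A\<close>, since
  \<open>(h \<otimes> 1) \<Delta>(h) = (1 \<otimes> S\<^sup>-\<^sup>1(h)) \<Delta>(h)\<close>, which is \<open>(1 \<otimes> S\<^sup>-\<^sup>1(h)) G1(h \<otimes> \<cdot>)\<close>.\<close>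

lemma ex_gamma_s: "\<exists>y. y \<in> source_algebra \<Delta> E \<and> h * a = h \<lhd> y"
proof (rule ccontr)
  let ?U = "(\<lambda>x. h \<lhd> x) ` source_algebra \<Delta> E"
  assume "\<not> ?thesis"
  then have "h * a \<notin> ?U" by auto
  moreover have "csubspace ?U"
    by (rule complex_vector_pair.linear_subspace_image[OF _ csubspace_source]) (intro clin)
  ultimately obtain f :: "'a \<Rightarrow> complex" where f: "clinear f" "\<forall>u\<in>?U. f u = 0" "f (h * a) = 1"
    using exists_separating_functional by blast
  note [clin] = clin_o[OF f(1)]
  have "f (h * a) = 0"
  proof (rule faithful_left[where f = "\<lambda>a. f (h * a)"])
    fix c
    \<comment> \<open>As \<open>S\<^sup>-\<^sup>1(h)\<close> is a right cointegral, \<open>q\<close>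
      behind it may be replaced by \<open>es q\<close>; this is what turns \<open>D1 h c\<close>
      into \<open>G1 (h \<otimes> c)\<close>.\<close>
    have es: "ap' h * (q * c) = ap' h * (es q \<rhd> c)" for q
      unfolding mult.assoc[symmetric] ap'_h_mult[of q] by (rule act_middle)
    have "emb1 h \<rhd> D1 h c = emb2 (ap' h) \<rhd> D1 h c"
      by (rule emb_eqI) (simp add: emb_act_mult emb_T1 emb_Delta_h' antipode_inv_eq flip: mult.assoc)
    also have "\<dots> = emb2 (ap' h) \<rhd> G1 (h \<otimes> c)"
    proof (rule cover1_left)
      fix k
      have "emb1 k \<rhd> emb2 (ap' h) \<rhd> D1 h c =
          (emb2 (ap' h)) \<rhd> (D2 k h \<lhd> emb2 c)"
        by (simp add: T1_cover[symmetric]) (simp add: multiplier_tensor_mult flip: left_act_simps(7))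
      also have "\<dots> = tsum (D2 k h) (\<lambda>p q. p \<otimes> (ap' h * (es q \<rhd> c)))"
        by (simp add: act_tsum push clin tsum_pure left_act_simps right_act_simps emb_act es)
      also have "\<dots> = emb2 (ap' h) \<rhd> emb1 k \<rhd> G1 (h \<otimes> c)"
        by (simp add: G1_es) (simp add: act_tsum push clin tsum_pure left_act_simps emb_act)
      also have "\<dots> = emb1 k \<rhd> emb2 (ap' h) \<rhd> G1 (h \<otimes> c)"
        by (simp add: multiplier_tensor_mult flip: left_act_simps(7))
      finally have "emb1 k \<rhd> emb2 (ap' h) \<rhd> D1 h c =
        (emb1 k) \<rhd> emb2 (ap' h) \<rhd> G1 (h \<otimes> c)" .
      then show "tsum (emb2 (ap' h) \<rhd> D1 h c) (\<lambda>p v. (k * p) \<otimes> v) =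
        tsum (emb2 (ap' h) \<rhd> G1 (h \<otimes> c)) (\<lambda>p v. (k * p) \<otimes> v)"
        by (simp only: act_tsum(1)[of "emb k" 1] left_act_simps emb_act)
    qed
    also have "\<dots> = tsum ((h \<otimes> ap' c) \<lhd> E) (\<lambda>p q. p \<otimes> (ap' h * ap q))"
      by (simp add: G1_E act_tsum push clin tsum_pure left_act_simps emb_act)
    finally have 1: "slice_left f (emb1 h \<rhd> D1 h c) =
        ap' h * ap (slice_left f ((h \<otimes> ap' c) \<lhd> E))"
      by (simp add: tsum_pure f(1) clin slice_tsum push ap_tsum
          mult_scaleC_right clinear_scale[OF clinear_ap])
    have "slice_left f ((h \<otimes> ap' c) \<lhd> E) = 0"
    proof (rule nondegenerate_left)
      fix e
      have "slice_left f ((h \<otimes> ap' c) \<lhd> E) * e = slice_left f ((h \<otimes> ap' c) \<lhd> E \<lhd> emb2 e)"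
        by (simp add: slice_act f(1) emb_act)
      also have "\<dots> = tsum (D1 (ap' c) e) (\<lambda>p q. f (h \<lhd> es p) *\<^sub>C q)"
        by (simp add: E_right_es push_slice slice_left_pure f(1) clin)
      also have "\<dots> = 0"
      proof -
        have "f (h \<lhd> es p) = 0" for p using f(2) es_source[of p] by blast
        then show ?thesis using lin_tsum[of "\<lambda>_. 0 :: 'a", OF clin_basic(2) cbilinear_pure_tensor] by simp
      qed
      finally show "slice_left f ((h \<otimes> ap' c) \<lhd> E) * e = 0" .
    qed
    with 1 show "slice_left (\<lambda>a. f (h * a)) (D1 h c) = 0"
      using slice_act(4)[OF f(1), of "emb h" "D1 h c"]
      by (simp add: emb_act clinear_zero[OF clinear_ap])
  qed (intro clin)
  with f(3) show False by simp
qed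

lemma unique_gamma_s:
  assumes x: "x \<in> source_algebra \<Delta> E" and y: "y \<in> source_algebra \<Delta> E" and eq: "h \<lhd> x = h \<lhd> y"
  shows "x = y"
proof (rule multiplier_eqI_right)
  have T2: "D2 c (h \<lhd> z) = D2 c h \<lhd> (1 \<otimes>\<^sub>M z)" if "z \<in> source_algebra \<Delta> E" for z c
    by (rule emb_eqI) (simp add: emb_T2 emb_act_mult Delta_source[OF that] mult.assoc)
  have "csubspace {q. q \<lhd> x = q \<lhd> y}" by (intro csubspace_eq clin)
  moreover have "slice_left g (D2 c h) \<in> {q. q \<lhd> x = q \<lhd> y}" if "clinear g" for g c
    using T2[OF x, of c] T2[OF y, of c] eq by (simp flip: slice_act(2)[OF that])
  ultimately show "q \<lhd> x = q \<lhd> y" for q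
    using right_leg_h[of "{q. q \<lhd> x = q \<lhd> y}"] by blast
qed

abbreviation "gam_t \<equiv> gamma_t \<Delta> E h"
abbreviation "gam_s \<equiv> gamma_s \<Delta> E h"

lemma gamma_t: "gam_t a \<in> target_algebra \<Delta> E" "h \<lhd> gam_t a = h * a"
proof -
  have "gam_t a \<in> target_algebra \<Delta> E \<and> emb (h * a) = emb h * gam_t a"
    unfolding gamma_t_def
  proof (rule theI')
    show "\<exists>!x. x \<in> target_algebra \<Delta> E \<and> emb (h * a) = emb h * x"
      using ex_gamma_t[of a] unique_gamma_t by (auto simp: emb_eq_iff mult_emb)
  qed
  then show "gam_t a \<in> target_algebra \<Delta> E" "h \<lhd> gam_t a = h * a" by (auto simp: mult_emb emb_eq_iff)
qed

lemma gamma_s: "gam_s a \<in> source_algebra \<Delta> E" "h \<lhd> gam_s a = h * a"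
proof -
  have "gam_s a \<in> source_algebra \<Delta> E \<and> emb (h * a) = emb h * gam_s a"
    unfolding gamma_s_def
  proof (rule theI')
    show "\<exists>!x. x \<in> source_algebra \<Delta> E \<and> emb (h * a) = emb h * x"
      using ex_gamma_s[of a] unique_gamma_s by (auto simp: emb_eq_iff mult_emb)
  qed
  then show "gam_s a \<in> source_algebra \<Delta> E" "h \<lhd> gam_s a = h * a" by (auto simp: mult_emb emb_eq_iff)
qed

lemma clinear_gamma_t: "clinear gam_t"
  by (rule clinearI; rule unique_gamma_t)
    (simp_all add: gamma_t right_act_simps distrib_left mult_scaleC_right
      complex_vector.subspace_add[OF csubspace_target] complex_vector.subspace_scale[OF csubspace_target])

lemma clinear_gamma_s: "clinear gam_s"
  by (rule clinearI; rule unique_gamma_s)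
    (simp_all add: gamma_s right_act_simps distrib_left mult_scaleC_right
      complex_vector.subspace_add[OF csubspace_source] complex_vector.subspace_scale[OF csubspace_source])

lemma clin_gamma [clin]: "clinear f \<Longrightarrow> clinear (\<lambda>x. gam_t (f x))" "clinear f \<Longrightarrow> clinear (\<lambda>x. gam_s (f x))"
  by (rule clin_o[OF clinear_gamma_t] clin_o[OF clinear_gamma_s]; assumption)+

lemma times_E_t: "emb1 c * times_E_t \<Delta> E h a = tsum (D2 c a) (\<lambda>p q. emb p \<otimes>\<^sub>M gam_t q)"
proof -
  obtain x where x: "\<forall>c. (emb1 c) * x = tsum (D2 c a) (\<lambda>p q. emb p \<otimes>\<^sub>M gam_t q)"
    using ex_right_leg_multiplier[OF clinear_gamma_t] by blast
  then have "times_E_t \<Delta> E h a = x"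
    unfolding times_E_t_def by (rule the_equality) (rule multiplier_cancel(3), simp add: x)
  then show ?thesis by (simp add: x)
qed

lemma times_E_s: "times_E_s \<Delta> E h a * emb2 c = tsum (D1 a c) (\<lambda>p q. gam_s p \<otimes>\<^sub>M emb q)"
proof -
  obtain x where x: "\<forall>c. x * emb2 c = tsum (D1 a c) (\<lambda>p q. gam_s p \<otimes>\<^sub>M emb q)"
    using ex_left_leg_multiplier[OF clinear_gamma_s] by blast
  then have "times_E_s \<Delta> E h a = x"
    unfolding times_E_s_def by (rule the_equality) (rule multiplier_cancel(2), simp add: x)
  then show ?thesis by (simp add: x)
qed

section \<open>The identities with \<open>E_t\<close>, \<open>E_s\<close>, \<open>S1'\<close> and
  \<open>S2'\<close>\<close>

lemma h_Delta_t: "emb2 h * \<Delta> a = emb2 h * times_E_t \<Delta> E h a"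
proof (rule multiplier_cancel(3))
  fix c
  have "emb1 c * (emb2 h * times_E_t \<Delta> E h a) =
      (emb2 h) * (emb1 c * times_E_t \<Delta> E h a)"
    by (simp add: multiplier_tensor_mult_assoc)
  also have "\<dots> = tsum (D2 c a) (\<lambda>p q. emb (p \<otimes> (h * q)))"
    by (simp add: times_E_t push clin multiplier_tensor_mult mult_emb gamma_t emb_tensor left_act_simps)
  also have "\<dots> = emb (emb2 h \<rhd> D2 c a)"
    by (simp add: act_tsum push clin left_act_simps emb_act)
  also have "\<dots> = emb1 c * (emb2 h * \<Delta> a)"
    by (simp add: emb_act_mult emb_T2 multiplier_tensor_mult_assoc)
  finally show "emb1 c * (emb2 h * \<Delta> a) =
    (emb1 c) * (emb2 h * times_E_t \<Delta> E h a)" by simp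
qed

lemma h_Delta_s: "emb1 h * \<Delta> a = emb1 h * times_E_s \<Delta> E h a"
proof (rule multiplier_cancel(2))
  fix c
  have "emb1 h * times_E_s \<Delta> E h a * emb2 c =
      tsum (D1 a c) (\<lambda>p q. emb ((h * p) \<otimes> q))"
    by (simp add: times_E_s push clin multiplier_tensor_mult mult_emb gamma_s emb_tensor mult.assoc left_act_simps)
  also have "\<dots> = emb (emb1 h \<rhd> D1 a c)"
    by (simp add: act_tsum push clin left_act_simps emb_act)
  finally show "emb1 h * \<Delta> a * emb2 c =
      (emb1 h) * times_E_s \<Delta> E h a * emb2 c"
    by (simp add: emb_act_mult emb_T1 mult.assoc)
qed

text \<open>Since \<open>\<Delta>(h)(\<gamma>\<^sub>t(q) \<otimes> 1) = \<Delta>(h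
  \<gamma>\<^sub>t(q)) = \<Delta>(h q)\<close>, behind \<open>\<Delta>(h)\<close> the factor
  \<open>\<gamma>\<^sub>t(a\<^sub>2) \<otimes> 1\<close> may be replaced by
  \<open>\<Delta>(a\<^sub>2)\<close>. The sum is then the one in \<open>T3_antipode\<close>, and
  \<open>\<Delta>(h)\<close> absorbs the resulting \<open>E\<close>.\<close>

lemma Delta_h_S1':
  "\<Delta> h * (emb1 (tsum (D2 d a) (\<lambda>p q. gam_t q \<rhd> ap' p))) = \<Delta> h * (emb (ap' d) \<otimes>\<^sub>M emb a)"
proof -
  have *: "\<Delta> h * emb1 (gam_t q \<rhd> ap' p) = \<Delta> h * emb (T3 (ap' p) q)" for p q
  proof -
    have "\<Delta> h * emb1 (gam_t q \<rhd> ap' p) = \<Delta> h * (gam_t q \<otimes>\<^sub>M 1) * emb1 (ap' p)"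
      by (simp add: emb_act_mult multiplier_tensor_mult mult.assoc)
    also have "\<dots> = \<Delta> (h * q) * emb1 (ap' p)"
      by (simp add: gamma_t flip: Delta_target)
    finally show ?thesis by (simp add: Delta_mult emb_T3 mult.assoc)
  qed
  have "\<Delta> h * (emb1 (tsum (D2 d a) (\<lambda>p q. gam_t q \<rhd> ap' p))) =
      \<Delta> h * emb (tsum (D2 d a) (\<lambda>p q. T3 (ap' p) q))"
    by (simp add: push clin *)
  then show ?thesis
    by (simp add: T3_antipode emb_act_mult E_Delta_assoc emb_tensor)
qed

text \<open>The same replacement with
  \<open>\<Delta>(h)(1 \<otimes> \<gamma>\<^sub>s(q)) = \<Delta>(h q)\<close>; the sum is now the
  one in \<open>T1_antipode\<close>.\<close>

lemma Delta_h_S2':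
  "\<Delta> h * (emb2 (tsum (T4 d a) (\<lambda>p q. gam_s p \<rhd> ap q))) = \<Delta> h * (emb a \<otimes>\<^sub>M emb (ap d))"
proof -
  have *: "\<Delta> h * emb2 (gam_s p \<rhd> ap q) = \<Delta> h * emb (D1 p (ap q))" for p q
  proof -
    have "\<Delta> h * emb2 (gam_s p \<rhd> ap q) = \<Delta> h * (1 \<otimes>\<^sub>M gam_s p) * emb2 (ap q)"
      by (simp add: emb_act_mult multiplier_tensor_mult mult.assoc)
    also have "\<dots> = \<Delta> (h * p) * emb2 (ap q)"
      by (simp add: gamma_s flip: Delta_source)
    finally show ?thesis by (simp add: Delta_mult emb_T1 mult.assoc)
  qed
  have "\<Delta> h * (emb2 (tsum (T4 d a) (\<lambda>p q. gam_s p \<rhd> ap q))) =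
      \<Delta> h * emb (tsum (T4 d a) (\<lambda>p q. D1 p (ap q)))"
    by (simp add: push clin *)
  then show ?thesis
    by (simp add: T1_antipode emb_act_mult E_Delta_assoc emb_tensor)
qed

text \<open>The right action of \<open>S1' a\<close> is obtained from the left leg of \<open>\<Delta>(h)\<close>, which is all of \<open>A\<close>.\<close>

lemma S1'_act: "S1' \<Delta> E S h a \<rhd> ap' d = tsum (D2 d a) (\<lambda>p q. gam_t q \<rhd> ap' p)"
proof -
  \<comment> \<open>The cover is taken as \<open>d = S(b)\<close>, so that the covering factor
    \<open>S\<^sup>-\<^sup>1(d)\<close> is \<open>b\<close> itself.\<close>
  define l where "l b = tsum (D2 (ap b) a) (\<lambda>p q. gam_t q \<rhd> ap' p)" for b
  have "q \<in> {q. \<exists>r. \<forall>b. r * b = q * l b}" for q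
  proof (rule left_leg_h)
    show "csubspace {q. \<exists>r. \<forall>b. r * b = q * l b}" by (rule csubspace_right_factor)
    fix g :: "'a \<Rightarrow> complex" and c assume g: "clinear g"
    \<comment> \<open>Slicing this identity yields the partner: for \<open>q\<close> a slice of
      \<open>D1 h c\<close>, \<open>r\<close> is the same slice of
      \<open>D1 h (a * c)\<close>.\<close>
    have "D1 h (a * c) \<lhd> emb1 b = D1 h c \<lhd> emb1 (l b)" for b
    proof (rule emb_eqI)
      have "emb (D1 h c \<lhd> emb1 (l b)) = \<Delta> h * emb1 (l b) * emb2 c"
        by (simp add: emb_T1 emb_act_mult multiplier_tensor_mult mult.assoc)
      also have "\<dots> = emb (D1 h (a * c) \<lhd> emb1 b)"
        by (simp add: l_def Delta_h_S1' emb_T1 emb_act_mult emb_mult multiplier_tensor_mult mult.assoc)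
      finally show "emb (D1 h (a * c) \<lhd> emb1 b) = emb (D1 h c \<lhd> emb1 (l b))"
        by simp
    qed
    from arg_cong[OF this, of "slice_right g"]
    show "slice_right g (D1 h c) \<in> {q. \<exists>r. \<forall>b. r * b = q * l b}"
      by (auto simp: slice_act g emb_act)
  qed
  then have "\<forall>q. \<exists>r. \<forall>b. r * b = q * l b" by simp
  then obtain r where r: "\<And>q b. r q * b = q * l b" unfolding choice_iff by blast
  obtain x where x: "\<And>b. x \<rhd> b = l b"
    using ex_multiplier[of r l, OF r] by blast
  have sum: "tsum (D2 d a) (\<lambda>p q. gam_t q * emb (ap' p)) = emb (l (ap' d))" for d
    by (simp add: l_def push clin mult_emb)
  have "S1' \<Delta> E S h a = x"
    unfolding S1'_def antipode_inv_eq sum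
  proof (rule the_equality)
    show "\<forall>d. x * emb (ap' d) = emb (l (ap' d))" by (simp add: mult_emb x)
    fix y assume y: "\<forall>d. y * emb (ap' d) = emb (l (ap' d))"
    show "y = x"
    proof (rule multiplier_eqI_left)
      show "y \<rhd> b = x \<rhd> b" for b
        using y[rule_format, of "ap b"] by (simp add: mult_emb emb_eq_iff x)
    qed
  qed
  then show ?thesis by (simp add: x l_def)
qed

text \<open>Here the right leg of \<open>\<Delta>(h)\<close> is used: the partner of a slice of
  \<open>D2 c h\<close> is the same slice of \<open>D2 c h \<lhd> emb1 a\<close>.\<close>

lemma S2'_act: "S2' \<Delta> E S h a \<rhd> ap d = tsum (T4 d a) (\<lambda>p q. gam_s p \<rhd> ap q)"
proof -
  define l where "l b = tsum (T4 (ap' b) a) (\<lambda>p q. gam_s p \<rhd> ap q)" for b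
  have "q \<in> {q. \<exists>r. \<forall>b. r * b = q * l b}" for q
  proof (rule right_leg_h)
    show "csubspace {q. \<exists>r. \<forall>b. r * b = q * l b}" by (rule csubspace_right_factor)
    fix g :: "'a \<Rightarrow> complex" and c assume g: "clinear g"
    have "D2 c h \<lhd> emb1 a \<lhd> emb2 b = D2 c h \<lhd> emb2 (l b)" for b
      using Delta_h_S2'[of "ap' b" a]
      by (intro emb_eqI[of "_ \<lhd> _"]) (simp add: l_def emb_T2 emb_act_mult multiplier_tensor_mult mult.assoc)
    from arg_cong[OF this, of "slice_left g"]
    show "slice_left g (D2 c h) \<in> {q. \<exists>r. \<forall>b. r * b = q * l b}"
      by (auto simp: slice_act g emb_act)
  qed
  then have "\<forall>q. \<exists>r. \<forall>b. r * b = q * l b" by simp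
  then obtain r where r: "\<And>q b. r q * b = q * l b" unfolding choice_iff by blast
  obtain x where x: "\<And>b. x \<rhd> b = l b"
    using ex_multiplier[of r l, OF r] by blast
  have sum: "tsum (elt (emb2 d * \<Delta> a)) (\<lambda>p q. gam_s p * S q) = emb (l (ap d))" for d
    by (simp add: l_def push clin mult_emb flip: emb_ap T4_def)
  have "S2' \<Delta> E S h a = x"
    unfolding S2'_def sum
  proof (rule the_equality)
    show "\<forall>d. x * S d = emb (l (ap d))" by (simp add: mult_emb x flip: emb_ap)
    fix y assume y: "\<forall>d. y * S d = emb (l (ap d))"
    show "y = x"
    proof (rule multiplier_eqI_left)
      show "y \<rhd> b = x \<rhd> b" for b
        using y[rule_format, of "ap' b"] by (simp add: mult_emb emb_eq_iff x flip: emb_ap)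
    qed
  qed
  then show ?thesis by (simp add: x l_def)
qed

lemma Delta_h_emb: "\<Delta> h * emb2 a = \<Delta> h * (S1' \<Delta> E S h a \<otimes>\<^sub>M 1)"
proof (rule multiplier_cancel(1))
  fix b
  show "\<Delta> h * emb2 a * emb1 b = \<Delta> h * (S1' \<Delta> E S h a \<otimes>\<^sub>M 1) * emb1 b"
    using Delta_h_S1'[of "ap b" a] S1'_act[of a "ap b"]
    by (simp add: multiplier_tensor_mult mult_emb mult.assoc left_act_simps)
qed

lemma Delta_h_emb': "\<Delta> h * emb1 a = \<Delta> h * (1 \<otimes>\<^sub>M S2' \<Delta> E S h a)"
proof (rule multiplier_cancel(2))
  fix b
  show "\<Delta> h * emb1 a * emb2 b = \<Delta> h * (1 \<otimes>\<^sub>M S2' \<Delta> E S h a) * emb2 b"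
    using Delta_h_S2'[of "ap' b" a] S2'_act[of a "ap' b"]
    by (simp add: multiplier_tensor_mult mult_emb mult.assoc left_act_simps)
qed

end

end


theorem proposition4p7:
  fixes \<Delta> :: "'a::nondegenerate_algebra \<Rightarrow> ('a \<otimes> 'a) multiplier"
    and \<epsilon> :: "'a \<Rightarrow> complex"
    and E :: "('a \<otimes> 'a) multiplier"
    and G1 G2 :: "'a \<otimes> 'a \<Rightarrow> 'a \<otimes> 'a"
    and S :: "'a \<Rightarrow> 'a multiplier"
    and h a :: 'a
  assumes "regular_weak_multiplier_Hopf_algebra \<Delta> \<epsilon> E G1 G2 S"
    and "left_cointegral \<Delta> S (emb h)"
    and "faithful_cointegral \<Delta> h"
  shows
    "\<Delta> a * (1 \<otimes>\<^sub>M emb h) = E * (emb a \<otimes>\<^sub>M emb h) \<and>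
     (1 \<otimes>\<^sub>M emb h) * \<Delta> a = (1 \<otimes>\<^sub>M emb h) * times_E_t \<Delta> E h a \<and>
     \<Delta> a * (emb h \<otimes>\<^sub>M 1) = E * (emb h \<otimes>\<^sub>M emb a) \<and>
     (emb h \<otimes>\<^sub>M 1) * \<Delta> a = (emb h \<otimes>\<^sub>M 1) * times_E_s \<Delta> E h a \<and>
     (1 \<otimes>\<^sub>M emb a) * \<Delta> h = (S a \<otimes>\<^sub>M 1) * \<Delta> h \<and>
     \<Delta> h * (1 \<otimes>\<^sub>M emb a) = \<Delta> h * (S1' \<Delta> E S h a \<otimes>\<^sub>M 1) \<and>
     (emb a \<otimes>\<^sub>M 1) * \<Delta> h = (1 \<otimes>\<^sub>M emb (antipode_inv S a)) * \<Delta> h \<and>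
     \<Delta> h * (emb a \<otimes>\<^sub>M 1) = \<Delta> h * (1 \<otimes>\<^sub>M S2' \<Delta> E S h a)"
proof -
  interpret regular_weak_multiplier_Hopf_algebra \<Delta> \<epsilon> E G1 G2 S by (rule assms(1))
  note h = assms(2,3)
  show ?thesis
    by (intro conjI Delta_1_h[OF h] h_Delta_t[OF h] Delta_h_1[OF h] h_Delta_s[OF h]
        emb_Delta_h[OF h] Delta_h_emb[OF h] emb_Delta_h'[OF h] Delta_h_emb'[OF h])
qed

end
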